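(* Let $\chi_{12}$ be a nonzero holomorphic Siegel cusp form of weight $12$ on $\mathrm{Sp}_2(\mathbb{Z})$ (the space $S_{12}(\mathrm{Sp}_2(\mathbb{Z}))$ is one-dimensional). Then $\chi_{12}$ is not a Borcherds lift.
   Context: Siegel modular forms of degree $2$ are viewed as automorphic forms on the discriminant kernel $\Gamma^*(L)=\{\gamma\in G(\mathbb{R})^+ : \gamma L=L,\ \gamma|_{L^*/L}=\mathrm{Id}\}$ of the orthogonal group $G=O(2,3)$ of the even integral quadratic form $q(x)=\tfrac12\,{}^txQx$ on $L=\mathbb{Z}^5$, where $Q$ has $1$'s at positions $(1,5),(2,4),(4,2),(5,1)$, $-2$ at position $(3,3)$ and zeros elsewhere. A Borcherds lift is a meromorphic automorphic form on $\Gamma^*(L)$ whose divisor is a $\mathbb{Z}$-linear combination of Heegner divisors $H(\alpha,n)=\sum_{\lambda\in\alpha+L,\,q(\lambda)=n}\{Z: Q(\lambda,\widetilde Z)=0\}$ ($\alpha\in L^*/L$, $n\in q(\alpha)+\mathbb{Z}$, $n<0$). The form $\chi_{12}$ may be taken to be the Saito–Kurokawa lift of the Jacobi cusp form $\phi_{12,1}=\tfrac1{144}(E_4^2E_{4,1}-E_6E_{6,1})$. *)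

theory Defs
  imports "HOL-Analysis.Analysis"
begin

section \<open>Holomorphic and meromorphic functions of several complex variables\<close>

definition mv_holomorphic_on :: "(complex^'n \<Rightarrow> complex) \<Rightarrow> (complex^'n) set \<Rightarrow> bool" where
  "mv_holomorphic_on f S \<longleftrightarrow>
     (\<forall>x\<in>S. \<exists>f'. (f has_derivative f') (at x) \<and> (\<forall>c v. f' (c *s v) = c * f' v))"

definition regular_at :: "(complex^'n \<Rightarrow> complex) \<Rightarrow> complex^'n \<Rightarrow> bool" where
  "regular_at f x \<longleftrightarrow> (\<exists>V. open V \<and> x \<in> V \<and> mv_holomorphic_on f V)"

text \<open>A meromorphic function is represented by a total function that is locally a quotient
  of holomorphic functions; its values where it is not regular are irrelevant.\<close>

definition mv_meromorphic_on :: "(complex^'n \<Rightarrow> complex) \<Rightarrow> (complex^'n) set \<Rightarrow> bool" where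
  "mv_meromorphic_on f S \<longleftrightarrow>
     (\<forall>x\<in>S. \<exists>U g h. open U \<and> x \<in> U \<and> mv_holomorphic_on g U \<and> mv_holomorphic_on h U \<and>
        (\<forall>V. open V \<and> V \<noteq> {} \<and> V \<subseteq> U \<longrightarrow> (\<exists>z\<in>V. h z \<noteq> 0)) \<and>
        (\<forall>z\<in>U. h z \<noteq> 0 \<longrightarrow> f z = g z / h z))"


section \<open>Divisors\<close>

text \<open>\<open>t\<close> is a reduced equation of the hypersurface \<open>Y\<close> on the open set \<open>U\<close>: it
  cuts out \<open>Y \<inter> U\<close> and generates, at every point of \<open>U\<close>, the ideal of all germs of holomorphic
  functions vanishing on \<open>Y\<close>.\<close>

definition reduced_equation ::
  "(complex^'n) set \<Rightarrow> (complex^'n) set \<Rightarrow> (complex^'n \<Rightarrow> complex) \<Rightarrow> bool" where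
  "reduced_equation U Y t \<longleftrightarrow>
     mv_holomorphic_on t U \<and> Y \<inter> U = {z\<in>U. t z = 0} \<and>
     (\<forall>z\<in>U. \<forall>V g. open V \<and> z \<in> V \<and> V \<subseteq> U \<and> mv_holomorphic_on g V \<and> (\<forall>w\<in>V \<inter> Y. g w = 0) \<longrightarrow>
        (\<exists>W h. open W \<and> z \<in> W \<and> W \<subseteq> V \<and> mv_holomorphic_on h W \<and> (\<forall>w\<in>W. g w = t w * h w)))"

text \<open>A divisor is a formal integral combination of hypersurfaces, given by its coefficient
  function \<open>D\<close>.  The predicate below says \<open>div f = D\<close> on the open set \<open>S\<close>: \<open>D\<close> is locally finite
  and, locally, \<open>f\<close> is a nowhere vanishing holomorphic function times the product of reduced
  equations \<open>t Y\<close> of the hypersurfaces \<open>Y\<close> with exponents \<open>D Y\<close>.\<close>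

definition has_divisor ::
  "(complex^'n) set \<Rightarrow> (complex^'n \<Rightarrow> complex) \<Rightarrow> ((complex^'n) set \<Rightarrow> int) \<Rightarrow> bool" where
  "has_divisor S f D \<longleftrightarrow>
     (\<forall>x\<in>S. \<exists>U t u. open U \<and> x \<in> U \<and> U \<subseteq> S \<and>
        (let N = {Y. D Y \<noteq> 0 \<and> Y \<inter> U \<noteq> {}} in
           finite N \<and> (\<forall>Y\<in>N. reduced_equation U Y (t Y)) \<and>
           mv_holomorphic_on u U \<and> (\<forall>z\<in>U. u z \<noteq> 0) \<and>
           (\<forall>z\<in>U - \<Union>N. regular_at f z \<longrightarrow> f z = u z * (\<Prod>Y\<in>N. t Y z powi D Y))))"


section \<open>Siegel modular forms of degree 2\<close>

definition siegel_H2 :: "(complex^2^2) set" where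
  "siegel_H2 = {Z. transpose Z = Z \<and>
     (\<forall>v::real^2. v \<noteq> 0 \<longrightarrow> v \<bullet> ((\<chi> i j. Im (Z $ i $ j)) *v v) > 0)}"

definition sym_mat :: "complex^3 \<Rightarrow> complex^2^2" where
  "sym_mat z = vector [vector [z$1, z$2], vector [z$2, z$3]]"

text \<open>The upper half-space in the coordinates \<open>(z\<^sub>1, z\<^sub>2, z\<^sub>3)\<close>; this is also the tube domain on
  which the orthogonal group acts.\<close>

definition tube :: "(complex^3) set" where
  "tube = {z. sym_mat z \<in> siegel_H2}"

definition cmat :: "int^2^2 \<Rightarrow> complex^2^2" where
  "cmat A = (\<chi> i j. of_int (A $ i $ j))"

text \<open>The blocks of the matrices \<open>((A, B), (C, D))\<close> in \<open>Sp\<^sub>2(\<int>)\<close>, a group of \<open>4 \<times> 4\<close> matrices.\<close>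

definition Sp2Z :: "((int^2^2) \<times> (int^2^2) \<times> (int^2^2) \<times> (int^2^2)) set" where
  "Sp2Z = {(A, B, C, D). transpose A ** C = transpose C ** A \<and>
     transpose B ** D = transpose D ** B \<and> transpose A ** D - transpose C ** B = mat 1}"

text \<open>Holomorphy at the cusps is automatic in degree 2 by the Koecher principle.\<close>

definition siegel_modular_form :: "int \<Rightarrow> (complex^2^2 \<Rightarrow> complex) \<Rightarrow> bool" where
  "siegel_modular_form k F \<longleftrightarrow>
     mv_holomorphic_on (\<lambda>z. F (sym_mat z)) tube \<and>
     (\<forall>(A, B, C, D)\<in>Sp2Z. \<forall>Z\<in>siegel_H2.
        F ((cmat A ** Z + cmat B) ** matrix_inv (cmat C ** Z + cmat D)) =
          det (cmat C ** Z + cmat D) powi k * F Z)"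

text \<open>Cusp forms are the forms in the kernel of the Siegel operator
  \<open>(\<Phi> F)(\<tau>) = lim F(diag(\<tau>, \<i>t))\<close> as \<open>t\<close> tends to infinity.\<close>

definition siegel_cusp_form :: "int \<Rightarrow> (complex^2^2 \<Rightarrow> complex) \<Rightarrow> bool" where
  "siegel_cusp_form k F \<longleftrightarrow> siegel_modular_form k F \<and>
     (\<forall>\<tau>. Im \<tau> > 0 \<longrightarrow>
        ((\<lambda>t::real. F (sym_mat (vector [\<tau>, 0, \<i> * of_real t]))) \<longlongrightarrow> 0) at_top)"


section \<open>The orthogonal group and Borcherds lifts\<close>

definition Qmat :: "'a::comm_ring_1^5^5" where
  "Qmat = vector
     [vector [0, 0,  0, 0, 1],
      vector [0, 0,  0, 1, 0],
      vector [0, 0, -2, 0, 0],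
      vector [0, 1,  0, 0, 0],
      vector [1, 0,  0, 0, 0]]"

definition Qform :: "'a::comm_ring_1^5 \<Rightarrow> 'a^5 \<Rightarrow> 'a" where
  "Qform x y = (\<Sum>i\<in>UNIV. x $ i * (Qmat *v y) $ i)"

definition quad_q :: "real^5 \<Rightarrow> real" where
  "quad_q x = Qform x x / 2"

definition lattice_L :: "(real^5) set" where
  "lattice_L = {x. \<forall>i. x $ i \<in> \<int>}"

definition dual_L :: "(real^5) set" where
  "dual_L = {x. \<forall>y\<in>lattice_L. Qform x y \<in> \<int>}"

definition orth_group :: "(real^5^5) set" where
  "orth_group = {\<gamma>. transpose \<gamma> ** Qmat ** \<gamma> = Qmat}"

text \<open>\<open>G(\<real>)\<^sup>+\<close> is the identity component.\<close>

definition orth_plus :: "(real^5^5) set" where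
  "orth_plus = connected_component_set orth_group (mat 1)"

definition disc_kernel :: "(real^5^5) set" where
  "disc_kernel = {\<gamma>\<in>orth_plus. (\<lambda>x. \<gamma> *v x) ` lattice_L = lattice_L \<and>
     (\<forall>x\<in>dual_L. \<gamma> *v x - x \<in> lattice_L)}"

definition cvec :: "real^5 \<Rightarrow> complex^5" where
  "cvec x = (\<chi> i. of_real (x $ i))"

text \<open>The isotropic vector \<open>Z\<close> with a tilde: \<open>(- (z\<^sub>1 z\<^sub>3 - z\<^sub>2\<^sup>2), z\<^sub>1, z\<^sub>2, z\<^sub>3, 1)\<close>.\<close>

definition tilde :: "complex^3 \<Rightarrow> complex^5" where
  "tilde z = vector [- (z$1 * z$3 - z$2 * z$2), z$1, z$2, z$3, 1]"

text \<open>The action \<open>w = \<gamma>\<langle>z\<rangle>\<close> and the factor \<open>j = j(\<gamma>, z)\<close> are determined by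
  \<open>\<gamma> (tilde z) = j (tilde w)\<close>.  For meromorphic \<open>F\<close> the transformation law is imposed wherever
  both sides are regular.  Meromorphy at the boundary is automatic.\<close>

definition meromorphic_automorphic_form :: "int \<Rightarrow> (complex^3 \<Rightarrow> complex) \<Rightarrow> bool" where
  "meromorphic_automorphic_form k F \<longleftrightarrow> mv_meromorphic_on F tube \<and>
     (\<forall>\<gamma>\<in>disc_kernel. \<forall>z\<in>tube. \<forall>w\<in>tube. \<forall>j.
        (\<chi> i l. complex_of_real (\<gamma> $ i $ l)) *v tilde z = j *s tilde w \<and>
        regular_at F z \<and> regular_at F w \<longrightarrow> F w = j powi k * F z)"

definition rat_quad_divisor :: "real^5 \<Rightarrow> (complex^3) set" where
  "rat_quad_divisor l = {z\<in>tube. Qform (cvec l) (tilde z) = 0}"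

text \<open>The coefficient function of \<open>H(\<alpha>, n)\<close>.  The sum runs over all \<open>\<lambda>\<close>, so \<open>\<lambda>\<close> and \<open>-\<lambda>\<close>
  both contribute when they lie in the same coset.\<close>

definition heegner :: "real^5 \<Rightarrow> real \<Rightarrow> (complex^3) set \<Rightarrow> int" where
  "heegner \<alpha> n Y = int (card {l. l - \<alpha> \<in> lattice_L \<and> quad_q l = n \<and> rat_quad_divisor l = Y})"

definition heegner_index :: "((real^5) \<times> real) set" where
  "heegner_index = {(\<alpha>, n). \<alpha> \<in> dual_L \<and> n - quad_q \<alpha> \<in> \<int> \<and> n < 0}"

definition borcherds_lift :: "(complex^3 \<Rightarrow> complex) \<Rightarrow> bool" where
  "borcherds_lift F \<longleftrightarrow> (\<exists>k. meromorphic_automorphic_form k F) \<and>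
     (\<exists>I (c :: (real^5) \<times> real \<Rightarrow> int). finite I \<and> I \<subseteq> heegner_index \<and>
        has_divisor tube F (\<lambda>Y. \<Sum>(\<alpha>, n)\<in>I. c (\<alpha>, n) * heegner \<alpha> n Y))"

end

theory Submission
  imports Defs "HOL-Complex_Analysis.Complex_Analysis" "HOL-Real_Asymp.Real_Asymp"
begin

no_notation fps_nth (infixl "$" 75)

text \<open>
  Write \<open>F\<close> for the cusp form on the tube domain and expand it along the diagonal \<open>z\<^sub>2 = 0\<close>. The
  coefficient of the lowest power \<open>z\<^sub>2 ^ m\<close> is, in each outer variable, a modular form of weight
  \<open>12 + m\<close> for \<open>SL\<^sub>2(\<int>)\<close>. The maximum principle and the invariance under the Jacobi group show that
  a zero of high order on the diagonal forces fast decay at the cusp, too fast for a nonzero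
  modular form of that weight unless \<open>m = 0\<close>. Hence \<open>F\<close> does not vanish on the diagonal, where it
  has the form \<open>f(z\<^sub>1) f(z\<^sub>3)\<close> up to a constant because cusp forms of weight 12 are unique up to scalars; in particular
  \<open>F\<close> does not vanish identically on any curve \<open>(\<tau>, 0, M \<tau>)\<close> with \<open>M > 0\<close>.

  The coefficient of a rational quadratic divisor \<open>\<lambda>\<close>-perp, \<open>\<lambda>\<close> primitive, in a combination of
  Heegner divisors depends only on \<open>q(\<lambda>)\<close>, and every value of \<open>q\<close> is attained by a primitive vector
  whose divisor contains such a curve. So if \<open>F\<close> were a Borcherds lift, its divisor would be empty and
  \<open>F\<close> would be nowhere zero. But then \<open>F\<close> has a logarithm, whose translation periods vanish
  by \<open>GL\<^sub>2(\<int>)\<close>-invariance, and comparing the fixed points of order 4 and 6 of the modular group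
  contradicts the nonzero weight.
\<close>

section \<open>Modular forms of one variable\<close>

text \<open>The argument rests on a balance of constants. At z1 = i y the Jacobi group moves z2 into
  |z2|^2 <= (1 + y^2)/4, and a zero of order 2 j on the diagonal then gives decay at a rate as close
  as desired to 8 y j / (1 + y^2) per unit of height, which is best at y = 1, where it is 4 j. A
  rate above pi j is needed: decay faster than exp (-2 pi l t) with l = floor (j/2) already means
  order l + 1 at the cusp. The proof settles for 16/5 j on 1 <= y <= 11/10, an interval so that the
  identity theorem carries vanishing to all z1. Comparing sup norms kills forms of weight k and cusp
  order n when k <= 9 n (the valence formula would allow k < 12 n), and 12 + 2 j <= 9 (1 + floor
  (j/2)) holds for every j >= 2. Only j = 1 escapes, which is why weight 14 with order 1 needs its
  own argument. On the arithmetic side, the dual lattice modulo L has order 2 and q modulo 1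
  separates its two classes, so a coset carries no information beyond the norm; this is why
  multiplicities see only q(lambda).\<close>

definition uhp :: "complex set" where
  "uhp = {\<tau>. Im \<tau> > 0}"

definition nome :: "complex \<Rightarrow> complex" where
  "nome \<tau> = exp (2 * of_real pi * \<i> * \<tau>)"

definition weakly_modular :: "nat \<Rightarrow> (complex \<Rightarrow> complex) \<Rightarrow> bool" where
  "weakly_modular k f \<longleftrightarrow> f holomorphic_on uhp \<and>
     (\<forall>\<tau>\<in>uhp. f (\<tau> + 1) = f \<tau> \<and> f (- 1 / \<tau>) = \<tau> ^ k * f \<tau>)"

text \<open>\<open>h\<close> is the q-expansion with \<open>nome \<tau> ^ n\<close> divided out;
  \<open>h 0\<close> may be zero, so \<open>n\<close> is only a lower bound for the order at the
  cusp.\<close>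

definition vanishes_at_infinity :: "nat \<Rightarrow> (complex \<Rightarrow> complex) \<Rightarrow> bool" where
  "vanishes_at_infinity n f \<longleftrightarrow>
     (\<exists>h. h holomorphic_on ball 0 1 \<and> (\<forall>\<tau>\<in>uhp. f \<tau> = nome \<tau> ^ n * h (nome \<tau>)))"

section \<open>The upper half-plane, the nome and reduction by the modular group\<close>

lemma open_uhp: "open uhp"
  unfolding uhp_def by (simp add: open_halfspace_Im_gt)

lemma connected_uhp: "connected uhp"
  unfolding uhp_def by (simp add: convex_connected convex_halfspace_Im_gt)

lemma norm_nome: "norm (nome \<tau>) = exp (- 2 * pi * Im \<tau>)"
  by (simp add: nome_def)

lemma nome_in_ball: "\<tau> \<in> uhp \<Longrightarrow> nome \<tau> \<in> ball 0 1"
  by (simp add: norm_nome uhp_def)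

lemma nome_nonzero [simp]: "nome \<tau> \<noteq> 0"
  by (simp add: nome_def)

lemma nome_surj:
  assumes "q \<noteq> 0"
  obtains \<tau> where "nome \<tau> = q" "Im \<tau> = - ln (norm q) / (2 * pi)"
proof -
  define \<tau> where "\<tau> = Ln q / (2 * of_real pi * \<i>)"
  have "2 * of_real pi * \<i> * \<tau> = Ln q"
    by (simp add: \<tau>_def)
  hence 1: "nome \<tau> = q" using assms by (simp add: nome_def)
  hence "norm q = exp (- 2 * pi * Im \<tau>)" using norm_nome by metis
  hence "ln (norm q) = - 2 * pi * Im \<tau>" by simp
  hence "Im \<tau> = - ln (norm q) / (2 * pi)" by (simp add: field_simps)
  with 1 show thesis using that by blast
qed

lemma minus_inverse_in_uhp:
  assumes "\<tau> \<in> uhp"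
  shows "- 1 / \<tau> \<in> uhp" "Im (- 1 / \<tau>) = Im \<tau> / (norm \<tau>)\<^sup>2"
proof -
  have "\<tau> \<noteq> 0" using assms by (auto simp: uhp_def)
  show 1: "Im (- 1 / \<tau>) = Im \<tau> / (norm \<tau>)\<^sup>2"
    by (simp add: Im_divide cmod_power2)
  show "- 1 / \<tau> \<in> uhp"
    using 1 assms \<open>\<tau> \<noteq> 0\<close> unfolding uhp_def mem_Collect_eq by simp
qed

lemma periodic_int_translate:
  fixes f :: "complex \<Rightarrow> 'a"
  assumes "\<And>\<tau>. \<tau> \<in> uhp \<Longrightarrow> f (\<tau> + 1) = f \<tau>" "\<tau> \<in> uhp"
  shows "f (\<tau> + of_int n) = f \<tau>"
proof (induction n rule: int_induct[where k = 0])
  case (step1 i)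
  have "\<tau> + of_int i \<in> uhp" using assms by (simp add: uhp_def)
  from assms(1)[OF this] step1 show ?case by (simp add: add.assoc)
next
  case (step2 i)
  have "\<tau> + of_int (i - 1) \<in> uhp" using assms by (simp add: uhp_def)
  from assms(1)[OF this] step2 show ?case by simp
qed simp

text \<open>The imaginary part grows by a definite factor as long as it stays below \<open>17/20\<close>, a
  convenient number below \<open>sqrt 3 / 2\<close>; this makes the reduction terminate.\<close>

lemma modular_reduction:
  fixes \<psi> :: "complex \<Rightarrow> 'a"
  assumes T: "\<And>\<tau>. \<tau> \<in> uhp \<Longrightarrow> \<psi> (\<tau> + 1) = \<psi> \<tau>"
    and S: "\<And>\<tau>. \<tau> \<in> uhp \<Longrightarrow> \<psi> (- 1 / \<tau>) = \<psi> \<tau>"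
    and "\<tau> \<in> uhp"
  shows "\<exists>\<sigma>. Im \<sigma> \<ge> 17/20 \<and> \<psi> \<sigma> = \<psi> \<tau>"
proof -
  have *: "\<exists>\<sigma>. Im \<sigma> \<ge> 17/20 \<and> \<psi> \<sigma> = \<psi> \<tau>" if "Im \<tau> * 1.02 ^ n \<ge> 17/20" "\<tau> \<in> uhp" for n \<tau>
    using that
  proof (induction n arbitrary: \<tau>)
    case (Suc n)
    show ?case
    proof (cases "Im \<tau> \<ge> 17/20")
      case False
      define \<rho> where "\<rho> = \<tau> + of_int (- round (Re \<tau>))"
      have \<rho>: "\<rho> \<in> uhp" "\<psi> \<rho> = \<psi> \<tau>" "Im \<rho> = Im \<tau>"
        using Suc.prems periodic_int_translate[of \<psi> \<tau> "- round (Re \<tau>)", OF T] by (auto simp: \<rho>_def uhp_def)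
      have "\<bar>Re \<rho>\<bar> \<le> 1/2"
        using of_int_round_abs_le[of "Re \<tau>"] by (simp add: \<rho>_def abs_minus_commute)
      hence "(Re \<rho>)\<^sup>2 \<le> (1/2)\<^sup>2"
        by (metis abs_le_square_iff abs_of_nonneg zero_le_divide_1_iff zero_le_numeral)
      moreover have "(Im \<rho>)\<^sup>2 \<le> (17/20)\<^sup>2"
        using False \<rho> by (intro power_mono) (auto simp: uhp_def)
      \<comment> \<open>1/4 + (17/20)^2 = 389/400 lies below 1/1.02; this gap is the source of the
        growth factor 1.02.\<close>
      ultimately have n: "(norm \<rho>)\<^sup>2 \<le> 1/1.02"
        unfolding cmod_power2 by (simp add: power2_eq_square)
      have "Im \<rho> > 0" "\<rho> \<noteq> 0" using \<rho> by (auto simp: uhp_def)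
      hence "1.02 * Im \<rho> \<le> Im (- 1 / \<rho>)"
        unfolding minus_inverse_in_uhp(2)[OF \<rho>(1)]
        using mult_left_mono[OF n, of "1.02 * Im \<rho>"] by (simp add: field_simps)
      hence "1.02 * Im \<tau> * 1.02 ^ n \<le> Im (- 1 / \<rho>) * 1.02 ^ n"
        using \<rho> by (intro mult_right_mono) auto
      hence "Im (- 1 / \<rho>) * 1.02 ^ n \<ge> 17/20"
        using Suc.prems by (simp add: algebra_simps)
      from Suc.IH[OF this minus_inverse_in_uhp(1)[OF \<rho>(1)]] S[OF \<rho>(1)] \<rho>(2)
      show ?thesis by simp
    qed auto
  qed auto
  obtain n where "17/20 / Im \<tau> < 1.02 ^ n"
    using real_arch_pow[of "1.02" "17/20 / Im \<tau>"] by auto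
  hence "Im \<tau> * 1.02 ^ n \<ge> 17/20"
    using assms(3) by (simp add: uhp_def field_simps)
  from *[OF this assms(3)] show ?thesis .
qed

section \<open>The invariant norm and its supremum\<close>

text \<open>This is the square of the Petersson norm: the factor |tau|^(2 k) from the weight cancels
  the one from Im (-1/tau) = Im tau / |tau|^2.\<close>

lemma modular_invariant_norm:
  assumes "weakly_modular k f" "\<tau> \<in> uhp"
  shows "Im (\<tau> + 1) ^ k * (norm (f (\<tau> + 1)))\<^sup>2 = Im \<tau> ^ k * (norm (f \<tau>))\<^sup>2"
    and "Im (- 1 / \<tau>) ^ k * (norm (f (- 1 / \<tau>)))\<^sup>2 = Im \<tau> ^ k * (norm (f \<tau>))\<^sup>2"
proof -
  have "\<tau> \<noteq> 0" using assms by (auto simp: uhp_def)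
  have 1: "f (\<tau> + 1) = f \<tau>" "f (- 1 / \<tau>) = \<tau> ^ k * f \<tau>"
    using assms unfolding weakly_modular_def by blast+
  show "Im (\<tau> + 1) ^ k * (norm (f (\<tau> + 1)))\<^sup>2 = Im \<tau> ^ k * (norm (f \<tau>))\<^sup>2"
    unfolding 1 by simp
  show "Im (- 1 / \<tau>) ^ k * (norm (f (- 1 / \<tau>)))\<^sup>2 = Im \<tau> ^ k * (norm (f \<tau>))\<^sup>2"
    unfolding 1 minus_inverse_in_uhp(2)[OF assms(2)] using \<open>\<tau> \<noteq> 0\<close>
    by (simp add: norm_mult norm_power power_divide power_mult_distrib
        flip: power_mult) (simp add: mult.commute)
qed

lemma power_exp_bounded:
  fixes c :: real
  assumes "c > 0"
  shows "\<exists>B. \<forall>y\<ge>0. y ^ k * exp (- c * y) \<le> B"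
proof (cases "k = 0")
  case False
  have "y ^ k * exp (- c * y) \<le> (real k / c) ^ k" if "y \<ge> 0" for y
  proof -
    have "(c * y / real k) ^ k \<le> (1 + c * y / real k) ^ k"
      using that assms by (intro power_mono) auto
    also have "\<dots> \<le> exp (c * y)"
    proof (rule exp_ge_one_plus_x_over_n_power_n)
      have "0 \<le> c * y" using that assms by simp
      thus "- real k \<le> c * y" by linarith
    qed (use False in simp)
    finally show ?thesis using assms False
      by (simp add: exp_minus power_mult_distrib power_divide field_simps)
  qed
  thus ?thesis by blast
qed (use assms in \<open>auto intro!: exI[of _ 1]\<close>)

text \<open>By reduction it suffices to look at Im tau >= 17/20. There the nome stays in a compact
  disc, so \<open>h\<close> is bounded, and one factor of the nome, available since n > 0, beats the
  power of Im tau.\<close>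

lemma modular_norm_bounded:
  assumes f: "weakly_modular k f" "vanishes_at_infinity n f" and "n > 0"
  shows "\<exists>B. \<forall>\<tau>\<in>uhp. Im \<tau> ^ k * (norm (f \<tau>))\<^sup>2 \<le> B"
proof -
  obtain h where h: "h holomorphic_on ball 0 1" "\<And>\<tau>. \<tau> \<in> uhp \<Longrightarrow> f \<tau> = nome \<tau> ^ n * h (nome \<tau>)"
    using f(2) unfolding vanishes_at_infinity_def by blast
  define R where "R = exp (- 2 * pi * (17/20))"
  have "R < 1" by (simp add: R_def)
  have "compact (h ` cball 0 R)"
    using \<open>R < 1\<close> by (intro compact_continuous_image holomorphic_on_imp_continuous_on
        holomorphic_on_subset[OF h(1)]) auto
  then obtain C where C: "\<And>q. norm q \<le> R \<Longrightarrow> norm (h q) \<le> C"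
    by (metis compact_imp_bounded bounded_iff image_eqI mem_cball_0)
  obtain B where B: "\<And>y. y \<ge> 0 \<Longrightarrow> y ^ k * exp (- (4 * pi) * y) \<le> B"
    using power_exp_bounded[of "4 * pi" k] by auto
  have *: "Im \<tau> ^ k * (norm (f \<tau>))\<^sup>2 \<le> B * C\<^sup>2" if "Im \<tau> \<ge> 17/20" for \<tau>
  proof -
    have \<tau>: "\<tau> \<in> uhp" using that by (simp add: uhp_def)
    have "norm (nome \<tau>) \<le> R" using that by (simp add: R_def norm_nome)
    hence 1: "(norm (h (nome \<tau>)))\<^sup>2 \<le> C\<^sup>2" using C by (intro power_mono) auto
    have "norm (nome \<tau>) ^ n \<le> norm (nome \<tau>) ^ 1"
      using nome_in_ball[OF \<tau>] \<open>n > 0\<close> by (intro power_decreasing) auto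
    hence "(norm (nome \<tau>) ^ n)\<^sup>2 \<le> (norm (nome \<tau>))\<^sup>2"
      by (intro power_mono) auto
    also have "\<dots> = exp (- (4 * pi) * Im \<tau>)"
      by (simp add: norm_nome power2_eq_square flip: exp_add)
    finally have 2: "Im \<tau> ^ k * (norm (nome \<tau>) ^ n)\<^sup>2 \<le> B"
      using B[of "Im \<tau>"] \<tau> by (smt (verit) mem_Collect_eq mult_left_mono uhp_def zero_le_power)
    have "Im \<tau> ^ k * (norm (f \<tau>))\<^sup>2 = (Im \<tau> ^ k * (norm (nome \<tau>) ^ n)\<^sup>2) * (norm (h (nome \<tau>)))\<^sup>2"
      by (simp add: h(2)[OF \<tau>] norm_mult norm_power power_mult_distrib)
    also have "\<dots> \<le> B * C\<^sup>2"
      proof (rule mult_mono[OF 2 1])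
      have "0 \<le> Im \<tau> ^ k * (norm (nome \<tau>) ^ n)\<^sup>2" using \<tau> by (simp add: uhp_def)
      thus "0 \<le> B" using 2 by (rule order.trans)
    qed simp
    finally show ?thesis .
  qed
  show ?thesis
  proof (intro exI ballI)
    fix \<tau> assume "\<tau> \<in> uhp"
    then obtain \<sigma> where "Im \<sigma> \<ge> 17/20" "Im \<sigma> ^ k * (norm (f \<sigma>))\<^sup>2 = Im \<tau> ^ k * (norm (f \<tau>))\<^sup>2"
      using modular_reduction[of "\<lambda>\<tau>. Im \<tau> ^ k * (norm (f \<tau>))\<^sup>2" \<tau>]
        modular_invariant_norm[OF f(1)] by auto
    with *[of \<sigma>] show "Im \<tau> ^ k * (norm (f \<tau>))\<^sup>2 \<le> B * C\<^sup>2" by simp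
  qed
qed

text \<open>Let M be the supremum of the invariant norm. \<open>contr\<close> improves the bound M
  to c * M on Im tau >= 17/20, reduction spreads this to all of \<open>uhp\<close>, and M <= c * M
  with c < 1 leaves only M <= 0.\<close>

lemma modular_contraction:
  assumes f: "weakly_modular k f" "vanishes_at_infinity n f" and "n > 0"
    and c: "c < 1"
    and contr: "\<And>M \<tau>. (\<And>\<sigma>. \<sigma> \<in> uhp \<Longrightarrow> Im \<sigma> ^ k * (norm (f \<sigma>))\<^sup>2 \<le> M) \<Longrightarrow> Im \<tau> \<ge> 17/20 \<Longrightarrow>
      Im \<tau> ^ k * (norm (f \<tau>))\<^sup>2 \<le> c * M"
    and \<tau>: "\<tau> \<in> uhp"
  shows "f \<tau> = 0"
proof -
  define \<psi> where "\<psi> = (\<lambda>\<tau>. Im \<tau> ^ k * (norm (f \<tau>))\<^sup>2)"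
  have \<psi>inv: "\<psi> (\<sigma> + 1) = \<psi> \<sigma>" "\<psi> (- 1 / \<sigma>) = \<psi> \<sigma>" if "\<sigma> \<in> uhp" for \<sigma>
    unfolding \<psi>_def using modular_invariant_norm[OF f(1) that] .
  define M where "M = Sup (\<psi> ` uhp)"
  have bdd: "bdd_above (\<psi> ` uhp)"
    using modular_norm_bounded[OF f \<open>n > 0\<close>] unfolding \<psi>_def by fast
  have M: "\<psi> \<sigma> \<le> M" if "\<sigma> \<in> uhp" for \<sigma>
    unfolding M_def by (rule cSUP_upper[OF that bdd])
  have cM: "\<psi> \<sigma> \<le> c * M" if "\<sigma> \<in> uhp" for \<sigma>
  proof -
    have "\<exists>\<rho>. Im \<rho> \<ge> 17/20 \<and> \<psi> \<rho> = \<psi> \<sigma>"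
      by (rule modular_reduction) (use \<psi>inv that in auto)
    then obtain \<rho> where "Im \<rho> \<ge> 17/20" "\<psi> \<rho> = \<psi> \<sigma>" by blast
    thus ?thesis using contr[of M \<rho>] M by (simp add: \<psi>_def)
  qed
  have "M \<le> c * M"
    unfolding M_def[of] using cM \<tau> by (intro cSUP_least) (auto simp: M_def)
  hence "M \<le> 0" using c by (smt (verit) mult_less_cancel_right2)
  hence "\<psi> \<tau> \<le> 0" using M[OF \<tau>] by simp
  moreover have "Im \<tau> ^ k > 0" using \<tau> by (simp add: uhp_def)
  ultimately show ?thesis unfolding \<psi>_def
    by (metis mult_pos_pos not_less zero_less_norm_iff zero_less_power)
qed

section \<open>Vanishing theorems from the maximum principle in the nome\<close>

lemma norm_le_on_disc:
  assumes "h holomorphic_on ball 0 r" "0 < R" "R < r" "norm q \<le> R"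
    and "\<And>z. norm z = R \<Longrightarrow> norm (h z) \<le> B"
  shows "norm (h q) \<le> B"
proof (rule maximum_modulus_frontier[of h "cball 0 R"])
  show "h holomorphic_on interior (cball 0 R)" "continuous_on (closure (cball 0 R)) h"
    using assms by (auto intro!: holomorphic_on_imp_continuous_on intro: holomorphic_on_subset[OF assms(1)])
qed (use assms in \<open>auto simp: frontier_cball\<close>)

text \<open>Input for the maximum principle: a circle around 0 in the nome is a horizontal line,
  where the bound M controls \<open>f\<close>, and dividing by the n-th power of the nome costs exp
  (2 pi n y).\<close>

lemma q_expansion_circle_bound:
  assumes M: "\<And>\<sigma>. \<sigma> \<in> uhp \<Longrightarrow> Im \<sigma> ^ k * (norm (f \<sigma>))\<^sup>2 \<le> M"
    and h: "\<And>\<tau>. \<tau> \<in> uhp \<Longrightarrow> f \<tau> = nome \<tau> ^ n * h (nome \<tau>)"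
    and y: "y > 0" and z: "norm z = exp (- 2 * pi * y)"
  shows "norm (h z) \<le> sqrt (M / y ^ k) * exp (2 * pi * n * y)"
proof -
  have "z \<noteq> 0" using z by auto
  then obtain \<sigma> where \<sigma>: "nome \<sigma> = z" "Im \<sigma> = y"
    using nome_surj[of z] z by (auto simp: )
  hence u: "\<sigma> \<in> uhp" using y by (simp add: uhp_def)
  have "(norm (f \<sigma>))\<^sup>2 \<le> M / y ^ k"
    using M[OF u] y \<sigma> by (simp add: field_simps)
  hence 1: "norm (f \<sigma>) \<le> sqrt (M / y ^ k)"
    by (simp add: real_le_rsqrt)
  have "norm (f \<sigma>) = exp (- 2 * pi * y) ^ n * norm (h z)"
    using h[OF u] \<sigma> z by (simp add: norm_mult norm_power)
  also have "exp (- 2 * pi * y) ^ n = exp (- (2 * pi * n * y))"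
    by (simp flip: exp_of_nat_mult add: mult_ac)
  also have "\<dots> * norm (h z) = norm (h z) / exp (2 * pi * n * y)"
    by (simp add: exp_minus field_simps)
  finally have "norm (h z) = norm (f \<sigma>) * exp (2 * pi * n * y)" by simp
  thus ?thesis using 1 by simp
qed

text \<open>By 1 + x <= exp x the power grows at most like exp (4/3 * 9 n (y - 3/4)), and 4/3 * 9 =
  12 is below 4 pi. The margin 4 pi - 12 >= 1/2 over the distance 17/20 - 3/4 = 1/10 yields exp (-
  1/20).\<close>

lemma growth_comparison:
  assumes "k \<le> 9 * n" "n > 0" "y \<ge> 17/20"
  shows "(y / (3/4)) ^ k * exp (- 4 * pi * n * (y - 3/4)) \<le> exp (- 1/20)"
proof -
  have "(y / (3/4)) ^ k \<le> (y / (3/4)) ^ (9 * n)"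
    using assms by (intro power_increasing) auto
  also have "\<dots> \<le> exp (4/3 * (y - 3/4)) ^ (9 * n)"
    using assms exp_ge_add_one_self[of "4/3 * (y - 3/4)"] by (intro power_mono) (auto simp: field_simps)
  also have "\<dots> = exp (12 * n * (y - 3/4))"
    by (simp flip: exp_of_nat_mult add: algebra_simps)
  finally have "(y / (3/4)) ^ k * exp (- 4 * pi * n * (y - 3/4)) \<le>
      exp (12 * n * (y - 3/4)) * exp (- 4 * pi * n * (y - 3/4))"
    by (rule mult_right_mono) auto
  also have "\<dots> = exp (- ((4 * pi - 12) * (n * (y - 3/4))))"
    by (simp flip: exp_add add: algebra_simps)
  also have "\<dots> \<le> exp (- (1/2 * (1 * (1/10))))"
    using assms pi_approx by (intro iffD2[OF exp_le_cancel_iff] le_imp_neg_le mult_mono) auto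
  finally show ?thesis by simp
qed

text \<open>The maximum principle for \<open>h\<close>, applied on the circle of height 3/4, covers
  all reduced points, whose height is at least 17/20. Moving up from 3/4 to y gains exp (- 4 pi n (y
  - 3/4)), more than the weight factor loses.\<close>

theorem weakly_modular_eq_0:
  assumes f: "weakly_modular k f" "vanishes_at_infinity n f" and "n > 0" "k \<le> 9 * n" "\<tau> \<in> uhp"
  shows "f \<tau> = 0"
proof (rule modular_contraction[OF f \<open>n > 0\<close> _ _ \<open>\<tau> \<in> uhp\<close>])
  show "exp (- 1/20) < (1::real)" by simp
next
  fix M \<tau> assume M: "\<And>\<sigma>. \<sigma> \<in> uhp \<Longrightarrow> Im \<sigma> ^ k * (norm (f \<sigma>))\<^sup>2 \<le> M" and y: "Im \<tau> \<ge> 17/20"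
  obtain h where h: "h holomorphic_on ball 0 1" "\<And>\<tau>. \<tau> \<in> uhp \<Longrightarrow> f \<tau> = nome \<tau> ^ n * h (nome \<tau>)"
    using f(2) unfolding vanishes_at_infinity_def by blast
  have \<tau>: "\<tau> \<in> uhp" using y by (simp add: uhp_def)
  have "0 \<le> Im \<tau> ^ k * (norm (f \<tau>))\<^sup>2" using \<tau> by (simp add: uhp_def)
  hence M0: "M \<ge> 0" using M[OF \<tau>] by (rule order.trans)
  define B where "B = sqrt (M / (3/4) ^ k) * exp (2 * pi * n * (3/4))"
  have "norm (h (nome \<tau>)) \<le> B"
  proof (rule norm_le_on_disc[OF h(1), of "exp (- 2 * pi * (3/4))"])
    show "norm (nome \<tau>) \<le> exp (- 2 * pi * (3/4))" using y by (simp add: norm_nome)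
    show "norm (h z) \<le> B" if "norm z = exp (- 2 * pi * (3/4))" for z
      unfolding B_def by (rule q_expansion_circle_bound[OF M h(2) _ that]) auto
  qed auto
  hence "(norm (h (nome \<tau>)))\<^sup>2 \<le> B\<^sup>2" by (intro power_mono) auto
  also have "\<dots> = M / (3/4) ^ k * exp (4 * pi * n * (3/4))"
    using M0 by (simp add: B_def power_mult_distrib exp_double[symmetric])
  finally have *: "(norm (h (nome \<tau>)))\<^sup>2 \<le> M / (3/4) ^ k * exp (4 * pi * n * (3/4))" .
  have "Im \<tau> ^ k * (norm (f \<tau>))\<^sup>2 = Im \<tau> ^ k * exp (- 4 * pi * n * Im \<tau>) * (norm (h (nome \<tau>)))\<^sup>2"
  proof -
    have "(exp (- 2 * pi * Im \<tau>) ^ n)\<^sup>2 = exp (- 4 * pi * n * Im \<tau>)"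
      by (simp flip: exp_of_nat_mult exp_double add: mult_ac)
    thus ?thesis
      by (simp add: h(2)[OF \<tau>] norm_mult norm_power norm_nome power_mult_distrib)
  qed
  also have "\<dots> \<le> Im \<tau> ^ k * exp (- 4 * pi * n * Im \<tau>) * (M / (3/4) ^ k * exp (4 * pi * n * (3/4)))"
    using * y by (intro mult_left_mono) auto
  also have "\<dots> = ((Im \<tau> / (3/4)) ^ k * exp (- 4 * pi * n * (Im \<tau> - 3/4))) * M"
  proof -
    have "exp (- 4 * pi * n * (Im \<tau> - 3/4)) = exp (- 4 * pi * n * Im \<tau>) * exp (4 * pi * n * (3/4))"
      by (simp add: algebra_simps flip: exp_add)
    thus ?thesis by (simp add: power_divide)
  qed
  also have "\<dots> \<le> exp (- 1/20) * M"
    using growth_comparison[OF \<open>k \<le> 9 * n\<close> \<open>n > 0\<close> y] M0 by (rule mult_right_mono)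
  finally show "Im \<tau> ^ k * (norm (f \<tau>))\<^sup>2 \<le> exp (- 1/20) * M" .
qed

text \<open>In the application y^7 is the square root of the weight factor and exp (-2 pi y) is |q|.
  The quotient compares |q - a|, where a = nome i, with its lower bound on the circle |q| = exp (-
  pi) of height 1/2, and 128 exp pi bounds \<open>h\<close> there up to sqrt M, with 128 =
  (1/2)^(-7).\<close>

lemma weight_14_numerics:
  assumes "y \<ge> 17/20"
  shows "y ^ 7 * exp (- 2 * pi * y) * ((exp (- 2 * pi * y) + exp (- 2 * pi)) / (exp (- pi) - exp (- 2 * pi)))
    * (128 * exp pi) \<le> 97/100"
proof -
  have y: "y > 0" using assms by simp
  have e: "exp 1 \<ge> (2.718::real)" using e_approx_32 by (simp add: abs_if split: if_splits)
  have e': "exp 1 \<le> (2.7183::real)" using e_approx_32 by (simp add: abs_if split: if_splits)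
  \<comment> \<open>The maximum of y^7 exp (-2 pi y) is (7 / (2 pi e))^7, attained at y = 7 / (2
    pi); 2.439 is a lower bound for 2 pi e / 7.\<close>
  have "(2.439::real) * y \<le> exp 1 * (2 * pi * y / 7)"
    using mult_mono[OF e, of "3.1415" pi] pi_approx y by (simp add: field_simps)
  also have "\<dots> \<le> exp 1 * exp (2 * pi * y / 7 - 1)"
    using exp_ge_add_one_self[of "2 * pi * y / 7 - 1"] by (intro mult_left_mono) auto
  also have "\<dots> = exp (2 * pi * y / 7)" by (simp flip: exp_add)
  finally have "(2.439 * y) ^ 7 \<le> exp (2 * pi * y / 7) ^ 7" using y by (intro power_mono) auto
  also have "\<dots> = exp (2 * pi * y)" by (simp flip: exp_of_nat_mult)
  finally have 0: "2.439 ^ 7 * (y ^ 7 * exp (- 2 * pi * y)) \<le> 1"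
    by (simp add: exp_minus power_mult_distrib field_simps)
  have "513 \<le> (2.439::real) ^ 7" by (simp add: power_divide)
  hence "513 * (y ^ 7 * exp (- 2 * pi * y)) \<le> 2.439 ^ 7 * (y ^ 7 * exp (- 2 * pi * y))"
    by (rule mult_right_mono) (use y in simp)
  from this 0 have "513 * (y ^ 7 * exp (- 2 * pi * y)) \<le> 1" by (rule order.trans)
  hence 1: "y ^ 7 * exp (- 2 * pi * y) \<le> 1 / 513" by simp
  have "exp (- 2 * pi * y) \<le> exp (- 2 * pi * (17/20))"
    using assms by simp
  also have "\<dots> = exp (- 2 * pi) * exp (3/10 * pi)"
    by (simp flip: exp_add)
  also have "exp (3/10 * pi) \<le> 2.6"
  proof -
    have "exp (3/10 * pi) \<le> exp (1 - 0.057)" using pi_approx by (intro iffD2[OF exp_le_cancel_iff]) simp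
    also have "\<dots> = exp 1 / exp 0.057" by (rule exp_diff)
    also have "\<dots> \<le> 2.7183 / (1 + 0.057)"
      using e' exp_ge_add_one_self[of "0.057"] by (intro frac_le) auto
    finally show ?thesis by simp
  qed
  finally have "exp (- 2 * pi * y) \<le> exp (- 2 * pi) * 2.6" by simp
  hence 2: "exp (- 2 * pi * y) + exp (- 2 * pi) \<le> exp (- 2 * pi) * 3.6" by simp
  have "exp (- pi) \<le> (1/20 :: real)"
  proof -
    have "(2.7::real) ^ 3 \<le> exp 1 ^ 3" using e by (intro power_mono) auto
    also have "\<dots> = exp 3" by (simp flip: exp_of_nat_mult)
    finally have "19.6 \<le> exp (3::real)" by (simp add: power_divide)
    moreover have "exp (0.1::real) \<ge> 1.1" using exp_ge_add_one_self[of "0.1"] by simp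
    ultimately have "19.6 * 1.1 \<le> exp 3 * exp (0.1::real)" by (intro mult_mono) auto
    also have "\<dots> = exp (3.1)" by (simp flip: exp_add)
    also have "\<dots> \<le> exp pi" using pi_approx by simp
    finally show ?thesis by (simp add: exp_minus field_simps)
  qed
  hence "exp (- pi) * exp (- pi) \<le> exp (- pi) * (1/20)" by (rule mult_left_mono) simp
  moreover have pp: "exp (- 2 * pi) = exp (- pi) * exp (- pi)" by (simp flip: exp_add)
  ultimately have 3: "exp (- pi) - exp (- 2 * pi) \<ge> exp (- pi) * (19/20)"
    by linarith
  have "(exp (- 2 * pi * y) + exp (- 2 * pi)) / (exp (- pi) - exp (- 2 * pi)) \<le>
      (exp (- 2 * pi) * 3.6) / (exp (- pi) * (19/20))"
    using 2 3 by (intro frac_le) (auto simp: add_nonneg_nonneg)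
  also have "\<dots> = 72 / 19 * exp (- pi)" unfolding pp by simp
  finally have "y ^ 7 * exp (- 2 * pi * y) * ((exp (- 2 * pi * y) + exp (- 2 * pi)) / (exp (- pi) - exp (- 2 * pi)))
      \<le> 1 / 513 * (72 / 19 * exp (- pi))"
    using 1 y by (intro mult_mono) (auto intro!: divide_nonneg_nonneg add_nonneg_nonneg)
  hence "y ^ 7 * exp (- 2 * pi * y) * ((exp (- 2 * pi * y) + exp (- 2 * pi)) / (exp (- pi) - exp (- 2 * pi)))
      * (128 * exp pi) \<le> 1 / 513 * (72 / 19 * exp (- pi)) * (128 * exp pi)"
    by (rule mult_right_mono) simp
  also have "\<dots> = 1 / 513 * (72 / 19) * 128 * (exp (- pi) * exp pi)" by (simp only: mult_ac)
  also have "\<dots> \<le> 97/100" by (simp flip: exp_add)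
  finally show ?thesis .
qed

text \<open>The sign \<open>\<i> ^ 14 = -1\<close> forces a zero at \<open>\<i>\<close>, which is what the bound for general weights lacks.\<close>

theorem weakly_modular_14_eq_0:
  assumes f: "weakly_modular 14 f" "vanishes_at_infinity 1 f" and "\<tau> \<in> uhp"
  shows "f \<tau> = 0"
proof (rule modular_contraction[OF f _ _ _ \<open>\<tau> \<in> uhp\<close>])
  show "(97/100)\<^sup>2 < (1::real)" by (simp add: power2_eq_square)
next
  fix M \<tau> assume M: "\<And>\<sigma>. \<sigma> \<in> uhp \<Longrightarrow> Im \<sigma> ^ 14 * (norm (f \<sigma>))\<^sup>2 \<le> M" and y: "Im \<tau> \<ge> 17/20"
  obtain h where h: "h holomorphic_on ball 0 1" "\<And>\<tau>. \<tau> \<in> uhp \<Longrightarrow> f \<tau> = nome \<tau> ^ 1 * h (nome \<tau>)"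
    using f(2) unfolding vanishes_at_infinity_def by blast
  have \<tau>: "\<tau> \<in> uhp" using y by (simp add: uhp_def)
  have "0 \<le> Im \<tau> ^ 14 * (norm (f \<tau>))\<^sup>2" using \<tau> by (simp add: uhp_def)
  hence M0: "M \<ge> 0" using M[OF \<tau>] by (rule order.trans)
  have i: "\<i> \<in> uhp" by (simp add: uhp_def)
  define a where "a = nome \<i>"
  have na: "norm a = exp (- 2 * pi)" by (simp add: a_def norm_nome)
  have "f (- 1 / \<i>) = \<i> ^ 14 * f \<i>" using f(1) i unfolding weakly_modular_def by blast
  moreover have "- 1 / \<i> = \<i>" "\<i> ^ 14 = (\<i> ^ 2) ^ 7"
    by (simp_all add: field_simps flip: power_mult)
  ultimately have "f \<i> = 0" by simp
  hence ha: "h a = 0" using h(2)[OF i] by (simp add: a_def)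
  \<comment> \<open>The zero at \<open>a\<close> is divided out before the maximum principle is
    applied and multiplied back at the nome of tau, where |q - a| is much smaller than on the circle
    |q| = exp (- pi).\<close>
  define g where "g = (\<lambda>q. if q = a then deriv h a else (h q - h a) / (q - a))"
  have g: "g holomorphic_on ball 0 1"
    unfolding g_def by (rule pole_lemma_open[OF h(1) open_ball])
  have hg: "h q = (q - a) * g q" for q by (auto simp: g_def ha)
  define S where "S = sqrt (M / (1/2) ^ 14) * exp (2 * pi * 1 * (1/2))"
  define d where "d = exp (- pi) - exp (- 2 * pi)"
  have d: "d > 0" by (simp add: d_def)
  have gb: "norm (g (nome \<tau>)) \<le> S / d"
  proof (rule norm_le_on_disc[OF g, of "exp (- 2 * pi * (1/2))"])
    show "norm (nome \<tau>) \<le> exp (- 2 * pi * (1/2))" using y by (simp add: norm_nome)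
    fix z :: complex assume z: "norm z = exp (- 2 * pi * (1/2))"
    have "norm (h z) \<le> S"
      using q_expansion_circle_bound[OF M h(2) _ z] by (simp add: S_def)
    have "d \<le> norm (z - a)"
      using norm_triangle_ineq2[of z a] na z by (simp add: d_def)
    have "d * norm (g z) \<le> norm (z - a) * norm (g z)"
      using \<open>d \<le> norm (z - a)\<close> by (rule mult_right_mono) simp
    also have "\<dots> = norm (h z)" by (simp add: hg norm_mult)
    also note \<open>norm (h z) \<le> S\<close>
    finally show "norm (g z) \<le> S / d" using d by (simp add: field_simps)
  qed (auto)
  have "sqrt (M / (1/2) ^ 14) = sqrt (M * 128\<^sup>2)" by (simp add: power_divide)
  also have "\<dots> = 128 * sqrt M" by (simp only: real_sqrt_mult real_sqrt_abs)
  finally have S: "S = 128 * exp pi * sqrt M" by (simp add: S_def)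
  have "norm (f \<tau>) = exp (- 2 * pi * Im \<tau>) * (norm (nome \<tau> - a) * norm (g (nome \<tau>)))"
    using h(2)[OF \<tau>] hg by (simp add: norm_mult norm_nome)
  also have "\<dots> \<le> exp (- 2 * pi * Im \<tau>) * ((exp (- 2 * pi * Im \<tau>) + exp (- 2 * pi)) * (S / d))"
    using norm_triangle_ineq4[of "nome \<tau>" a] gb
    by (intro mult_left_mono mult_mono) (auto simp: norm_nome na)
  finally have "Im \<tau> ^ 7 * norm (f \<tau>) \<le>
      Im \<tau> ^ 7 * (exp (- 2 * pi * Im \<tau>) * ((exp (- 2 * pi * Im \<tau>) + exp (- 2 * pi)) * (S / d)))"
    using y by (intro mult_left_mono) auto
  also have "\<dots> = (Im \<tau> ^ 7 * exp (- 2 * pi * Im \<tau>) * ((exp (- 2 * pi * Im \<tau>) + exp (- 2 * pi)) / d)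
    * (128 * exp pi)) * sqrt M" by (simp add: S)
  also have "\<dots> \<le> 97/100 * sqrt M"
    unfolding d_def using weight_14_numerics[OF y] M0 by (intro mult_right_mono) auto
  finally have "(Im \<tau> ^ 7 * norm (f \<tau>))\<^sup>2 \<le> (97/100 * sqrt M)\<^sup>2"
    using y by (intro power_mono) auto
  thus "Im \<tau> ^ 14 * (norm (f \<tau>))\<^sup>2 \<le> (97/100)\<^sup>2 * M"
    using M0 by (simp add: power_mult_distrib power_divide flip: power_mult)
qed auto

section \<open>Leading coefficients and expansions at the cusp\<close>

text \<open>This is the Taylor coefficient of order \<open>m\<close> at \<open>0\<close> provided that the lower ones
  vanish; otherwise the limit need not exist and the value is meaningless.\<close>

definition lead :: "nat \<Rightarrow> (complex \<Rightarrow> complex) \<Rightarrow> complex" where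
  "lead m f = Lim (at 0) (\<lambda>w. f w / w ^ m)"

definition quot :: "nat \<Rightarrow> (complex \<Rightarrow> complex) \<Rightarrow> complex \<Rightarrow> complex" where
  "quot m f w = (if w = 0 then lead m f else f w / w ^ m)"

lemma lead_eqI:
  assumes "g holomorphic_on ball 0 r" "r > 0" "\<And>w. w \<in> ball 0 r \<Longrightarrow> w \<noteq> 0 \<Longrightarrow> g w = f w / w ^ m"
  shows "lead m f = g 0"
proof -
  have "continuous (at 0) g"
    using assms(1,2) holomorphic_on_imp_continuous_on continuous_on_eq_continuous_at[of "ball 0 r" g]
    by simp
  hence "(g \<longlongrightarrow> g 0) (at 0)" by (simp add: continuous_at)
  hence "((\<lambda>w. f w / w ^ m) \<longlongrightarrow> g 0) (at 0)"
    by (rule Lim_transform_within_open[of _ _ _ _ "ball 0 r"]) (use assms in auto)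
  thus ?thesis unfolding lead_def by (intro tendsto_Lim) auto
qed

text \<open>One zero is divided out at a time; the vanishing of the preceding leading coefficient
  keeps the next quotient holomorphic at 0.\<close>

lemma quot_holomorphic:
  assumes "f holomorphic_on ball 0 r" "r > 0" "\<And>i. i < m \<Longrightarrow> lead i f = 0"
  shows "quot m f holomorphic_on ball 0 r"
  using assms(3)
proof (induction m)
  case 0
  have "lead 0 f = f 0" by (rule lead_eqI[OF assms(1,2)]) simp
  hence "quot 0 f = f" by (auto simp: quot_def fun_eq_iff)
  thus ?case using assms(1) by simp
next
  case (Suc m)
  define g where "g = quot m f"
  define h where "h = (\<lambda>w. if w = 0 then deriv g 0 else (g w - g 0) / (w - 0))"
  have "g holomorphic_on ball 0 r" unfolding g_def by (rule Suc.IH) (use Suc.prems in auto)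
  hence h: "h holomorphic_on ball 0 r" unfolding h_def by (rule pole_lemma_open) simp
  have "g 0 = 0" using Suc.prems[of m] by (simp add: g_def quot_def)
  hence hw: "h w = f w / w ^ Suc m" if "w \<noteq> 0" for w
    using that by (simp add: h_def g_def quot_def field_simps)
  hence "lead (Suc m) f = h 0" by (intro lead_eqI[OF h assms(2)]) auto
  hence "quot (Suc m) f = h" using hw by (auto simp: quot_def fun_eq_iff)
  thus ?case using h by simp
qed

lemma quot_0 [simp]: "quot m f 0 = lead m f"
  by (simp add: quot_def)

lemma quot_mult:
  assumes "f holomorphic_on ball 0 r" "r > 0" "\<And>i. i < m \<Longrightarrow> lead i f = 0"
  shows "f w = w ^ m * quot m f w"
proof (cases "w = 0")
  case True
  have "lead 0 f = f 0" by (rule lead_eqI[OF assms(1,2)]) simp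
  thus ?thesis using assms(3)[of 0] True by (cases "m = 0") auto
qed (auto simp: quot_def)

text \<open>Schwarz's lemma for a zero of order m.\<close>

lemma quot_bound:
  assumes "f holomorphic_on ball 0 r" "\<And>i. i < m \<Longrightarrow> lead i f = 0"
    and "0 < R" "R < r" "\<And>z. norm z = R \<Longrightarrow> norm (f z) \<le> B" "norm w \<le> R"
  shows "norm (quot m f w) \<le> B / R ^ m"
proof (rule norm_le_on_disc[OF quot_holomorphic[OF assms(1) _ assms(2)] assms(3,4,6)])
  show "norm (quot m f z) \<le> B / R ^ m" if "norm z = R" for z
    using that assms by (auto simp: quot_def norm_divide norm_power intro!: divide_right_mono)
qed (use assms in auto)

text \<open>Letting m tend to infinity in |f w| <= (|w| / R)^m B gives vanishing near 0, and the
  identity theorem does the rest.\<close>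

lemma eq_0_if_all_leads_0:
  assumes f: "f holomorphic_on S" "open S" "connected S" "0 \<in> S" and l: "\<And>i. lead i f = 0" and w: "w \<in> S"
  shows "f w = 0"
proof -
  obtain r where r: "r > 0" "ball 0 r \<subseteq> S" using f openE by blast
  define R where "R = r / 2"
  have R: "R > 0" "R < r" using r by (auto simp: R_def)
  have fr: "f holomorphic_on ball 0 r" using f(1) r(2) by (rule holomorphic_on_subset)
  have "compact (f ` cball 0 R)"
    using R by (intro compact_continuous_image holomorphic_on_imp_continuous_on
        holomorphic_on_subset[OF fr]) auto
  then obtain B where B: "\<And>q. norm q \<le> R \<Longrightarrow> norm (f q) \<le> B"
    by (metis compact_imp_bounded bounded_iff image_eqI mem_cball_0)
  have *: "f w = 0" if "w \<in> ball 0 R" for w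
  proof -
    have "norm (f w) \<le> (norm w / R) ^ m * B" for m
    proof -
      have "norm (f w) = norm w ^ m * norm (quot m f w)"
        using quot_mult[OF fr r(1), of m] l by (metis norm_mult norm_power)
      also have "\<dots> \<le> norm w ^ m * (B / R ^ m)"
        using that R B l by (intro mult_left_mono quot_bound[OF fr]) auto
      finally show ?thesis by (simp add: power_divide)
    qed
    moreover have "(\<lambda>m. (norm w / R) ^ m * B) \<longlonglongrightarrow> 0 * B"
      using that R by (intro tendsto_mult_right LIMSEQ_realpow_zero) auto
    ultimately have "norm (f w) \<le> 0 * B"
      by (intro LIMSEQ_le_const) auto
    thus ?thesis by simp
  qed
  show ?thesis
  proof (rule analytic_continuation_open[of "ball 0 R" S f "\<lambda>_. 0"])
    show "ball 0 R \<noteq> {}" "ball 0 R \<subseteq> S" using R r by auto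
  qed (use f * w in auto)
qed

text \<open>On a circle |w| = rho division by w^m is harmless, so uniform continuity of
  \<open>p\<close> passes to the quotients there. The maximum principle carries the closeness of two
  slices inward, in particular to w = 0.\<close>

lemma continuous_on_quot:
  fixes p :: "complex \<Rightarrow> complex \<Rightarrow> complex"
  assumes U: "open U" and r: "r > 0"
    and cont: "continuous_on (U \<times> ball 0 r) (\<lambda>(s, w). p s w)"
    and hol: "\<And>s. s \<in> U \<Longrightarrow> p s holomorphic_on ball 0 r"
    and ord: "\<And>s i. s \<in> U \<Longrightarrow> i < m \<Longrightarrow> lead i (p s) = 0"
  shows "continuous_on (U \<times> ball 0 r) (\<lambda>(s, w). quot m (p s) w)"
proof -
  have "\<exists>d>0. \<forall>s w. dist s s0 < d \<and> dist w w0 < d \<longrightarrow> dist (quot m (p s) w) (quot m (p s0) w0) < e"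
    if s0: "s0 \<in> U" and w0: "w0 \<in> ball 0 r" and e: "e > 0" for s0 w0 e
  proof -
    obtain d1 where d1: "d1 > 0" "cball s0 d1 \<subseteq> U" using U s0 open_contains_cball by blast
    define \<rho> where "\<rho> = (norm w0 + r) / 2"
    have \<rho>: "norm w0 < \<rho>" "\<rho> < r" "\<rho> > 0" using w0 norm_ge_zero[of w0] by (auto simp: \<rho>_def simp del: norm_ge_zero)
    have "compact (cball s0 d1 \<times> cball (0::complex) \<rho>)" by (intro compact_Times) auto
    moreover have "continuous_on (cball s0 d1 \<times> cball 0 \<rho>) (\<lambda>(s, w). p s w)"
      by (rule continuous_on_subset[OF cont]) (use d1 \<rho> in auto)
    ultimately have "uniformly_continuous_on (cball s0 d1 \<times> cball 0 \<rho>) (\<lambda>(s, w). p s w)"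
      by (intro compact_uniformly_continuous)
    moreover have "e / 2 * \<rho> ^ m > 0" using e \<rho> by simp
    ultimately obtain d2 where d2: "d2 > 0" "\<And>x y. x \<in> cball s0 d1 \<times> cball 0 \<rho> \<Longrightarrow> y \<in> cball s0 d1 \<times> cball 0 \<rho>
        \<Longrightarrow> dist y x < d2 \<Longrightarrow> dist (case y of (s, w) \<Rightarrow> p s w) (case x of (s, w) \<Rightarrow> p s w) < e / 2 * \<rho> ^ m"
      unfolding uniformly_continuous_on_def by blast
    have "quot m (p s0) holomorphic_on ball 0 r" by (intro quot_holomorphic hol ord s0 r)
    hence "continuous (at w0) (quot m (p s0))"
      using w0 holomorphic_on_imp_continuous_on continuous_on_eq_continuous_at[of "ball 0 r" "quot m (p s0)"] by blast
    then obtain d3 where d3: "d3 > 0" "\<And>w. dist w w0 < d3 \<Longrightarrow> dist (quot m (p s0) w) (quot m (p s0) w0) < e / 2"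
      unfolding continuous_at_eps_delta using e by (metis half_gt_zero)
    define d where "d = min (min d1 d2) (min d3 (\<rho> - norm w0))"
    show ?thesis
    proof (intro exI[of _ d] conjI allI impI)
      show "d > 0" using d1 d2 d3 \<rho> by (simp add: d_def)
      fix s w assume sw: "dist s s0 < d \<and> dist w w0 < d"
      have s: "s \<in> cball s0 d1" using sw by (auto simp: d_def dist_commute)
      have "norm w \<le> norm w0 + dist w w0" by (metis dist_norm norm_triangle_sub)
      hence w: "norm w \<le> \<rho>" using sw by (auto simp: d_def)
      have "norm (quot m (p s) w - quot m (p s0) w) \<le> e / 2"
      proof (rule norm_le_on_disc[of "\<lambda>w. quot m (p s) w - quot m (p s0) w" r \<rho>])
        show "(\<lambda>w. quot m (p s) w - quot m (p s0) w) holomorphic_on ball 0 r"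
          using d1 s by (intro holomorphic_intros quot_holomorphic hol ord s0 r) auto
        fix z :: complex assume z: "norm z = \<rho>"
        have "dist (s0, z) (s, z) < d2" using sw by (simp add: dist_Pair_Pair d_def dist_commute)
        hence "dist (p s0 z) (p s z) < e / 2 * \<rho> ^ m"
          using d2(2)[of "(s, z)" "(s0, z)"] s z d1 by auto
        hence "norm (p s z - p s0 z) \<le> e / 2 * \<rho> ^ m" by (simp add: dist_norm norm_minus_commute)
        moreover have "z \<noteq> 0" using z \<rho> by auto
        ultimately show "norm (quot m (p s) z - quot m (p s0) z) \<le> e / 2"
          using z \<rho> by (simp add: quot_def norm_divide norm_power field_simps flip: diff_divide_distrib)
      qed (use \<rho> w in auto)
      moreover have "norm (quot m (p s0) w - quot m (p s0) w0) < e / 2"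
        using d3(2)[of w] sw by (simp add: d_def dist_norm)
      ultimately show "dist (quot m (p s) w) (quot m (p s0) w0) < e"
        unfolding dist_norm using norm_triangle_ineq[of "quot m (p s) w - quot m (p s0) w" "quot m (p s0) w - quot m (p s0) w0"]
        by simp
    qed
  qed
  thus ?thesis
    unfolding continuous_on_iff using dist_fst_le dist_snd_le
    by (clarsimp, smt (verit, ccfv_SIG) dist_fst_le dist_snd_le fst_conv snd_conv)
qed

text \<open>The leading coefficient is the locally uniform limit of the holomorphic functions p s
  w_n / w_n^m of s as w_n tends to 0; joint continuity of the quotient supplies the
  uniformity.\<close>

lemma holomorphic_on_lead:
  fixes p :: "complex \<Rightarrow> complex \<Rightarrow> complex"
  assumes U: "open U" and r: "r > 0"
    and cont: "continuous_on (U \<times> ball 0 r) (\<lambda>(s, w). p s w)"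
    and hol: "\<And>s. s \<in> U \<Longrightarrow> p s holomorphic_on ball 0 r"
    and hol': "\<And>w. w \<in> ball 0 r \<Longrightarrow> (\<lambda>s. p s w) holomorphic_on U"
    and ord: "\<And>s i. s \<in> U \<Longrightarrow> i < m \<Longrightarrow> lead i (p s) = 0"
  shows "(\<lambda>s. lead m (p s)) holomorphic_on U"
proof -
  define wn where "wn = (\<lambda>n::nat. complex_of_real (r / (n + 2)))"
  have nwn: "norm (wn n) = r / (n + 2)" for n
    unfolding wn_def norm_of_real using r by simp
  have wn: "wn n \<in> ball 0 r" "wn n \<in> cball 0 (r/2)" for n
  proof -
    have "r / (real n + 2) \<le> r / 2" using r by (intro frac_le) auto
    hence "norm (wn n) \<le> r / 2" by (simp add: nwn add_ac)
    thus "wn n \<in> ball 0 r" "wn n \<in> cball 0 (r/2)" using r by auto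
  qed
  have wn_nz: "wn n \<noteq> 0" for n
  proof -
    have "norm (wn n) > 0" unfolding nwn using r by simp
    thus ?thesis by simp
  qed
  have wn0: "wn \<longlonglongrightarrow> 0"
  proof -
    have "(\<lambda>n. r / (real (n + 2))) \<longlonglongrightarrow> 0"
      by (rule LIMSEQ_ignore_initial_segment[OF lim_const_over_n])
    from tendsto_of_real[OF this, where ?'a = complex] show ?thesis by (simp add: wn_def add_ac)
  qed
  show ?thesis
  proof (rule holomorphic_uniform_sequence[OF U])
    show "(\<lambda>s. quot m (p s) (wn n)) holomorphic_on U" for n
    proof -
      have "(\<lambda>s. p s (wn n) / wn n ^ m) holomorphic_on U"
        using wn wn_nz by (intro holomorphic_intros hol') auto
      thus ?thesis using wn_nz by (simp add: quot_def)
    qed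
    fix x assume "x \<in> U"
    then obtain d where d: "d > 0" "cball x d \<subseteq> U" using U open_contains_cball by blast
    have "continuous_on (cball x d \<times> cball 0 (r/2)) (\<lambda>(s, w). quot m (p s) w)"
      by (rule continuous_on_subset[OF continuous_on_quot[OF U r cont hol ord]]) (use d r in auto)
    hence uc: "uniformly_continuous_on (cball x d \<times> cball 0 (r/2)) (\<lambda>(s, w). quot m (p s) w)"
      by (intro compact_uniformly_continuous compact_Times) auto
    have "uniform_limit (cball x d) (\<lambda>n s. quot m (p s) (wn n)) (\<lambda>s. lead m (p s)) sequentially"
    proof (rule uniform_limitI)
      fix e :: real assume "e > 0"
      with uc obtain b where b: "b > 0" "\<And>u v. u \<in> cball x d \<times> cball 0 (r/2) \<Longrightarrow> v \<in> cball x d \<times> cball 0 (r/2)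
        \<Longrightarrow> dist v u < b \<Longrightarrow> dist (case v of (s, w) \<Rightarrow> quot m (p s) w) (case u of (s, w) \<Rightarrow> quot m (p s) w) < e"
        unfolding uniformly_continuous_on_def by blast
      have "\<forall>\<^sub>F n in sequentially. dist (wn n) 0 < b" using wn0 b(1) by (rule tendstoD)
      thus "\<forall>\<^sub>F n in sequentially. \<forall>s\<in>cball x d. dist (quot m (p s) (wn n)) (lead m (p s)) < e"
      proof eventually_elim
        case (elim n)
        show ?case
        proof
          fix s assume "s \<in> cball x d"
          thus "dist (quot m (p s) (wn n)) (lead m (p s)) < e"
            using b(2)[of "(s, 0)" "(s, wn n)"] elim wn(2)[of n] r by (auto simp: dist_Pair_Pair)
        qed
      qed
    qed
    thus "\<exists>d>0. cball x d \<subseteq> U \<and> uniform_limit (cball x d) (\<lambda>n s. quot m (p s) (wn n)) (\<lambda>s. lead m (p s)) sequentially"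
      using d by blast
  qed
qed

text \<open>For odd m the function - quot m f (- w) also extends f w / w^m over 0, so the leading
  coefficient equals its own negative.\<close>

lemma lead_odd_eq_0:
  assumes "f holomorphic_on ball 0 r" "r > 0" "\<And>i. i < m \<Longrightarrow> lead i f = 0"
    and "\<And>w. w \<in> ball 0 r \<Longrightarrow> f (- w) = f w" "odd m"
  shows "lead m f = 0"
proof -
  have "(\<lambda>w. - quot m f (- w)) holomorphic_on ball 0 r"
    by (intro holomorphic_intros holomorphic_on_compose_gen[OF _ quot_holomorphic[OF assms(1-3)], unfolded o_def]) auto
  hence "lead m f = - quot m f (- 0)"
    by (rule lead_eqI) (use assms in \<open>auto simp: quot_def\<close>)
  thus ?thesis by simp
qed

section \<open>Expansions at the cusp from periodicity and decay\<close>

lemma nome_eqD: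
  assumes "nome \<tau> = nome \<sigma>"
  obtains n :: int where "\<tau> = \<sigma> + of_int n"
proof -
  obtain n :: int where "2 * of_real pi * \<i> * \<tau> = 2 * of_real pi * \<i> * \<sigma> + of_int (2 * n) * of_real pi * \<i>"
    using assms unfolding nome_def exp_eq by auto
  hence "2 * of_real pi * \<i> * \<tau> = 2 * of_real pi * \<i> * (\<sigma> + of_int n)" by (simp add: algebra_simps)
  hence "\<tau> = \<sigma> + of_int n" by simp
  thus thesis by (rule that)
qed

text \<open>\<open>f\<close> descends to a function \<open>A\<close> on the punctured disc, and the
  bound makes the singularity of A / q^l removable. The limit along the imaginary axis shows that
  the extension vanishes at 0, which is the extra order in \<open>Suc l\<close>.\<close>

theorem q_expansion:
  assumes hol: "f holomorphic_on uhp" and per: "\<And>\<tau>. \<tau> \<in> uhp \<Longrightarrow> f (\<tau> + 1) = f \<tau>"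
    and bd: "\<And>\<tau>. Im \<tau> \<ge> b \<Longrightarrow> norm (f \<tau>) \<le> C * exp (- 2 * pi * l * Im \<tau>)"
    and lim: "((\<lambda>t. f (\<i> * of_real t) * of_real (exp (2 * pi * l * t))) \<longlongrightarrow> 0) at_top"
  shows "vanishes_at_infinity (Suc l) f"
proof -
  define A where "A = (\<lambda>q. f (Ln q / (2 * of_real pi * \<i>)))"
  have uhpI: "\<tau> \<in> uhp" if "norm (nome \<tau>) < 1" for \<tau>
    using that by (simp add: norm_nome uhp_def zero_less_mult_iff)
  have nL: "nome (Ln q / (2 * of_real pi * \<i>)) = q" if "q \<noteq> 0" for q
    using that by (simp add: nome_def)
  have A: "A (nome \<tau>) = f \<tau>" if "\<tau> \<in> uhp" for \<tau>
  proof -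
    obtain n :: int where "Ln (nome \<tau>) / (2 * of_real pi * \<i>) = \<tau> + of_int n"
      using nome_eqD nL[of "nome \<tau>"] nome_nonzero by metis
    thus ?thesis using periodic_int_translate[of f, OF per that] by (simp add: A_def)
  qed
  have Ahol: "A holomorphic_on ball 0 1 - {0}"
    unfolding holomorphic_on_def
  proof
    fix q0 :: complex assume q0: "q0 \<in> ball 0 1 - {0}"
    \<comment> \<open>\<open>Ln\<close> jumps across the negative axis, so a branch adapted to
      \<open>q0\<close> is used; by periodicity \<open>A\<close> does not depend on the
      branch.\<close>
    define L where "L = (\<lambda>q. (Ln (q / q0) + Ln q0) / (2 * of_real pi * \<i>))"
    define V where "V = ball q0 (norm q0) \<inter> ball 0 1"
    have V: "open V" "q0 \<in> V" using q0 by (auto simp: V_def)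
    have qV: "q / q0 \<notin> \<real>\<^sub>\<le>\<^sub>0" "q \<noteq> 0" if "q \<in> V" for q
    proof -
      have "norm (1 - q / q0) < 1"
      proof -
        have "1 - q / q0 = (q0 - q) / q0" using q0 by (simp add: field_simps)
        thus ?thesis using that q0 by (simp add: V_def norm_divide dist_norm)
      qed
      hence "\<bar>Re (1 - q / q0)\<bar> < 1" by (meson abs_Re_le_cmod le_less_trans)
      thus "q / q0 \<notin> \<real>\<^sub>\<le>\<^sub>0" by (auto simp: complex_nonpos_Reals_iff)
      thus "q \<noteq> 0" by auto
    qed
    have nL: "nome (L q) = q" if "q \<in> V" for q
      using qV[OF that] q0 by (simp add: nome_def L_def exp_add)
    have "L holomorphic_on V" unfolding L_def
      using qV q0 by (intro holomorphic_intros) auto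
    moreover have "L ` V \<subseteq> uhp" using nL by (auto intro!: uhpI simp: V_def)
    ultimately have "(\<lambda>q. f (L q)) holomorphic_on V"
      using holomorphic_on_compose_gen[OF _ hol, of L V] by (simp add: o_def)
    hence "A holomorphic_on V"
      by (rule holomorphic_transform) (use nL A uhpI in \<open>auto simp: V_def\<close>, metis)
    thus "A field_differentiable at q0 within ball 0 1 - {0}"
      using V holomorphic_on_imp_differentiable_at field_differentiable_at_within by blast
  qed
  define B where "B = (\<lambda>q. A q / q ^ l)"
  have "B holomorphic_on ball 0 1 - {0}" unfolding B_def by (intro holomorphic_intros Ahol) auto
  moreover have "\<forall>\<^sub>F q in at 0. norm (B q) \<le> C"
    unfolding eventually_at
  proof (intro exI[of _ "min 1 (exp (- 2 * pi * b))"] conjI ballI impI)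
    fix q :: complex assume q: "q \<noteq> 0 \<and> dist q 0 < min 1 (exp (- 2 * pi * b))"
    then obtain \<tau> where \<tau>: "nome \<tau> = q" "Im \<tau> = - ln (norm q) / (2 * pi)" using nome_surj by metis
    have n: "exp (- 2 * pi * Im \<tau>) = norm q" using \<tau>(1) norm_nome by metis
    have "exp (- 2 * pi * Im \<tau>) < exp (- 2 * pi * b)" unfolding n using q by simp
    hence "Im \<tau> \<ge> b" by simp
    from bd[OF this] have "norm (f \<tau>) \<le> C * exp (- 2 * pi * Im \<tau>) ^ l"
      by (simp flip: exp_of_nat_mult add: mult_ac)
    moreover have "\<tau> \<in> uhp" using \<tau> q by (intro uhpI) auto
    ultimately show "norm (B q) \<le> C"
      using A[of \<tau>] q \<tau>(1) unfolding n by (simp add: B_def norm_divide norm_power field_simps)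
  qed auto
  ultimately obtain g where g: "g holomorphic_on ball 0 1" "\<And>q. q \<in> ball 0 1 - {0} \<Longrightarrow> g q = B q"
    using holomorphic_on_extend_bounded[of B "ball 0 1" 0] by auto
  have gn: "g (nome \<tau>) = f \<tau> / nome \<tau> ^ l" if "\<tau> \<in> uhp" for \<tau>
    using g(2)[of "nome \<tau>"] A[OF that] nome_in_ball[OF that] by (simp add: B_def)
  have nt: "nome (\<i> * of_real t) = of_real (exp (- 2 * pi * t))" for t
    by (simp add: nome_def flip: exp_of_real) (simp add: algebra_simps)
  have "g 0 = 0"
  proof (rule tendsto_unique)
    have "continuous (at 0) g"
      using g(1) holomorphic_on_imp_continuous_on continuous_on_eq_continuous_at[of "ball 0 1" g] by simp
    moreover have "((\<lambda>t::real. exp (- 2 * pi * t)) \<longlongrightarrow> 0) at_top" by real_asymp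
    hence "((\<lambda>t. nome (\<i> * of_real t)) \<longlongrightarrow> 0) at_top"
      unfolding nt using tendsto_of_real by fastforce
    ultimately show "((\<lambda>t. g (nome (\<i> * of_real t))) \<longlongrightarrow> g 0) at_top"
      by (rule isCont_tendsto_compose)
    show "((\<lambda>t. g (nome (\<i> * of_real t))) \<longlongrightarrow> 0) at_top"
    proof (rule Lim_transform_eventually[OF lim])
      show "\<forall>\<^sub>F t in at_top. f (\<i> * of_real t) * of_real (exp (2 * pi * l * t)) = g (nome (\<i> * of_real t))"
        using eventually_gt_at_top[of 0]
      proof eventually_elim
        case (elim t)
        have "\<i> * of_real t \<in> uhp" using elim by (simp add: uhp_def)
        moreover have "exp (2 * pi * l * t) = 1 / exp (- 2 * pi * t) ^ l"
        proof -
          have "exp (2 * pi * l * t) = exp (2 * pi * t) ^ l"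
            by (simp add: mult_ac flip: exp_of_nat_mult)
          thus ?thesis by (simp add: exp_minus power_divide inverse_eq_divide)
        qed
        ultimately show ?case using gn[of "\<i> * of_real t"] by (simp add: nt)
      qed
    qed
  qed simp
  define h where "h = (\<lambda>q. if q = 0 then deriv g 0 else (g q - g 0) / (q - 0))"
  have "h holomorphic_on ball 0 1" unfolding h_def by (rule pole_lemma_open[OF g(1)]) simp
  moreover have "f \<tau> = nome \<tau> ^ Suc l * h (nome \<tau>)" if "\<tau> \<in> uhp" for \<tau>
    using gn[OF that] by (simp add: h_def \<open>g 0 = 0\<close>)
  ultimately show ?thesis unfolding vanishes_at_infinity_def by blast
qed

section \<open>Degree two forms near the diagonal\<close>

text \<open>The leading minors of Im Z: this is the Siegel upper half-space in coordinates, and Im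
  z3 > 0 is implied.\<close>

definition siegel_dom :: "(complex \<times> complex \<times> complex) set" where
  "siegel_dom = {(z1, z2, z3). Im z1 > 0 \<and> (Im z2)\<^sup>2 < Im z1 * Im z3}"

lemma siegel_dom_iff [simp]:
  "(z1, z2, z3) \<in> siegel_dom \<longleftrightarrow> Im z1 > 0 \<and> (Im z2)\<^sup>2 < Im z1 * Im z3"
  by (simp add: siegel_dom_def)

text \<open>Holomorphy is required along holomorphic curves, which is how one-variable function
  theory is applied to \<open>F\<close>. The symmetries come from the integral translations, from
  diag (1, -1) and the shears in GL_2(Z), and from the inversion of SL_2(Z) embedded in the variable
  z3.\<close>

locale siegel_form_12 =
  fixes F :: "complex \<Rightarrow> complex \<Rightarrow> complex \<Rightarrow> complex"
  assumes cont: "continuous_on siegel_dom (\<lambda>(z1, z2, z3). F z1 z2 z3)"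
    and hol: "\<And>S a b c. open S \<Longrightarrow> a holomorphic_on S \<Longrightarrow> b holomorphic_on S \<Longrightarrow> c holomorphic_on S \<Longrightarrow>
      (\<And>w. w \<in> S \<Longrightarrow> (a w, b w, c w) \<in> siegel_dom) \<Longrightarrow> (\<lambda>w. F (a w) (b w) (c w)) holomorphic_on S"
    and transl: "\<And>z1 z2 z3 l m n. (z1, z2, z3) \<in> siegel_dom \<Longrightarrow>
      F (z1 + of_int l) (z2 + of_int m) (z3 + of_int n) = F z1 z2 z3"
    and reflect: "\<And>z1 z2 z3. (z1, z2, z3) \<in> siegel_dom \<Longrightarrow> F z1 (- z2) z3 = F z1 z2 z3"
    and heis: "\<And>z1 z2 z3 l. (z1, z2, z3) \<in> siegel_dom \<Longrightarrow>
      F z1 (z2 + of_int l * z1) (z3 + 2 * of_int l * z2 + (of_int l)\<^sup>2 * z1) = F z1 z2 z3"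
    and inv: "\<And>z1 z2 z3. (z1, z2, z3) \<in> siegel_dom \<Longrightarrow>
      F (z1 - z2\<^sup>2 / z3) (z2 / z3) (- 1 / z3) = z3 ^ 12 * F z1 z2 z3"
    and cusp: "\<And>z1. Im z1 > 0 \<Longrightarrow> ((\<lambda>t::real. F z1 0 (\<i> * of_real t)) \<longlongrightarrow> 0) at_top"
    and nonzero: "\<exists>z1 z2 z3. (z1, z2, z3) \<in> siegel_dom \<and> F z1 z2 z3 \<noteq> 0"
begin

definition coef :: "nat \<Rightarrow> complex \<Rightarrow> complex \<Rightarrow> complex" where
  "coef m z1 z3 = lead m (\<lambda>w. F z1 w z3)"

text \<open>Under this condition \<open>coef m\<close> is a genuine Taylor coefficient at every
  point of the diagonal.\<close>

definition order_ge :: "nat \<Rightarrow> bool" where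
  "order_ge m \<longleftrightarrow> (\<forall>i<m. \<forall>z1\<in>uhp. \<forall>z3\<in>uhp. coef i z1 z3 = 0)"

section \<open>Taylor coefficients along the diagonal as modular forms\<close>

lemma in_domI:
  assumes "norm w < r" "r\<^sup>2 \<le> Im z1 * Im z3" "Im z1 > 0"
  shows "(z1, w, z3) \<in> siegel_dom"
proof -
  have "\<bar>Im w\<bar> < r" using assms abs_Im_le_cmod le_less_trans by blast
  hence "(Im w)\<^sup>2 < r\<^sup>2" by (metis abs_ge_zero power2_abs power_strict_mono zero_less_numeral)
  thus ?thesis using assms by simp
qed

lemma hol_middle:
  assumes "r\<^sup>2 \<le> Im z1 * Im z3" "Im z1 > 0"
  shows "(\<lambda>w. F z1 w z3) holomorphic_on ball 0 r"
  by (rule hol) (use assms in_domI in auto)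

lemma lead_0:
  assumes "z1 \<in> uhp" "z3 \<in> uhp"
  shows "coef 0 z1 z3 = F z1 0 z3"
proof -
  define r where "r = sqrt (Im z1 * Im z3)"
  have r: "r > 0" "r\<^sup>2 \<le> Im z1 * Im z3" using assms by (auto simp: r_def uhp_def)
  show ?thesis unfolding coef_def
    by (rule lead_eqI[of "\<lambda>w. F z1 w z3" r]) (use hol_middle[OF r(2)] r assms in \<open>auto simp: uhp_def\<close>)
qed

text \<open>No radius in the middle variable serves all s in \<open>uhp\<close>. On Im s > b one
  with r^2 <= b * Im z3 does, and on this product the results on jointly continuous quotients
  apply.\<close>

lemma quot_cont_1:
  assumes "order_ge m" "b > 0" "Im z3 > 0" "r > 0" "r\<^sup>2 \<le> b * Im z3"
  shows "continuous_on ({s. Im s > b} \<times> ball 0 r) (\<lambda>(s, w). quot m (\<lambda>w. F s w z3) w)"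
    and "(\<lambda>s. coef m s z3) holomorphic_on {s. Im s > b}"
proof -
  have dom: "(s, w, z3) \<in> siegel_dom" if "Im s > b" "norm w < r" for s w
  proof (rule in_domI[OF that(2)])
    have "b * Im z3 \<le> Im s * Im z3" using that assms by (intro mult_right_mono) auto
    thus "r\<^sup>2 \<le> Im s * Im z3" using assms by linarith
  qed (use that assms in auto)
  have c: "continuous_on ({s. Im s > b} \<times> ball 0 r) (\<lambda>(s, w). F s w z3)"
  proof -
    have "continuous_on ({s. Im s > b} \<times> ball 0 r) (\<lambda>x. (\<lambda>(z1, z2, z3). F z1 z2 z3) (fst x, snd x, z3))"
      by (rule continuous_on_compose2[OF cont]) (use dom in \<open>auto intro!: continuous_intros\<close>)
    thus ?thesis by (simp add: case_prod_unfold)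
  qed
  have h: "(\<lambda>w. F s w z3) holomorphic_on ball 0 r" if "s \<in> {s. Im s > b}" for s
    by (rule hol) (use that dom in auto)
  have h': "(\<lambda>s. F s w z3) holomorphic_on {s. Im s > b}" if "w \<in> ball 0 r" for w
    by (rule hol) (use that dom in \<open>auto simp: open_halfspace_Im_gt\<close>)
  have o: "lead i (\<lambda>w. F s w z3) = 0" if "s \<in> {s. Im s > b}" "i < m" for s i
    using assms that unfolding order_ge_def coef_def uhp_def by auto
  show "continuous_on ({s. Im s > b} \<times> ball 0 r) (\<lambda>(s, w). quot m (\<lambda>w. F s w z3) w)"
    by (rule continuous_on_quot[OF open_halfspace_Im_gt \<open>r > 0\<close> c h o])
  show "(\<lambda>s. coef m s z3) holomorphic_on {s. Im s > b}" unfolding coef_def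
    by (rule holomorphic_on_lead[OF open_halfspace_Im_gt \<open>r > 0\<close> c h h' o])
qed

text \<open>Vanishing is assumed at the given \<open>z1\<close> only, because the decay estimate
  works on a single slice z1 = i y.\<close>

lemma quot_cont_3:
  assumes ord: "\<And>i z3. i < m \<Longrightarrow> z3 \<in> uhp \<Longrightarrow> coef i z1 z3 = 0" and "b > 0" "Im z1 > 0" "r > 0" "r\<^sup>2 \<le> b * Im z1"
  shows "continuous_on ({s. Im s > b} \<times> ball 0 r) (\<lambda>(s, w). quot m (\<lambda>w. F z1 w s) w)"
    and "(\<lambda>s. coef m z1 s) holomorphic_on {s. Im s > b}"
proof -
  have dom: "(z1, w, s) \<in> siegel_dom" if "Im s > b" "norm w < r" for s w
  proof (rule in_domI[OF that(2)])
    have "b * Im z1 \<le> Im s * Im z1" using that assms by (intro mult_right_mono) auto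
    thus "r\<^sup>2 \<le> Im z1 * Im s" using assms by (subst mult.commute) linarith
  qed (use that assms in auto)
  have c: "continuous_on ({s. Im s > b} \<times> ball 0 r) (\<lambda>(s, w). F z1 w s)"
  proof -
    have "continuous_on ({s. Im s > b} \<times> ball 0 r) (\<lambda>x. (\<lambda>(z1, z2, z3). F z1 z2 z3) (z1, snd x, fst x))"
      by (rule continuous_on_compose2[OF cont]) (use dom in \<open>auto intro!: continuous_intros\<close>)
    thus ?thesis by (simp add: case_prod_unfold)
  qed
  have h: "(\<lambda>w. F z1 w s) holomorphic_on ball 0 r" if "s \<in> {s. Im s > b}" for s
    by (rule hol) (use that dom in auto)
  have h': "(\<lambda>s. F z1 w s) holomorphic_on {s. Im s > b}" if "w \<in> ball 0 r" for w
    by (rule hol) (use that dom in \<open>auto simp: open_halfspace_Im_gt\<close>)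
  have o: "lead i (\<lambda>w. F z1 w s) = 0" if "s \<in> {s. Im s > b}" "i < m" for s i
    using ord[of i s] assms(2) that unfolding coef_def uhp_def by auto
  show "continuous_on ({s. Im s > b} \<times> ball 0 r) (\<lambda>(s, w). quot m (\<lambda>w. F z1 w s) w)"
    by (rule continuous_on_quot[OF open_halfspace_Im_gt \<open>r > 0\<close> c h o])
  show "(\<lambda>s. coef m z1 s) holomorphic_on {s. Im s > b}" unfolding coef_def
    by (rule holomorphic_on_lead[OF open_halfspace_Im_gt \<open>r > 0\<close> c h h' o])
qed

lemma uhp_Union: "uhp = (\<Union>b\<in>{0<..}. {s. Im s > b})"
proof (intro equalityI subsetI)
  fix x assume "x \<in> uhp"
  thus "x \<in> (\<Union>b\<in>{0<..}. {s. Im s > b})"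
    by (auto simp: uhp_def intro!: bexI[of _ "Im x / 2"])
qed (auto simp: uhp_def)

lemma coef_hol_1:
  assumes "order_ge m" "z3 \<in> uhp"
  shows "(\<lambda>s. coef m s z3) holomorphic_on uhp"
  unfolding uhp_Union
proof (rule holomorphic_on_UN_open)
  fix b :: real assume "b \<in> {0<..}"
  thus "(\<lambda>s. coef m s z3) holomorphic_on {s. Im s > b}"
    using assms quot_cont_1(2)[of m b z3 "sqrt (b * Im z3)"] by (simp add: uhp_def)
qed (simp add: open_halfspace_Im_gt)

lemma coef_hol_3:
  assumes "order_ge m" "z1 \<in> uhp"
  shows "(\<lambda>s. coef m z1 s) holomorphic_on uhp"
  unfolding uhp_Union
proof (rule holomorphic_on_UN_open)
  fix b :: real assume "b \<in> {0<..}"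
  thus "(\<lambda>s. coef m z1 s) holomorphic_on {s. Im s > b}"
    using assms quot_cont_3(2)[of m z1 b "sqrt (b * Im z1)"] by (simp add: uhp_def order_ge_def)
qed (simp add: open_halfspace_Im_gt)

text \<open>In the limit \<open>z\<^sub>2 \<longlongrightarrow> 0\<close> of the inversion law, the argument \<open>z\<^sub>1 - z\<^sub>2\<^sup>2 / z\<^sub>3\<close> becomes
  \<open>z\<^sub>1\<close> and every power of \<open>z\<^sub>2\<close> contributes one to the weight.\<close>

lemma coef_inversion:
  assumes "order_ge m" "z1 \<in> uhp" "z3 \<in> uhp"
  shows "coef m z1 (- 1 / z3) = z3 ^ (12 + m) * coef m z1 z3"
proof -
  define y where "y = Im z1 / 2"
  define s where "s = - 1 / z3"
  have y: "y > 0" "Im z1 > y" using assms by (auto simp: y_def uhp_def)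
  have s: "Im s > 0" using minus_inverse_in_uhp(1)[OF assms(3)] by (simp add: s_def uhp_def)
  have z3: "z3 \<noteq> 0" "Im z3 > 0" using assms by (auto simp: uhp_def)
  define r where "r = sqrt (y * Im s)"
  have r: "r > 0" "r\<^sup>2 \<le> y * Im s" using y s by (auto simp: r_def)
  have "continuous_on ({s. Im s > y} \<times> ball 0 r) (\<lambda>(z, w). quot m (\<lambda>w. F z w s) w)"
    by (rule quot_cont_1[OF assms(1) y(1) s r])
  hence "isCont (\<lambda>(z, w). quot m (\<lambda>w. F z w s) w) (z1, 0)"
    by (rule continuous_on_interior) (use y r in \<open>simp add: interior_open open_Times open_halfspace_Im_gt\<close>)
  moreover have "((\<lambda>w. (z1 - w\<^sup>2 / z3, w / z3)) \<longlongrightarrow> (z1 - 0\<^sup>2 / z3, 0 / z3)) (at 0)"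
    using z3 by (intro tendsto_intros) auto
  hence "((\<lambda>w. (z1 - w\<^sup>2 / z3, w / z3)) \<longlongrightarrow> (z1, 0)) (at 0)" by simp
  ultimately have "((\<lambda>w. (\<lambda>(z, w). quot m (\<lambda>w. F z w s) w) (z1 - w\<^sup>2 / z3, w / z3)) \<longlongrightarrow>
      (\<lambda>(z, w). quot m (\<lambda>w. F z w s) w) (z1, 0)) (at 0)"
    by (rule isCont_tendsto_compose)
  hence 1: "((\<lambda>w. quot m (\<lambda>w'. F (z1 - w\<^sup>2 / z3) w' s) (w / z3)) \<longlongrightarrow> coef m z1 s) (at 0)"
    by (simp add: coef_def)
  define r' where "r' = sqrt (Im z1 * Im z3)"
  have r': "r' > 0" "r'\<^sup>2 \<le> Im z1 * Im z3" using y z3 by (auto simp: r'_def)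
  have "quot m (\<lambda>w. F z1 w z3) holomorphic_on ball 0 r'"
    using assms y by (intro quot_holomorphic hol_middle r') (auto simp: order_ge_def coef_def)
  hence "continuous (at 0) (quot m (\<lambda>w. F z1 w z3))"
    using r' holomorphic_on_imp_continuous_on continuous_on_eq_continuous_at[of "ball 0 r'"] by force
  hence 2: "((\<lambda>w. z3 ^ (12 + m) * quot m (\<lambda>w. F z1 w z3) w) \<longlongrightarrow> z3 ^ (12 + m) * coef m z1 z3) (at 0)"
    by (intro tendsto_mult_left) (simp add: continuous_at coef_def)
  have "\<forall>\<^sub>F w in at 0. z3 ^ (12 + m) * quot m (\<lambda>w. F z1 w z3) w = quot m (\<lambda>w'. F (z1 - w\<^sup>2 / z3) w' s) (w / z3)"
    unfolding eventually_at
  proof (intro exI[of _ r'] conjI ballI impI)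
    fix w :: complex assume w: "w \<noteq> 0 \<and> dist w 0 < r'"
    hence "(z1, w, z3) \<in> siegel_dom" using r' y by (intro in_domI) auto
    from inv[OF this] show "z3 ^ (12 + m) * quot m (\<lambda>w. F z1 w z3) w = quot m (\<lambda>w'. F (z1 - w\<^sup>2 / z3) w' s) (w / z3)"
      using w z3 by (simp add: quot_def s_def power_add power_divide)
  qed (use r' in auto)
  from tendsto_unique[OF _ 1 Lim_transform_eventually[OF 2 this]] show ?thesis by (simp add: s_def)
qed

lemma coef_weakly_modular:
  assumes "order_ge m" "z1 \<in> uhp"
  shows "weakly_modular (12 + m) (coef m z1)"
  unfolding weakly_modular_def
proof (intro conjI ballI)
  show "coef m z1 holomorphic_on uhp" by (rule coef_hol_3[OF assms])
  fix \<tau> assume \<tau>: "\<tau> \<in> uhp"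
  show "coef m z1 (- 1 / \<tau>) = \<tau> ^ (12 + m) * coef m z1 \<tau>" by (rule coef_inversion[OF assms \<tau>])
  define r where "r = sqrt (Im z1 * Im \<tau>)"
  have r: "r > 0" "r\<^sup>2 \<le> Im z1 * Im \<tau>" using assms \<tau> by (auto simp: r_def uhp_def)
  have "F z1 w (\<tau> + 1) = F z1 w \<tau>" if "w \<in> ball 0 r" for w
    using transl[of z1 w \<tau> 0 0 1] in_domI[of w r z1 \<tau>] that r assms by (simp add: uhp_def)
  hence ev: "\<forall>\<^sub>F w in at 0. F z1 w (\<tau> + 1) / w ^ m = F z1 w \<tau> / w ^ m"
    unfolding eventually_at using r by (intro exI[of _ r]) auto
  show "coef m z1 (\<tau> + 1) = coef m z1 \<tau>"
    unfolding coef_def lead_def Topological_Spaces.Lim_def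
    using tendsto_cong[OF ev] by simp
qed

section \<open>Decay at the cusp forced by zeros on the diagonal\<close>

lemma order_leads:
  assumes "order_ge m" "z1 \<in> uhp" "z3 \<in> uhp" "i < m"
  shows "lead i (\<lambda>w. F z1 w z3) = 0"
  using assms unfolding order_ge_def coef_def by blast

text \<open>For Im z1 = y this is det (Im Z) / Im z1, which is invariant under the Jacobi
  group.\<close>

definition height :: "real \<Rightarrow> complex \<Rightarrow> complex \<Rightarrow> real" where
  "height y z2 z3 = Im z3 - (Im z2)\<^sup>2 / y"

lemma height_dom: "y > 0 \<Longrightarrow> height y z2 z3 > 0 \<longleftrightarrow> (\<i> * of_real y, z2, z3) \<in> siegel_dom"
  by (simp add: height_def field_simps)

text \<open>Since z1 = i y is purely imaginary, \<open>heis\<close> shifts z2 vertically by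
  multiples of y; translations then normalise the real parts without changing the height.\<close>

lemma jacobi_reduction:
  assumes y: "y > 0" and h: "height y z2 z3 > 0"
  obtains z2' z3' where "F (\<i> * of_real y) z2' z3' = F (\<i> * of_real y) z2 z3" "height y z2' z3' = height y z2 z3"
    "\<bar>Re z2'\<bar> \<le> 1/2" "\<bar>Im z2'\<bar> \<le> y / 2" "\<bar>Re z3'\<bar> \<le> 1/2"
proof -
  define l where "l = - round (Im z2 / y)"
  define u where "u = z2 + of_int l * (\<i> * of_real y)"
  define v where "v = z3 + 2 * of_int l * z2 + (of_int l)\<^sup>2 * (\<i> * of_real y)"
  have 1: "F (\<i> * of_real y) u v = F (\<i> * of_real y) z2 z3"
    unfolding u_def v_def by (rule heis) (use h height_dom[OF y] in auto)
  have huv: "height y u v = height y z2 z3"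
    using y by (simp add: height_def u_def v_def power2_eq_square field_simps)
  have 2: "F (\<i> * of_real y) (u + of_int (- round (Re u))) (v + of_int (- round (Re v))) = F (\<i> * of_real y) u v"
  proof -
    have "(\<i> * of_real y, u, v) \<in> siegel_dom"
      unfolding height_dom[OF y, symmetric] huv by (rule h)
    from transl[OF this, of 0 "- round (Re u)" "- round (Re v)"] show ?thesis by simp
  qed
  have "\<bar>Im z2 / y - of_int (round (Im z2 / y))\<bar> \<le> 1/2"
    using of_int_round_abs_le[of "Im z2 / y"] by (simp add: abs_minus_commute)
  moreover have "Im z2 / y - of_int (round (Im z2 / y)) = Im u / y"
    using y by (simp add: u_def l_def field_simps)
  ultimately have "\<bar>Im u\<bar> \<le> y / 2" using y by (simp add: abs_divide field_simps)
  moreover have "\<bar>Re u - of_int (round (Re u))\<bar> \<le> 1/2" "\<bar>Re v - of_int (round (Re v))\<bar> \<le> 1/2"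
    using of_int_round_abs_le[of "Re u"] of_int_round_abs_le[of "Re v"] by (simp_all add: abs_minus_commute)
  ultimately show thesis
    using that[of "u + of_int (- round (Re u))" "v + of_int (- round (Re v))"] 1 2 huv
    by (simp add: height_def)
qed

lemma bounded_on_strip:
  assumes y: "y > 0"
  shows "\<exists>C. \<forall>z2 z3. 1 \<le> height y z2 z3 \<and> height y z2 z3 \<le> 21/20 \<longrightarrow> norm (F (\<i> * of_real y) z2 z3) \<le> C"
proof -
  define K where "K = cbox (Complex (-1/2) (-y/2)) (Complex (1/2) (y/2)) \<times> cbox (Complex (-1/2) 1) (Complex (1/2) (21/20))"
  \<comment> \<open>Subtracting i (Im z2)^2 / y from z3 makes the height the imaginary part of s, so
    that the reduced points of the strip fill the compact box \<open>K\<close>.\<close>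
  define f where "f = (\<lambda>(z, s). F (\<i> * of_real y) z (s + \<i> * of_real ((Im z)\<^sup>2 / y)))"
  have "compact K" unfolding K_def by (intro compact_Times compact_cbox)
  moreover have "continuous_on K f"
  proof -
    have "(\<i> * of_real y, z, s + \<i> * of_real ((Im z)\<^sup>2 / y)) \<in> siegel_dom" if "(z, s) \<in> K" for z s
      using that y by (subst height_dom[symmetric]) (auto simp: K_def height_def in_cbox_complex_iff)
    hence "continuous_on K (\<lambda>x. (\<lambda>(z1, z2, z3). F z1 z2 z3) (\<i> * of_real y, fst x, snd x + \<i> * of_real ((Im (fst x))\<^sup>2 / y)))"
      by (intro continuous_on_compose2[OF cont] continuous_intros) (use y in auto)
    thus ?thesis by (simp add: f_def case_prod_unfold)
  qed
  ultimately have "bounded (f ` K)" by (intro compact_imp_bounded compact_continuous_image)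
  then obtain C where C: "\<forall>w\<in>f ` K. norm w \<le> C" unfolding bounded_iff by blast
  have "norm (F (\<i> * of_real y) z2 z3) \<le> C" if hh: "1 \<le> height y z2 z3" "height y z2 z3 \<le> 21/20" for z2 z3
  proof -
    obtain z2' z3' where z: "F (\<i> * of_real y) z2' z3' = F (\<i> * of_real y) z2 z3" "height y z2' z3' = height y z2 z3"
      "\<bar>Re z2'\<bar> \<le> 1/2" "\<bar>Im z2'\<bar> \<le> y / 2" "\<bar>Re z3'\<bar> \<le> 1/2"
      by (rule jacobi_reduction[OF y, of z2 z3]) (use hh in auto)
    define s where "s = z3' - \<i> * of_real ((Im z2')\<^sup>2 / y)"
    have "(z2', s) \<in> K" using z hh by (auto simp: K_def in_cbox_complex_iff s_def height_def)
    hence "norm (f (z2', s)) \<le> C" using C by blast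
    thus ?thesis using z(1) by (simp add: f_def s_def)
  qed
  thus ?thesis by blast
qed

text \<open>Along the curve \<open>w \<mapsto> (w, z\<^sub>3 - \<i> (w\<^sup>2 - z\<^sub>2\<^sup>2) / (2 y))\<close> the invariant height depends only on
  \<open>\<bar>w\<bar>\<close>; the maximum principle there, sharpened by the zero of order \<open>2 j\<close> at \<open>w = 0\<close>, trades a
  decrease \<open>1/20\<close> of the height for a factor \<open>exp (4/25 * j)\<close>.\<close>

lemma height_step:
  fixes j :: nat
  assumes y: "1 \<le> y" "y \<le> 11/10"
    and ord: "\<And>i z3. i < 2 * j \<Longrightarrow> z3 \<in> uhp \<Longrightarrow> coef i (\<i> * of_real y) z3 = 0"
    and B: "\<And>z2 z3. height y z2 z3 = h - 1/20 \<Longrightarrow> norm (F (\<i> * of_real y) z2 z3) \<le> B"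
    and h: "h \<ge> 21/20" "height y z2 z3 = h"
  shows "norm (F (\<i> * of_real y) z2 z3) \<le> exp (- (4/25) * j) * B"
proof -
  have y0: "y > 0" using y by simp
  obtain u v where uv: "F (\<i> * of_real y) u v = F (\<i> * of_real y) z2 z3" "height y u v = h"
      "\<bar>Re u\<bar> \<le> 1/2" "\<bar>Im u\<bar> \<le> y / 2"
    by (rule jacobi_reduction[OF y0, of z2 z3]) (use h in auto)
  define c where "c = (\<lambda>w. v - \<i> * (w\<^sup>2 - u\<^sup>2) / of_real (2 * y))"
  define g where "g = (\<lambda>w. F (\<i> * of_real y) w (c w))"
  have hc: "height y w (c w) = h + ((norm u)\<^sup>2 - (norm w)\<^sup>2) / (2 * y)" for w
  proof -
    have "Im (c w) = Im v - (Re (w\<^sup>2) - Re (u\<^sup>2)) / (2 * y)"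
      using y0 by (simp add: c_def Im_divide_of_real del: of_real_mult)
    also have "Re (w\<^sup>2) - Re (u\<^sup>2) = (norm w)\<^sup>2 - 2 * (Im w)\<^sup>2 - (norm u)\<^sup>2 + 2 * (Im u)\<^sup>2"
      by (simp add: cmod_power2 Re_power2)
    finally have eq: "Im (c w) = Im v - ((norm w)\<^sup>2 - 2 * (Im w)\<^sup>2 - (norm u)\<^sup>2 + 2 * (Im u)\<^sup>2) / (2 * y)" .
    show ?thesis unfolding uv(2)[symmetric] height_def eq
      using y0 by (simp add: field_simps)
  qed
  \<comment> \<open>At |w| = R the height has dropped by (R^2 - |u|^2) / (2 y) = 1/20. The larger R'
    corresponds to a drop of 1/10 and still lies in the domain.\<close>
  define R where "R = sqrt ((norm u)\<^sup>2 + y / 10)"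
  define R' where "R' = sqrt ((norm u)\<^sup>2 + y / 5)"
  have R: "0 < R" "R < R'" "norm u \<le> R" "R\<^sup>2 = (norm u)\<^sup>2 + y / 10" "R'\<^sup>2 = (norm u)\<^sup>2 + y / 5"
    using y0 by (auto simp: R_def R'_def add_nonneg_pos intro!: real_le_rsqrt)
  have dom: "(\<i> * of_real y, w, c w) \<in> siegel_dom" if "norm w < R'" for w
  proof -
    have "(norm w)\<^sup>2 \<le> R'\<^sup>2" using that by (intro power_mono) auto
    hence "(norm w)\<^sup>2 - (norm u)\<^sup>2 \<le> y / 5" using R by simp
    hence "((norm w)\<^sup>2 - (norm u)\<^sup>2) / (2 * y) \<le> 1 / 10" using y0 by (simp add: field_simps)
    hence "height y w (c w) > 0" unfolding hc using h by (simp add: diff_divide_distrib)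
    thus ?thesis using height_dom[OF y0] by blast
  qed
  have gh: "g holomorphic_on ball 0 R'" unfolding g_def
    by (rule hol) (use dom y0 in \<open>auto simp: c_def intro!: holomorphic_intros\<close>)
  define G where "G = (\<lambda>w. quot (2 * j) (\<lambda>w'. F (\<i> * of_real y) w' (c w)) w)"
  have Gg: "G w = g w / w ^ (2 * j)" if "w \<noteq> 0" for w
    using that by (simp add: G_def g_def quot_def)
  have c0: "Im (c 0) > 0"
    using dom[of 0] R y0 by (auto simp: zero_less_mult_iff)
  \<comment> \<open>The third argument \<open>c w\<close> moves with w, so holomorphy of the
    quotient on one slice does not suffice; its joint continuity makes 0 a removable singularity of
    \<open>G\<close>.\<close>
  have Ghol: "G holomorphic_on ball 0 R'"
  proof (rule no_isolated_singularity'[of "{0}"])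
    have "(\<lambda>w. g w / w ^ (2 * j)) holomorphic_on ball 0 R' - {0}"
      by (intro holomorphic_intros holomorphic_on_subset[OF gh]) auto
    thus "G holomorphic_on ball 0 R' - {0}"
      by (rule holomorphic_transform) (use Gg in auto)
    fix z :: complex assume "z \<in> {0}"
    define b where "b = Im (c 0) / 2"
    have b: "b > 0" "Im (c 0) > b" using c0 by (auto simp: b_def)
    define r where "r = sqrt (b * Im (\<i> * of_real y))"
    have r: "r > 0" "r\<^sup>2 \<le> b * Im (\<i> * of_real y)" using b y0 by (auto simp: r_def)
    have "continuous_on ({s. Im s > b} \<times> ball 0 r) (\<lambda>(s, w). quot (2 * j) (\<lambda>w. F (\<i> * of_real y) w s) w)"
      by (rule quot_cont_3(1)[OF ord b(1) _ r]) (use y0 in auto)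
    hence "isCont (\<lambda>(s, w). quot (2 * j) (\<lambda>w. F (\<i> * of_real y) w s) w) (c 0, 0)"
      by (rule continuous_on_interior) (use b r in \<open>simp add: interior_open open_Times open_halfspace_Im_gt\<close>)
    moreover have "((\<lambda>w. (c w, w)) \<longlongrightarrow> (c 0, 0)) (at 0)"
      unfolding c_def using y0 by (intro tendsto_intros) auto
    ultimately have "((\<lambda>w. (\<lambda>(s, w). quot (2 * j) (\<lambda>w. F (\<i> * of_real y) w s) w) (c w, w)) \<longlongrightarrow>
        (\<lambda>(s, w). quot (2 * j) (\<lambda>w. F (\<i> * of_real y) w s) w) (c 0, 0)) (at 0)"
      by (rule isCont_tendsto_compose)
    hence "(G \<longlongrightarrow> G 0) (at 0)" by (simp add: G_def)
    thus "(G \<longlongrightarrow> G z) (at z within ball 0 R')"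
      using \<open>z \<in> {0}\<close> by (auto intro: tendsto_within_subset)
  qed auto
  have "norm (G u) \<le> B / R ^ (2 * j)"
  proof (rule norm_le_on_disc[OF Ghol R(1-3)])
    fix z :: complex assume z: "norm z = R"
    have "height y z (c z) = h - 1/20"
      unfolding hc z R(4) using y0 by (simp add: field_simps)
    hence "norm (g z) \<le> B" unfolding g_def by (rule B)
    moreover have "z \<noteq> 0" using z R by auto
    ultimately show "norm (G z) \<le> B / R ^ (2 * j)"
      using R by (simp add: Gg norm_divide norm_power z divide_right_mono)
  qed
  hence "norm u ^ (2 * j) * norm (G u) \<le> norm u ^ (2 * j) * (B / R ^ (2 * j))"
    by (rule mult_left_mono) simp
  also have "\<dots> = ((norm u)\<^sup>2 / R\<^sup>2) ^ j * B"
    by (simp add: power_mult power_divide)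
  also have "\<dots> \<le> exp (- (4/25)) ^ j * B"
  proof (intro mult_right_mono power_mono)
    \<comment> \<open>The gain is R^2 / |u|^2 = 1 + (y/10) / |u|^2, and reduction gives |u|^2 <= (1
      + y^2)/4. For 1 <= y <= 11/10 this leaves at least 1 + 87/500 = 587/500, just above exp
      (4/25).\<close>
    have "(norm u)\<^sup>2 \<le> (1/2)\<^sup>2 + (y/2)\<^sup>2" unfolding cmod_power2
      using uv(3,4) y0 by (intro add_mono) (metis abs_le_square_iff abs_of_nonneg divide_nonneg_nonneg less_imp_le zero_le_numeral zero_le_one)+
    also have "\<dots> \<le> y / 10 / (87/500)"
    proof -
      have "(y - 1) * (y - 11/10) \<le> 0" using y by (simp add: mult_nonneg_nonpos)
      moreover have "(y - 1) * (y - 11/10) = y * y - 21/10 * y + 11/10" by (simp add: field_simps)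
      ultimately have "y * y \<le> 21/10 * y - 11/10" by linarith
      thus ?thesis using y by (simp add: power2_eq_square)
    qed
    finally have "(norm u)\<^sup>2 * (587/500) \<le> R\<^sup>2" unfolding R(4) by simp
    moreover have "exp (4/25) \<le> (587/500::real)"
    proof (rule ccontr)
      assume "\<not> exp (4/25) \<le> (587/500::real)"
      hence "(587/500) ^ 25 \<le> exp (4/25::real) ^ 25" by (intro power_mono) auto
      also have "\<dots> = exp 1 ^ 4" by (simp flip: exp_of_nat_mult)
      also have "\<dots> \<le> (2.72::real) ^ 4"
        using e_approx_32 by (intro power_mono) (auto simp: abs_if split: if_splits)
      finally show False by (simp add: power_divide)
    qed
    ultimately have "(norm u)\<^sup>2 * exp (4/25) \<le> R\<^sup>2"
      by (meson mult_left_mono order.trans zero_le_power2)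
    thus "(norm u)\<^sup>2 / R\<^sup>2 \<le> exp (- (4/25))"
      using R(1) by (simp add: exp_minus field_simps)
    have "norm (g (of_real R)) \<le> B" unfolding g_def
      by (rule B, unfold hc, use R y0 in \<open>simp add: field_simps\<close>)
    thus "B \<ge> 0" by (rule order.trans[rotated]) simp
  qed auto
  also have "exp (- (4/25)) ^ j = exp (- (4/25) * j)" by (simp flip: exp_of_nat_mult)
  also have "norm u ^ (2 * j) * norm (G u) = norm (F (\<i> * of_real y) u v)"
  proof -
    have cu: "c u = v" by (simp add: c_def)
    define r where "r = sqrt (y * Im v)"
    have "Im v = h + (Im u)\<^sup>2 / y" using uv(2) by (simp add: height_def)
    hence v: "Im v > 0" using h y0 by (simp add: add_pos_nonneg)
    have "F (\<i> * of_real y) u v = u ^ (2 * j) * quot (2 * j) (\<lambda>w'. F (\<i> * of_real y) w' v) u"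
      by (rule quot_mult[of _ r])
        (use v y0 ord in \<open>auto simp: r_def coef_def uhp_def intro!: hol_middle\<close>)
    thus ?thesis by (simp add: G_def cu norm_mult norm_power)
  qed
  finally show ?thesis using uv(1) by simp
qed

text \<open>Climb in steps of 1/20 from the strip 1 <= height <= 21/20, where \<open>F\<close> is
  bounded. A factor exp (- 4/25 j) per step is the rate 20 * 4/25 = 16/5.\<close>

lemma exponential_decay:
  fixes j :: nat
  assumes y: "1 \<le> y" "y \<le> 11/10"
    and ord: "\<And>i z3. i < 2 * j \<Longrightarrow> z3 \<in> uhp \<Longrightarrow> coef i (\<i> * of_real y) z3 = 0"
  shows "\<exists>C\<ge>0. \<forall>z2 z3. height y z2 z3 \<ge> 1 \<longrightarrow>
    norm (F (\<i> * of_real y) z2 z3) \<le> C * exp (- (16/5) * j * height y z2 z3)"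
proof -
  obtain C where C: "\<And>z2 z3. 1 \<le> height y z2 z3 \<Longrightarrow> height y z2 z3 \<le> 21/20 \<Longrightarrow> norm (F (\<i> * of_real y) z2 z3) \<le> C"
    using bounded_on_strip[of y] y by auto
  have *: "norm (F (\<i> * of_real y) z2 z3) \<le> exp (- (4/25) * j * n) * C"
    if "1 + n / 20 \<le> height y z2 z3" "height y z2 z3 \<le> 1 + (n + 1) / 20" for n :: nat and z2 z3
    using that
  proof (induction n arbitrary: z2 z3)
    case (Suc n)
    have "norm (F (\<i> * of_real y) z2 z3) \<le> exp (- (4/25) * j) * (exp (- (4/25) * j * n) * C)"
    proof (rule height_step[OF y ord _ _ refl])
      fix u v assume "height y u v = height y z2 z3 - 1/20"
      thus "norm (F (\<i> * of_real y) u v) \<le> exp (- (4/25) * j * n) * C"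
        using Suc.prems by (intro Suc.IH) (simp_all add: add_divide_distrib)
    qed (use Suc.prems in \<open>simp_all add: add_divide_distrib\<close>)
    also have "\<dots> = exp (- (4/25) * j * Suc n) * C"
      by (simp add: algebra_simps flip: exp_add)
    finally show ?case .
  qed (use C in auto)
  have "norm (F (\<i> * of_real y) 0 (\<i>)) \<le> C" using y by (intro C) (auto simp: height_def)
  hence C0: "C \<ge> 0" by (rule order.trans[rotated]) simp
  \<comment> \<open>84/25 = 16/5 + 4/25: the first term accounts for starting at height 1, the
    second for rounding the number of steps down.\<close>
  show ?thesis
  proof (intro exI[of _ "C * exp (84/25 * j)"] conjI allI impI)
    fix z2 z3 assume h: "height y z2 z3 \<ge> 1"
    define x where "x = (height y z2 z3 - 1) * 20"
    define n where "n = nat \<lfloor>x\<rfloor>"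
    have "x \<ge> 0" using h by (simp add: x_def)
    hence "real n \<le> x" "x \<le> real n + 1" unfolding n_def by linarith+
    hence n: "real n \<le> (height y z2 z3 - 1) * 20" "(height y z2 z3 - 1) * 20 \<le> real n + 1"
      by (simp_all add: x_def)
    have "norm (F (\<i> * of_real y) z2 z3) \<le> exp (- (4/25) * j * n) * C"
      using n by (intro *) (simp_all add: add_divide_distrib)
    also have "\<dots> \<le> exp (84/25 * j - (16/5) * j * height y z2 z3) * C"
    proof (intro mult_right_mono C0)
      have "(4/25) * j * ((height y z2 z3 - 1) * 20) \<le> (4/25) * j * (real n + 1)"
        using n by (intro mult_left_mono) auto
      thus "exp (- (4/25) * j * n) \<le> exp (84/25 * j - (16/5) * j * height y z2 z3)"
        by (simp add: algebra_simps)
    qed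
    finally have ub: "norm (F (\<i> * of_real y) z2 z3) \<le> exp (84/25 * j - (16/5) * j * height y z2 z3) * C" .
    show "norm (F (\<i> * of_real y) z2 z3) \<le> C * exp (84/25 * j) * exp (- (16/5) * j * height y z2 z3)"
    proof -
      have "84/25 * j - (16/5) * j * height y z2 z3 = 84/25 * j + - (16/5) * j * height y z2 z3" by simp
      hence "exp (84/25 * j - (16/5) * j * height y z2 z3) * C =
          C * exp (84/25 * j) * exp (- (16/5) * j * height y z2 z3)"
        by (simp only: exp_add mult_ac)
      from this ub show ?thesis by (rule subst)
    qed
  qed (use C0 in auto)
qed

text \<open>Cauchy's estimate on |w| = 1 lowers the height by at most 1, so the coefficient inherits
  the rate 16/5 j. As 16/5 > pi, this exceeds 2 pi floor (j/2) strictly for j > 0 and yields one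
  further order; for j = 0 that order comes from the cusp condition.\<close>

lemma coef_vanishing:
  assumes y: "1 \<le> y" "y \<le> 11/10" and ord: "order_ge (2 * j)"
  shows "vanishes_at_infinity (Suc (j div 2)) (coef (2 * j) (\<i> * of_real y))"
proof -
  define z1 where "z1 = \<i> * of_real y"
  have z1: "z1 \<in> uhp" using y by (simp add: z1_def uhp_def)
  obtain C where C: "C \<ge> 0" "\<And>z2 z3. height y z2 z3 \<ge> 1 \<Longrightarrow> norm (F z1 z2 z3) \<le> C * exp (- (16/5) * j * height y z2 z3)"
    using exponential_decay[OF y, of j] order_leads[OF ord] z1 unfolding z1_def coef_def by metis
  have bd: "norm (coef (2 * j) z1 z3) \<le> C * exp (- (16/5) * j * (Im z3 - 1))" if z3: "Im z3 \<ge> 2" for z3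
  proof -
    define r where "r = sqrt (y * Im z3)"
    have "y * Im z3 \<ge> 1 * 2" using y z3 by (intro mult_mono) auto
    hence r: "1 < r" "r\<^sup>2 \<le> Im z1 * Im z3" by (auto simp: r_def z1_def)
    have "norm (quot (2 * j) (\<lambda>w. F z1 w z3) 0) \<le> C * exp (- (16/5) * j * (Im z3 - 1)) / 1 ^ (2 * j)"
    proof (rule quot_bound[of _ r])
      show "(\<lambda>w. F z1 w z3) holomorphic_on ball 0 r"
        by (rule hol_middle) (use r y in \<open>auto simp: z1_def\<close>)
      fix z :: complex assume "norm z = 1"
      hence "\<bar>Im z\<bar> \<le> 1" using abs_Im_le_cmod[of z] by simp
      hence "(Im z)\<^sup>2 \<le> 1" by (simp add: abs_square_le_1)
      hence "(Im z)\<^sup>2 / y \<le> 1" using y by (simp add: field_simps)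
      hence h: "height y z z3 \<ge> Im z3 - 1" by (simp add: height_def)
      hence "norm (F z1 z z3) \<le> C * exp (- (16/5) * j * height y z z3)" using z3 by (intro C) auto
      also have "\<dots> \<le> C * exp (- (16/5) * j * (Im z3 - 1))"
        using h C(1) by (intro mult_left_mono) (auto intro!: mult_left_mono)
      finally show "norm (F z1 z z3) \<le> C * exp (- (16/5) * j * (Im z3 - 1))" .
    qed (use r z3 order_leads[OF ord z1, of z3] in \<open>auto simp: uhp_def\<close>)
    thus ?thesis by (simp add: coef_def)
  qed
  define l where "l = j div 2"
  have l: "2 * pi * l \<le> (16/5) * j" "j > 0 \<Longrightarrow> 2 * pi * l < (16/5) * j"
  proof -
    have "2 * real l \<le> real j" unfolding l_def by linarith
    hence "pi * (2 * real l) \<le> pi * real j" by (intro mult_left_mono) auto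
    hence 1: "2 * pi * l \<le> pi * j" by (simp add: mult_ac)
    have "pi * real j \<le> (16/5) * real j" using pi_approx by (intro mult_right_mono) auto
    with 1 show "2 * pi * l \<le> (16/5) * j" by (rule order.trans)
    have "pi * real j < (16/5) * real j" if "j > 0" using pi_approx that by (intro mult_strict_right_mono) auto
    with 1 show "2 * pi * l < (16/5) * j" if "j > 0" using that by (blast intro: le_less_trans)
  qed
  have "vanishes_at_infinity (Suc l) (coef (2 * j) z1)"
  proof (rule q_expansion)
    have wm: "weakly_modular (12 + 2 * j) (coef (2 * j) z1)" by (rule coef_weakly_modular[OF ord z1])
    show "coef (2 * j) z1 holomorphic_on uhp" using wm unfolding weakly_modular_def by blast
    show "coef (2 * j) z1 (\<tau> + 1) = coef (2 * j) z1 \<tau>" if "\<tau> \<in> uhp" for \<tau>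
      using wm that unfolding weakly_modular_def by blast
    show "norm (coef (2 * j) z1 \<tau>) \<le> (C * exp (16/5 * j)) * exp (- 2 * pi * l * Im \<tau>)" if "Im \<tau> \<ge> 2" for \<tau>
    proof -
      have "2 * pi * l * Im \<tau> \<le> (16/5) * j * Im \<tau>" using l that by (intro mult_right_mono) auto
      moreover have "- (16/5) * j * (Im \<tau> - 1) = 16/5 * j - (16/5) * j * Im \<tau>" by (simp add: field_simps)
      ultimately have "- (16/5) * j * (Im \<tau> - 1) \<le> 16/5 * j + - 2 * pi * l * Im \<tau>" by linarith
      hence "exp (- (16/5) * j * (Im \<tau> - 1)) \<le> exp (16/5 * j) * exp (- 2 * pi * l * Im \<tau>)"
        unfolding exp_add[symmetric] by (rule iffD2[OF exp_le_cancel_iff])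
      hence "C * exp (- (16/5) * j * (Im \<tau> - 1)) \<le> C * (exp (16/5 * j) * exp (- 2 * pi * l * Im \<tau>))"
        using C(1) by (rule mult_left_mono)
      with bd[OF that] have "norm (coef (2 * j) z1 \<tau>) \<le> C * (exp (16/5 * j) * exp (- 2 * pi * l * Im \<tau>))"
        by (rule order.trans)
      thus ?thesis by (simp only: mult.assoc)
    qed
    show "((\<lambda>t. coef (2 * j) z1 (\<i> * of_real t) * of_real (exp (2 * pi * l * t))) \<longlongrightarrow> 0) at_top"
    proof (cases "j = 0")
      case True
      have "((\<lambda>t::real. F z1 0 (\<i> * of_real t)) \<longlongrightarrow> 0) at_top"
        using z1 by (intro cusp) (simp add: uhp_def)
      moreover have "\<forall>\<^sub>F t::real in at_top. F z1 0 (\<i> * of_real t) = coef (2 * j) z1 (\<i> * of_real t) * of_real (exp (2 * pi * l * t))"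
        using eventually_gt_at_top[of 0]
        by eventually_elim (use True z1 lead_0 in \<open>auto simp: l_def uhp_def\<close>)
      ultimately show ?thesis by (rule Lim_transform_eventually)
    next
      case False
      show ?thesis
      proof (rule Lim_null_comparison)
        define d where "d = (16/5) * j - 2 * pi * l"
        have "d > 0" using l False by (simp add: d_def)
        thus "((\<lambda>t::real. C * exp (16/5 * j) * exp (- d * t)) \<longlongrightarrow> 0) at_top" by real_asymp
        show "\<forall>\<^sub>F t in at_top. norm (coef (2 * j) z1 (\<i> * of_real t) * of_real (exp (2 * pi * l * t))) \<le> C * exp (16/5 * j) * exp (- d * t)"
          using eventually_ge_at_top[of 2]
        proof eventually_elim
          case (elim t)
          have "norm (coef (2 * j) z1 (\<i> * of_real t) * of_real (exp (2 * pi * l * t))) \<le>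
              (C * exp (- (16/5) * j * (t - 1))) * exp (2 * pi * l * t)"
            unfolding norm_mult using bd[of "\<i> * of_real t"] elim
            by (intro mult_mono) (auto simp: C)
          also have "\<dots> = C * exp (16/5 * j) * exp (- d * t)"
          proof -
            have "- (16/5) * j * (t - 1) + 2 * pi * l * t = 16/5 * j + - d * t"
              by (simp add: d_def field_simps)
            thus ?thesis by (simp only: mult.assoc exp_add[symmetric])
          qed
          finally show ?case .
        qed
      qed
    qed
  qed
  thus ?thesis by (simp add: l_def z1_def)
qed

section \<open>Nonvanishing on the diagonal\<close>

text \<open>For fixed z1 and z3 the middle variable ranges over a horizontal strip around 0, which
  is connected; a slice with all leading coefficients zero would vanish on it.\<close>

lemma order_exists: "\<exists>m. \<exists>z1\<in>uhp. \<exists>z3\<in>uhp. coef m z1 z3 \<noteq> 0"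
proof (rule ccontr)
  assume "\<not> ?thesis"
  hence 0: "coef m z1 z3 = 0" if "z1 \<in> uhp" "z3 \<in> uhp" for m z1 z3 using that by blast
  obtain z1 z2 z3 where z: "(z1, z2, z3) \<in> siegel_dom" "F z1 z2 z3 \<noteq> 0" using nonzero by blast
  have "0 < Im z1 * Im z3" using z by (auto intro: le_less_trans[OF zero_le_power2])
  hence z13: "z1 \<in> uhp" "z3 \<in> uhp" using z by (auto simp: uhp_def zero_less_mult_iff)
  define c where "c = sqrt (Im z1 * Im z3)"
  have c: "c > 0" "c\<^sup>2 = Im z1 * Im z3" using \<open>0 < Im z1 * Im z3\<close> by (auto simp: c_def)
  define S where "S = {w. Im w < c} \<inter> {w. Im w > - c}"
  have dom: "w \<in> S \<longleftrightarrow> (z1, w, z3) \<in> siegel_dom" for w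
  proof -
    have "w \<in> S \<longleftrightarrow> \<bar>Im w\<bar> < \<bar>c\<bar>" using c by (auto simp: S_def)
    also have "\<dots> \<longleftrightarrow> (Im w)\<^sup>2 < c\<^sup>2" by (metis abs_le_square_iff not_less)
    finally show ?thesis using z13 by (simp add: c(2) uhp_def)
  qed
  have S: "open S" "connected S" "0 \<in> S"
    unfolding S_def using c by (auto intro!: open_halfspace_Im_lt open_halfspace_Im_gt convex_connected
        convex_Int convex_halfspace_Im_lt convex_halfspace_Im_gt)
  have "(\<lambda>w. F z1 w z3) holomorphic_on S" by (rule hol) (use S dom in auto)
  hence "F z1 z2 z3 = 0"
    by (rule eq_0_if_all_leads_0[OF _ S]) (use 0 z13 z dom in \<open>auto simp: coef_def\<close>)
  thus False using z by simp
qed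

lemma coef_odd:
  assumes "order_ge m" "odd m" "z1 \<in> uhp" "z3 \<in> uhp"
  shows "coef m z1 z3 = 0"
proof -
  define r where "r = sqrt (Im z1 * Im z3)"
  have r: "r > 0" "r\<^sup>2 \<le> Im z1 * Im z3" using assms by (auto simp: r_def uhp_def)
  show ?thesis unfolding coef_def
  proof (rule lead_odd_eq_0[of _ r])
    show "(\<lambda>w. F z1 w z3) holomorphic_on ball 0 r" by (rule hol_middle) (use r assms in \<open>auto simp: uhp_def\<close>)
    show "F z1 (- w) z3 = F z1 w z3" if "w \<in> ball 0 r" for w
      by (rule reflect) (use in_domI[of w r] that r assms in \<open>auto simp: uhp_def\<close>)
  qed (use r assms order_leads in auto)
qed

text \<open>The decay estimate is available only at z1 = i y with 1 <= y <= 11/10; this carries its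
  consequences to every z1.\<close>

lemma zero_on_segment_imp_zero:
  assumes "f holomorphic_on uhp" "\<And>y. 1 \<le> y \<Longrightarrow> y \<le> 11/10 \<Longrightarrow> f (\<i> * of_real y) = 0" "z \<in> uhp"
  shows "f z = 0"
proof (rule analytic_continuation[OF assms(1) open_uhp connected_uhp])
  show "(\<lambda>y. \<i> * of_real y) ` {1..11/10} \<subseteq> uhp" by (auto simp: uhp_def)
  show "\<i> \<in> uhp" by (simp add: uhp_def)
  show "\<i> islimpt (\<lambda>y. \<i> * of_real y) ` {1..11/10}"
    unfolding islimpt_approachable
  proof (intro allI impI)
    fix e :: real assume e: "e > 0"
    define d where "d = min (e/2) (1/10)"
    have d: "d > 0" "d < e" "d \<le> 1/10" using e by (auto simp: d_def)
    have "\<i> * of_real (1 + d) - \<i> = \<i> * of_real d" by (simp add: algebra_simps)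
    hence "dist (\<i> * of_real (1 + d)) \<i> = d" using d by (simp add: dist_norm norm_mult)
    thus "\<exists>x'\<in>(\<lambda>y. \<i> * of_real y) ` {1..11/10}. x' \<noteq> \<i> \<and> dist x' \<i> < e"
      using d by (intro bexI[of _ "\<i> * of_real (1 + d)"] imageI) auto
  qed
qed (use assms in auto)

theorem nonzero_on_diagonal: "\<exists>z1\<in>uhp. \<exists>z3\<in>uhp. F z1 0 z3 \<noteq> 0"
proof -
  define m where "m = (LEAST m. \<exists>z1\<in>uhp. \<exists>z3\<in>uhp. coef m z1 z3 \<noteq> 0)"
  obtain z1 z3 where z: "z1 \<in> uhp" "z3 \<in> uhp" "coef m z1 z3 \<noteq> 0"
    using LeastI_ex[OF order_exists] unfolding m_def by blast
  have ord: "order_ge m"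
    unfolding order_ge_def m_def using not_less_Least by blast
  obtain j where j: "m = 2 * j" using coef_odd[OF ord _ z(1,2)] z(3) by (metis evenE)
  have "j = 0"
  proof (rule ccontr)
    assume "j \<noteq> 0"
    have "coef m (\<i> * of_real y) z3 = 0" if y: "1 \<le> y" "y \<le> 11/10" for y
    proof -
      have iy: "\<i> * of_real y \<in> uhp" using y by (simp add: uhp_def)
      note wm = coef_weakly_modular[OF ord iy]
      have van: "vanishes_at_infinity (Suc (j div 2)) (coef m (\<i> * of_real y))"
        using coef_vanishing[OF y] ord unfolding j by blast
      show ?thesis
      proof (cases "j = 1")
        case True
        thus ?thesis using wm van j by (intro weakly_modular_14_eq_0[OF _ _ z(2)]) simp_all
      next
        case False
        \<comment> \<open>At j = 3 both sides equal 18; j = 1 is the only positive value for which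
          the inequality fails.\<close>
        have "12 + m \<le> 9 * Suc (j div 2)" using False \<open>j \<noteq> 0\<close> unfolding j by presburger
        thus ?thesis using weakly_modular_eq_0[OF wm van _ _ z(2)] by simp
      qed
    qed
    from zero_on_segment_imp_zero[OF coef_hol_1[OF ord z(2)] this z(1)] z(3) show False by simp
  qed
  thus ?thesis using z j lead_0 by auto
qed

section \<open>Product structure on the diagonal\<close>

lemma order_ge_0: "order_ge 0"
  by (simp add: order_ge_def)

lemma diagonal_hol:
  shows "z3 \<in> uhp \<Longrightarrow> (\<lambda>s. F s 0 z3) holomorphic_on uhp"
    and "z1 \<in> uhp \<Longrightarrow> (\<lambda>s. F z1 0 s) holomorphic_on uhp"
  by (rule hol; use open_uhp in \<open>auto simp: uhp_def\<close>)+

text \<open>A combination of two weight 12 cusp forms that kills the coefficient of q has order 2 at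
  the cusp, hence is zero by 12 <= 9 * 2. So the two slices are proportional.\<close>

lemma rank_one:
  assumes y: "1 \<le> y" "y \<le> 11/10" and y': "1 \<le> y'" "y' \<le> 11/10" and z: "z \<in> uhp" "z' \<in> uhp"
  shows "F (\<i> * of_real y) 0 z * F (\<i> * of_real y') 0 z' = F (\<i> * of_real y') 0 z * F (\<i> * of_real y) 0 z'"
proof -
  define f where "f = (\<lambda>y. coef 0 (\<i> * of_real y))"
  have iy: "\<i> * of_real y \<in> uhp" "\<i> * of_real y' \<in> uhp" using y y' by (auto simp: uhp_def)
  have wm: "weakly_modular 12 (f y)" "weakly_modular 12 (f y')"
    using coef_weakly_modular[OF order_ge_0] iy by (auto simp: f_def)
  have "vanishes_at_infinity 1 (f y)" "vanishes_at_infinity 1 (f y')"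
    using coef_vanishing[of y 0] coef_vanishing[of y' 0] y y' order_ge_0 by (auto simp: f_def)
  then obtain h h' where h: "h holomorphic_on ball 0 1" "\<And>\<tau>. \<tau> \<in> uhp \<Longrightarrow> f y \<tau> = nome \<tau> * h (nome \<tau>)"
      and h': "h' holomorphic_on ball 0 1" "\<And>\<tau>. \<tau> \<in> uhp \<Longrightarrow> f y' \<tau> = nome \<tau> * h' (nome \<tau>)"
    unfolding vanishes_at_infinity_def by auto
  have *: "p * f y \<tau> + q * f y' \<tau> = 0" if pq: "p * h 0 + q * h' 0 = 0" and \<tau>: "\<tau> \<in> uhp" for p q \<tau>
  proof (rule weakly_modular_eq_0[of 12 "\<lambda>\<tau>. p * f y \<tau> + q * f y' \<tau>" 2])
    show "weakly_modular 12 (\<lambda>\<tau>. p * f y \<tau> + q * f y' \<tau>)"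
      using wm unfolding weakly_modular_def by (auto intro!: holomorphic_intros simp: algebra_simps)
    define g where "g = (\<lambda>x. p * h x + q * h' x)"
    define k where "k = (\<lambda>x. if x = 0 then deriv g 0 else (g x - g 0) / (x - 0))"
    have "g holomorphic_on ball 0 1" unfolding g_def by (intro holomorphic_intros h h')
    hence "k holomorphic_on ball 0 1" unfolding k_def by (rule pole_lemma_open) simp
    moreover have "g x = x * k x" for x using pq by (simp add: k_def g_def)
    hence "p * f y \<tau> + q * f y' \<tau> = nome \<tau> ^ 2 * k (nome \<tau>)" if "\<tau> \<in> uhp" for \<tau>
      using h(2)[OF that] h'(2)[OF that] unfolding g_def by (simp add: power2_eq_square algebra_simps)
        (metis distrib_left mult.left_commute)
    ultimately show "vanishes_at_infinity 2 (\<lambda>\<tau>. p * f y \<tau> + q * f y' \<tau>)"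
      unfolding vanishes_at_infinity_def by blast
  qed (use \<tau> in auto)
  have f: "f t w = F (\<i> * of_real t) 0 w" if "t > 0" "w \<in> uhp" for t w
    using that lead_0[of "\<i> * of_real t" w] by (simp add: f_def uhp_def)
  have "f y z * f y' z' = f y' z * f y z'"
  proof (cases "h 0 = 0")
    case True
    hence "f y z = 0" "f y z' = 0" using *[of 1 0] z by auto
    thus ?thesis by simp
  next
    case False
    have "- h' 0 * f y w + h 0 * f y' w = 0" if "w \<in> uhp" for w
      by (rule *) (use that in auto)
    hence "f y' w = h' 0 / h 0 * f y w" if "w \<in> uhp" for w
      using that False by (simp add: field_simps)
    thus ?thesis using z by simp
  qed
  thus ?thesis using y y' z f by simp
qed

text \<open>If \<open>F\<close> vanished on the line, the rank one relation, continued in the first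
  variable, would give F tau 0 z3 * F b 0 (M tau) = 0. The first factor is nonzero near b, so the
  second vanishes on an open set and hence everywhere, also where M tau = z3.\<close>

theorem nonzero_on_line:
  fixes M :: real
  assumes "M > 0"
  shows "\<exists>\<tau>\<in>uhp. F \<tau> 0 (of_real M * \<tau>) \<noteq> 0"
proof (rule ccontr)
  assume "\<not> ?thesis"
  hence 0: "F \<tau> 0 (of_real M * \<tau>) = 0" if "\<tau> \<in> uhp" for \<tau> using that by blast
  obtain z1 z3 where z: "z1 \<in> uhp" "z3 \<in> uhp" "F z1 0 z3 \<noteq> 0" using nonzero_on_diagonal by blast
  obtain y where y: "1 \<le> y" "y \<le> 11/10" "F (\<i> * of_real y) 0 z3 \<noteq> 0"
    using zero_on_segment_imp_zero[OF diagonal_hol(1)[OF z(2)] _ z(1)] z(3) by blast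
  define b where "b = \<i> * complex_of_real y"
  have b: "b \<in> uhp" using y by (simp add: b_def uhp_def)
  have M: "of_real M * \<tau> \<in> uhp" if "\<tau> \<in> uhp" for \<tau>
    using that assms by (simp add: uhp_def)
  have prod0: "F \<tau> 0 z3 * F b 0 (of_real M * \<sigma>) - F b 0 z3 * F \<tau> 0 (of_real M * \<sigma>) = 0"
    if "\<tau> \<in> uhp" "\<sigma> \<in> uhp" for \<tau> \<sigma>
  proof (rule zero_on_segment_imp_zero[OF _ _ that(1)])
    show "(\<lambda>\<tau>. F \<tau> 0 z3 * F b 0 (of_real M * \<sigma>) - F b 0 z3 * F \<tau> 0 (of_real M * \<sigma>)) holomorphic_on uhp"
      by (intro holomorphic_intros diagonal_hol z M that)
  qed (use rank_one y z M that in \<open>auto simp: b_def\<close>)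
  hence prod: "F \<tau> 0 z3 * F b 0 (of_real M * \<tau>) = 0" if "\<tau> \<in> uhp" for \<tau>
    using 0[OF that] that by fastforce
  have "isCont (\<lambda>\<tau>. F \<tau> 0 z3) b"
    using diagonal_hol(1)[OF z(2)] b open_uhp holomorphic_on_imp_continuous_on continuous_on_eq_continuous_at by blast
  hence "\<forall>\<^sub>F \<tau> in nhds b. F \<tau> 0 z3 \<noteq> 0"
    using y(3) by (simp add: b_def[symmetric] continuous_at tendsto_imp_eventually_ne isCont_def eventually_nhds_conv_at)
  moreover have "\<forall>\<^sub>F \<tau> in nhds b. \<tau> \<in> uhp" using open_uhp b by (rule eventually_nhds_in_open)
  ultimately have "\<forall>\<^sub>F \<tau> in nhds b. F b 0 (of_real M * \<tau>) = 0 \<and> \<tau> \<in> uhp"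
    by eventually_elim (use prod in auto)
  then obtain S where S: "open S" "b \<in> S" "\<And>\<tau>. \<tau> \<in> S \<Longrightarrow> F b 0 (of_real M * \<tau>) = 0 \<and> \<tau> \<in> uhp"
    unfolding eventually_nhds by blast
  have "F b 0 (of_real M * (z3 / of_real M)) = 0"
  proof (rule analytic_continuation_open[of S uhp "\<lambda>\<tau>. F b 0 (of_real M * \<tau>)" "\<lambda>_. 0"])
    show "S \<noteq> {}" "S \<subseteq> uhp" using S by auto
    show "(\<lambda>\<tau>. F b 0 (of_real M * \<tau>)) holomorphic_on uhp"
      by (rule hol) (use open_uhp b M in \<open>auto simp: uhp_def intro!: holomorphic_intros\<close>)
    show "z3 / of_real M \<in> uhp" using z assms by (simp add: uhp_def Im_divide_of_real)
  qed (use S open_uhp connected_uhp in auto)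
  thus False using y(3) assms by (simp add: b_def)
qed

end

section \<open>Zeros of degree two forms\<close>

text \<open>The values lie in the discrete set 2 pi i Z.\<close>

lemma constant_on_if_exp_eq_1:
  fixes c :: "'a::topological_space \<Rightarrow> complex"
  assumes "connected S" "continuous_on S c" "\<And>z. z \<in> S \<Longrightarrow> exp (c z) = 1"
  shows "c constant_on S"
proof (rule continuous_discrete_range_constant[OF assms(1,2)])
  fix x assume x: "x \<in> S"
  have "2 * pi \<le> norm (c y - c x)" if "y \<in> S" "c y \<noteq> c x" for y
  proof -
    have "exp (c y) = exp (c x)" using assms(3) that x by simp
    then obtain n :: int where n: "c y = c x + of_real (of_int (2 * n) * pi) * \<i>" unfolding exp_eq by blast
    hence "n \<noteq> 0" using that by auto
    hence "1 \<le> \<bar>real_of_int n\<bar>" by (simp flip: of_int_abs)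
    moreover have "norm (c y - c x) = 2 * pi * \<bar>real_of_int n\<bar>" by (simp add: n norm_mult)
    ultimately show ?thesis by simp
  qed
  thus "\<exists>e>0. \<forall>y. y \<in> S \<and> c y \<noteq> c x \<longrightarrow> e \<le> norm (c y - c x)"
    by (intro exI[of _ "2 * pi"]) auto
qed

lemma siegel_dom_positive_definite:
  "(z1, z2, z3) \<in> siegel_dom \<longleftrightarrow>
    (\<forall>s t. s \<noteq> 0 \<or> t \<noteq> 0 \<longrightarrow> s\<^sup>2 * Im z1 + 2 * s * t * Im z2 + t\<^sup>2 * Im z3 > 0)"
proof (intro iffI allI impI)
  fix s t :: real assume d: "(z1, z2, z3) \<in> siegel_dom" and st: "s \<noteq> 0 \<or> t \<noteq> 0"
  have "Im z1 * (s\<^sup>2 * Im z1 + 2 * s * t * Im z2 + t\<^sup>2 * Im z3) =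
      (s * Im z1 + t * Im z2)\<^sup>2 + t\<^sup>2 * (Im z1 * Im z3 - (Im z2)\<^sup>2)"
    by (simp add: power2_eq_square algebra_simps)
  also have "\<dots> > 0"
    using d st by (cases "t = 0") (auto intro: add_nonneg_pos)
  finally show "s\<^sup>2 * Im z1 + 2 * s * t * Im z2 + t\<^sup>2 * Im z3 > 0"
    using d by (simp add: zero_less_mult_iff)
next
  assume *: "\<forall>s t. s \<noteq> 0 \<or> t \<noteq> 0 \<longrightarrow> s\<^sup>2 * Im z1 + 2 * s * t * Im z2 + t\<^sup>2 * Im z3 > 0"
  from *[rule_format, of 1 0] have y: "Im z1 > 0" by simp
  \<comment> \<open>The test vector (- Im z2, Im z1) turns the quadratic form into Im z1 times the
    determinant.\<close>
  have "0 < (- Im z2)\<^sup>2 * Im z1 + 2 * (- Im z2) * Im z1 * Im z2 + (Im z1)\<^sup>2 * Im z3"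
    using y by (intro *[rule_format]) simp
  also have "\<dots> = Im z1 * (Im z1 * Im z3 - (Im z2)\<^sup>2)" by (simp add: power2_eq_square algebra_simps)
  finally show "(z1, z2, z3) \<in> siegel_dom" using y by (simp add: zero_less_mult_iff)
qed

text \<open>Positive definiteness survives convex combinations. Convexity makes the domain
  contractible, which provides the logarithm of a form without zeros.\<close>

lemma convex_siegel_dom: "convex siegel_dom"
proof (rule convexI)
  fix x y :: "complex \<times> complex \<times> complex" and u v :: real
  assume xy: "x \<in> siegel_dom" "y \<in> siegel_dom" and uv: "0 \<le> u" "0 \<le> v" "u + v = 1"
  obtain x1 x2 x3 y1 y2 y3 where e: "x = (x1, x2, x3)" "y = (y1, y2, y3)" by (metis prod_cases3)
  show "u *\<^sub>R x + v *\<^sub>R y \<in> siegel_dom"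
    unfolding e scaleR_Pair add_Pair siegel_dom_positive_definite
  proof (intro allI impI)
    fix s t :: real assume st: "s \<noteq> 0 \<or> t \<noteq> 0"
    define A where "A = s\<^sup>2 * Im x1 + 2 * s * t * Im x2 + t\<^sup>2 * Im x3"
    define B where "B = s\<^sup>2 * Im y1 + 2 * s * t * Im y2 + t\<^sup>2 * Im y3"
    have "A > 0" "B > 0"
      using xy st unfolding e siegel_dom_positive_definite A_def B_def by blast+
    hence "u * A + v * B > 0"
      using uv by (metis add_nonneg_pos add_pos_nonneg less_eq_real_def mult_nonneg_nonneg mult_pos_pos add_cancel_right_right zero_neq_one)
    also have "u * A + v * B = s\<^sup>2 * Im (u *\<^sub>R x1 + v *\<^sub>R y1) + 2 * s * t * Im (u *\<^sub>R x2 + v *\<^sub>R y2) + t\<^sup>2 * Im (u *\<^sub>R x3 + v *\<^sub>R y3)"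
      by (simp add: A_def B_def algebra_simps)
    finally show "0 < \<dots>" .
  qed
qed

text \<open>At this point inversion agrees with translation by 1, so modulo translations it is fixed
  by the inversion.\<close>

lemma cube_root_of_unity:
  fixes \<rho> :: complex
  defines "\<rho> \<equiv> Complex (- 1/2) (sqrt 3 / 2)"
  shows "- 1 / \<rho> = \<rho> + 1" "Ln \<rho> = 2 * of_real pi / 3 * \<i>"
proof -
  have "\<rho> * (\<rho> + 1) = - 1"
    by (simp add: \<rho>_def complex_eq_iff)
  moreover have "\<rho> \<noteq> 0" by (simp add: \<rho>_def complex_eq_iff)
  ultimately show "- 1 / \<rho> = \<rho> + 1" by (simp add: field_simps)
  have "exp (2 * of_real pi / 3 * \<i>) = cis (2 * pi / 3)" by (simp add: cis_conv_exp mult.commute)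
  also have "\<dots> = \<rho>" by (simp add: cis.ctr cos_120 sin_120 \<rho>_def)
  finally have "Ln \<rho> = Ln (exp (2 * of_real pi / 3 * \<i>))" by simp
  also have "\<dots> = 2 * of_real pi / 3 * \<i>" by (rule Ln_exp) auto
  finally show "Ln \<rho> = 2 * of_real pi / 3 * \<i>" .
qed

context siegel_form_12
begin

text \<open>A nowhere vanishing \<open>F\<close> would have a logarithm on the convex domain. Its translation periods form a
  linear functional on symmetric matrices that is invariant under \<open>GL\<^sub>2(\<int>)\<close>, hence zero; but then the
  weight is contradicted by the fixed points of order 4 and 6 of the modular group.\<close>

theorem has_zero: "\<exists>z1 z2 z3. (z1, z2, z3) \<in> siegel_dom \<and> F z1 z2 z3 = 0"
proof (rule ccontr)
  assume "\<not> ?thesis"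
  hence nz: "F z1 z2 z3 \<noteq> 0" if "(z1, z2, z3) \<in> siegel_dom" for z1 z2 z3 using that by blast
  have conn: "connected siegel_dom" by (rule convex_connected[OF convex_siegel_dom])
  obtain g where g: "continuous_on siegel_dom g"
    "\<And>z. z \<in> siegel_dom \<Longrightarrow> (case z of (z1, z2, z3) \<Rightarrow> F z1 z2 z3) = exp (g z)"
    by (rule continuous_logarithm_on_contractible[OF cont convex_imp_contractible[OF convex_siegel_dom]])
      (use nz in auto)
  define G where "G = (\<lambda>z1 z2 z3. g (z1, z2, z3))"
  have G: "F z1 z2 z3 = exp (G z1 z2 z3)" if "(z1, z2, z3) \<in> siegel_dom" for z1 z2 z3
    using g(2)[OF that] by (simp add: G_def)
  have lift: "\<exists>c. \<forall>z\<in>siegel_dom. g (\<phi> z) = g z + c"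
    if \<phi>: "continuous_on siegel_dom \<phi>" "\<And>z. z \<in> siegel_dom \<Longrightarrow> \<phi> z \<in> siegel_dom \<and>
      (case \<phi> z of (z1, z2, z3) \<Rightarrow> F z1 z2 z3) = (case z of (z1, z2, z3) \<Rightarrow> F z1 z2 z3)" for \<phi>
  proof -
    have "(\<lambda>z. g (\<phi> z) - g z) constant_on siegel_dom"
    proof (rule constant_on_if_exp_eq_1[OF conn])
      show "continuous_on siegel_dom (\<lambda>z. g (\<phi> z) - g z)"
        by (intro continuous_on_diff g(1) continuous_on_compose2[OF g(1) \<phi>(1)]) (use \<phi>(2) in auto)
      fix z assume z: "z \<in> siegel_dom"
      have "exp (g (\<phi> z)) = exp (g z)" using \<phi>(2)[OF z] g(2)[OF z] g(2)[of "\<phi> z"] by simp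
      thus "exp (g (\<phi> z) - g z) = 1" by (simp add: exp_diff)
    qed
    then obtain c where "\<And>z. z \<in> siegel_dom \<Longrightarrow> g (\<phi> z) - g z = c" unfolding constant_on_def by blast
    thus ?thesis by (intro exI[of _ c]) (auto simp: algebra_simps)
  qed
  note [continuous_intros] = continuous_on_fst continuous_on_snd
  have "\<exists>c. \<forall>z\<in>siegel_dom. g ((\<lambda>(z1, z2, z3). (z1 + 1, z2, z3)) z) = g z + c"
    by (rule lift) (use transl[of _ _ _ 1 0 0] in \<open>auto simp: case_prod_unfold intro!: continuous_intros\<close>)
  then obtain t1 where t1: "\<And>z1 z2 z3. (z1, z2, z3) \<in> siegel_dom \<Longrightarrow> G (z1 + 1) z2 z3 = G z1 z2 z3 + t1"
    unfolding G_def by fastforce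
  have "\<exists>c. \<forall>z\<in>siegel_dom. g ((\<lambda>(z1, z2, z3). (z1, z2 + 1, z3)) z) = g z + c"
    by (rule lift) (use transl[of _ _ _ 0 1 0] in \<open>auto simp: case_prod_unfold intro!: continuous_intros\<close>)
  then obtain t2 where t2: "\<And>z1 z2 z3. (z1, z2, z3) \<in> siegel_dom \<Longrightarrow> G z1 (z2 + 1) z3 = G z1 z2 z3 + t2"
    unfolding G_def by fastforce
  have "\<exists>c. \<forall>z\<in>siegel_dom. g ((\<lambda>(z1, z2, z3). (z1, z2, z3 + 1)) z) = g z + c"
    by (rule lift) (use transl[of _ _ _ 0 0 1] in \<open>auto simp: case_prod_unfold intro!: continuous_intros\<close>)
  then obtain t3 where t3: "\<And>z1 z2 z3. (z1, z2, z3) \<in> siegel_dom \<Longrightarrow> G z1 z2 (z3 + 1) = G z1 z2 z3 + t3"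
    unfolding G_def by fastforce
  have "\<exists>c. \<forall>z\<in>siegel_dom. g ((\<lambda>(z1, z2, z3). (z1, - z2, z3)) z) = g z + c"
    by (rule lift) (use reflect in \<open>auto simp: case_prod_unfold intro!: continuous_intros\<close>)
  then obtain r where r: "\<And>z1 z2 z3. (z1, z2, z3) \<in> siegel_dom \<Longrightarrow> G z1 (- z2) z3 = G z1 z2 z3 + r"
    unfolding G_def by fastforce
  have hd: "(z1, z2 + z1, z3 + 2 * z2 + z1) \<in> siegel_dom" if "(z1, z2, z3) \<in> siegel_dom" for z1 z2 z3
    using that by (simp add: power2_eq_square algebra_simps)
  have "\<exists>c. \<forall>z\<in>siegel_dom. g ((\<lambda>(z1, z2, z3). (z1, z2 + z1, z3 + 2 * z2 + z1)) z) = g z + c"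
  proof (rule lift)
    show "continuous_on siegel_dom (\<lambda>(z1, z2, z3). (z1, z2 + z1, z3 + 2 * z2 + z1))"
      by (auto simp: case_prod_unfold intro!: continuous_intros)
  qed (use heis[of _ _ _ 1] hd in auto)
  then obtain h where h: "\<And>z1 z2 z3. (z1, z2, z3) \<in> siegel_dom \<Longrightarrow> G z1 (z2 + z1) (z3 + 2 * z2 + z1) = G z1 z2 z3 + h"
    unfolding G_def by fastforce
  \<comment> \<open>The reflection fixes z2 = 0, so r = 0; then \<open>G\<close> agrees at z2 = 1
    and z2 = -1, where its values differ by 2 t2.\<close>
  have "t2 = 0"
    using r[of \<i> 0 \<i>] r[of \<i> 1 \<i>] t2[of \<i> 0 \<i>] t2[of \<i> "-1" \<i>] by simp
  \<comment> \<open>The shear turns translation of z1 by 1 into translation of all three coordinates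
    by 1, so t1 = t1 + t2 + t3.\<close>
  moreover have "t2 + t3 = 0"
    using h[of \<i> 0 \<i>] h[of "\<i> + 1" 0 \<i>] t1[of \<i> 0 \<i>] t1[of \<i> \<i> "\<i> + \<i>"] t2[of "\<i> + 1" \<i> "\<i> + \<i>"]
      t3[of "\<i> + 1" "\<i> + 1" "\<i> + \<i>"] by (simp add: add_ac)
  ultimately have t3: "G z1 z2 (z3 + 1) = G z1 z2 z3" if "(z1, z2, z3) \<in> siegel_dom" for z1 z2 z3
    using t3[OF that] by simp
  have "(\<lambda>\<tau>. G \<i> 0 (- 1 / \<tau>) - G \<i> 0 \<tau> - 12 * Ln \<tau>) constant_on uhp"
  proof (rule constant_on_if_exp_eq_1[OF connected_uhp])
    have "\<tau> \<noteq> 0" "\<tau> \<notin> \<real>\<^sub>\<le>\<^sub>0" if "\<tau> \<in> uhp" for \<tau>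
      using that by (auto simp: uhp_def complex_nonpos_Reals_iff)
    moreover have "continuous_on uhp (\<lambda>\<tau>. G \<i> 0 \<tau>)" unfolding G_def
      by (rule continuous_on_compose2[OF g(1)]) (auto simp: uhp_def intro!: continuous_intros)
    moreover have "continuous_on uhp (\<lambda>\<tau>. G \<i> 0 (- 1 / \<tau>))"
      by (rule continuous_on_compose2[OF \<open>continuous_on uhp (\<lambda>\<tau>. G \<i> 0 \<tau>)\<close>])
        (use minus_inverse_in_uhp(1) calculation in \<open>auto intro!: continuous_intros\<close>)
    ultimately show "continuous_on uhp (\<lambda>\<tau>. G \<i> 0 (- 1 / \<tau>) - G \<i> 0 \<tau> - 12 * Ln \<tau>)"
      by (intro continuous_intros) auto
    fix \<tau> assume \<tau>: "\<tau> \<in> uhp"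
    have "(\<i>, 0, \<tau>) \<in> siegel_dom" "(\<i>, 0, - 1 / \<tau>) \<in> siegel_dom"
      using \<tau> minus_inverse_in_uhp(1)[OF \<tau>] unfolding uhp_def by simp_all
    moreover have "exp (12 * Ln \<tau>) = exp (Ln \<tau>) ^ 12"
      using exp_of_nat_mult[of 12 "Ln \<tau>"] by simp
    moreover have "exp (Ln \<tau>) = \<tau>" using \<tau> by (intro exp_Ln) (auto simp: uhp_def)
    moreover have "F \<i> 0 (- 1 / \<tau>) = \<tau> ^ 12 * F \<i> 0 \<tau>"
      using inv[of \<i> 0 \<tau>] \<tau> by (simp add: uhp_def)
    ultimately show "exp (G \<i> 0 (- 1 / \<tau>) - G \<i> 0 \<tau> - 12 * Ln \<tau>) = 1"
      using \<tau> by (auto simp: exp_diff G[symmetric] nz uhp_def)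
  qed
  then obtain c where c: "\<And>\<tau>. \<tau> \<in> uhp \<Longrightarrow> G \<i> 0 (- 1 / \<tau>) - G \<i> 0 \<tau> - 12 * Ln \<tau> = c"
    unfolding constant_on_def by blast
  have "- 1 / \<i> = \<i>" by (simp add: field_simps)
  \<comment> \<open>At i the values of \<open>G\<close> cancel and 12 Ln i = 6 pi i remains; at rho
    they cancel by periodicity and 12 Ln rho = 8 pi i remains. One constant cannot account for
    both.\<close>
  hence "c = - (6 * of_real pi * \<i>)" using c[of \<i>, symmetric] by (simp add: uhp_def mult_ac)
  moreover define \<rho> where "\<rho> = Complex (- 1/2) (sqrt 3 / 2)"
  have "G \<i> 0 (\<rho> + 1) = G \<i> 0 \<rho>" by (rule t3) (simp add: \<rho>_def)
  hence "c = - (8 * of_real pi * \<i>)"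
    using c[of \<rho>, symmetric] cube_root_of_unity unfolding \<rho>_def[symmetric]
    by (simp add: uhp_def \<rho>_def[THEN arg_cong[of _ _ Im]] mult_ac)
  ultimately show False by simp
qed

end

section \<open>Symmetries from the symplectic group\<close>

abbreviation vec3 :: "'a::zero \<Rightarrow> 'a \<Rightarrow> 'a \<Rightarrow> 'a^3" where
  "vec3 x y z \<equiv> vector [x, y, z]"

abbreviation mat2 :: "'a::zero \<Rightarrow> 'a \<Rightarrow> 'a \<Rightarrow> 'a \<Rightarrow> 'a^2^2" where
  "mat2 a b c d \<equiv> vector [vector [a, b], vector [c, d]]"

lemmas mat2_simps = vec_eq_iff forall_2 matrix_matrix_mult_def sum_2 transpose_def mat_def cmat_def

lemma vec3_exhaust: "(z :: 'a::zero^3) = vec3 (z $ 1) (z $ 2) (z $ 3)"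
  by (simp add: vec_eq_iff forall_3)

lemma siegel_H2_iff:
  "sym_mat (vec3 z1 z2 z3) \<in> siegel_H2 \<longleftrightarrow> (z1, z2, z3) \<in> siegel_dom"
proof -
  have q: "v \<bullet> ((\<chi> i j. Im (sym_mat (vec3 z1 z2 z3) $ i $ j)) *v v) =
      (v $ 1)\<^sup>2 * Im z1 + 2 * (v $ 1) * (v $ 2) * Im z2 + (v $ 2)\<^sup>2 * Im z3" for v :: "real^2"
    by (simp add: inner_vec_def sum_2 matrix_vector_mult_def sym_mat_def power2_eq_square algebra_simps)
  have "transpose (sym_mat (vec3 z1 z2 z3)) = sym_mat (vec3 z1 z2 z3)"
    by (simp add: sym_mat_def mat2_simps)
  hence "sym_mat (vec3 z1 z2 z3) \<in> siegel_H2 \<longleftrightarrow> (\<forall>v::real^2. v \<noteq> 0 \<longrightarrow>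
      (v $ 1)\<^sup>2 * Im z1 + 2 * (v $ 1) * (v $ 2) * Im z2 + (v $ 2)\<^sup>2 * Im z3 > 0)"
    by (simp only: siegel_H2_def mem_Collect_eq q simp_thms)
  also have "\<dots> \<longleftrightarrow> (\<forall>s t. s \<noteq> 0 \<or> t \<noteq> 0 \<longrightarrow> s\<^sup>2 * Im z1 + 2 * s * t * Im z2 + t\<^sup>2 * Im z3 > 0)"
  proof (intro iffI allI impI)
    fix s t :: real
    assume *: "\<forall>v::real^2. v \<noteq> 0 \<longrightarrow> (v $ 1)\<^sup>2 * Im z1 + 2 * (v $ 1) * (v $ 2) * Im z2 + (v $ 2)\<^sup>2 * Im z3 > 0"
      and "s \<noteq> 0 \<or> t \<noteq> 0"
    hence "(vector [s, t] :: real^2) \<noteq> 0" by (simp add: vec_eq_iff forall_2)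
    from *[rule_format, OF this] show "s\<^sup>2 * Im z1 + 2 * s * t * Im z2 + t\<^sup>2 * Im z3 > 0" by simp
  qed (simp add: vec_eq_iff forall_2)
  finally show ?thesis using siegel_dom_positive_definite by blast
qed

lemma tube_iff: "z \<in> tube \<longleftrightarrow> (z $ 1, z $ 2, z $ 3) \<in> siegel_dom"
  unfolding tube_def mem_Collect_eq by (subst vec3_exhaust[of z]) (rule siegel_H2_iff)

lemma vec3_in_tube: "vec3 z1 z2 z3 \<in> tube \<longleftrightarrow> (z1, z2, z3) \<in> siegel_dom"
  by (simp add: tube_iff)

text \<open>\<open>matrix_inv\<close> is defined by choice; with an explicit right inverse
  \<open>V\<close> each symmetry becomes a matrix computation.\<close>

lemma siegel_transformation:
  assumes F: "siegel_modular_form k F" and g: "(A, B, C, D) \<in> Sp2Z" and Z: "Z \<in> siegel_H2"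
    and V: "(cmat C ** Z + cmat D) ** V = mat 1"
  shows "F ((cmat A ** Z + cmat B) ** V) = det (cmat C ** Z + cmat D) powi k * F Z"
proof -
  define M where "M = cmat C ** Z + cmat D"
  have VM: "V ** M = mat 1" using V matrix_left_right_inverse unfolding M_def by blast
  have "M ** matrix_inv M = mat 1 \<and> matrix_inv M ** M = mat 1"
    unfolding matrix_inv_def by (rule someI[of "\<lambda>A'. M ** A' = mat 1 \<and> A' ** M = mat 1" V])
      (use V VM in \<open>simp add: M_def\<close>)
  moreover have "V ** (M ** matrix_inv M) = (V ** M) ** matrix_inv M" by (rule matrix_mul_assoc)
  ultimately have "matrix_inv (cmat C ** Z + cmat D) = V" using VM by (simp add: M_def)
  thus ?thesis using F g Z unfolding siegel_modular_form_def by fastforce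
qed

lemma has_derivative_vec3:
  fixes a b c :: "complex \<Rightarrow> complex"
  assumes "(a has_field_derivative a') (at w)" "(b has_field_derivative b') (at w)" "(c has_field_derivative c') (at w)"
  shows "((\<lambda>w. vec3 (a w) (b w) (c w)) has_derivative (\<lambda>h. h *s vec3 a' b' c')) (at w)"
proof -
  have l: "bounded_linear (\<lambda>x::complex. vec3 x 0 0)" "bounded_linear (\<lambda>x::complex. vec3 0 x 0)"
      "bounded_linear (\<lambda>x::complex. vec3 0 0 x)"
    by (auto simp: linear_conv_bounded_linear[symmetric] linear_iff vec_eq_iff forall_3)
  have e: "vec3 x y z = vec3 x 0 0 + vec3 0 y 0 + vec3 0 0 (z::complex)" for x y z
    by (simp add: vec_eq_iff forall_3)
  have "((\<lambda>w. vec3 (a w) 0 0 + vec3 0 (b w) 0 + vec3 0 0 (c w)) has_derivative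
      (\<lambda>h. vec3 (a' * h) 0 0 + vec3 0 (b' * h) 0 + vec3 0 0 (c' * h))) (at w)"
    using assms unfolding has_field_derivative_def
    by (intro has_derivative_add bounded_linear.has_derivative[OF l(1)] bounded_linear.has_derivative[OF l(2)]
        bounded_linear.has_derivative[OF l(3)])
  moreover have "(\<lambda>h. vec3 (a' * h) 0 0 + vec3 0 (b' * h) 0 + vec3 0 0 (c' * h)) = (\<lambda>h. h *s vec3 a' b' c')"
    by (simp add: fun_eq_iff vec_eq_iff forall_3 mult.commute)
  ultimately show ?thesis by (simp flip: e)
qed

text \<open>The chain rule gives a real derivative; complex homogeneity of f' makes it
  multiplication by a complex number.\<close>

lemma holomorphic_on_curve:
  fixes a b c :: "complex \<Rightarrow> complex"
  assumes f: "mv_holomorphic_on f T" and S: "open S"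
    and abc: "a holomorphic_on S" "b holomorphic_on S" "c holomorphic_on S"
    and T: "\<And>w. w \<in> S \<Longrightarrow> vec3 (a w) (b w) (c w) \<in> T"
  shows "(\<lambda>w. f (vec3 (a w) (b w) (c w))) holomorphic_on S"
  unfolding holomorphic_on_open[OF S]
proof
  fix w assume w: "w \<in> S"
  obtain a' b' c' where d: "(a has_field_derivative a') (at w)" "(b has_field_derivative b') (at w)"
      "(c has_field_derivative c') (at w)"
    using abc w unfolding holomorphic_on_open[OF S] by blast
  obtain f' where f': "(f has_derivative f') (at (vec3 (a w) (b w) (c w)))" "\<And>t v. f' (t *s v) = t * f' v"
    using f T[OF w] unfolding mv_holomorphic_on_def by blast
  have "((\<lambda>w. f (vec3 (a w) (b w) (c w))) has_derivative (\<lambda>h. f' (h *s vec3 a' b' c'))) (at w)"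
    by (rule has_derivative_compose[OF has_derivative_vec3[OF d] f'(1)])
  moreover have "(\<lambda>h. f' (h *s vec3 a' b' c')) = (*) (f' (vec3 a' b' c'))"
    by (simp add: f'(2) fun_eq_iff)
  ultimately show "\<exists>x. ((\<lambda>w. f (vec3 (a w) (b w) (c w))) has_field_derivative x) (at w)"
    unfolding has_field_derivative_def by metis
qed

lemma mv_holomorphic_on_continuous: "mv_holomorphic_on f S \<Longrightarrow> z \<in> S \<Longrightarrow> isCont f z"
  unfolding mv_holomorphic_on_def using has_derivative_continuous by blast

lemma continuous_on_vec3:
  fixes a b c :: "'b::topological_space \<Rightarrow> complex"
  assumes "continuous_on S a" "continuous_on S b" "continuous_on S c"
  shows "continuous_on S (\<lambda>x. vec3 (a x) (b x) (c x))"
proof -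
  have e: "vec3 x y z = (\<chi> i. if i = 1 then x else if i = 2 then y else z)" for x y z :: complex
    by (simp add: vec_eq_iff forall_3)
  have "continuous_on S (\<lambda>x. if i = 1 then a x else if i = 2 then b x else c x)" for i :: 3
    using assms by (cases "i = 1"; cases "i = 2") auto
  thus ?thesis unfolding e by (intro continuous_on_vec_lambda)
qed

lemma siegel_cusp_form_12_symmetries:
  assumes chi: "siegel_cusp_form 12 chi" and nz: "\<exists>Z\<in>siegel_H2. chi Z \<noteq> 0"
  shows "siegel_form_12 (\<lambda>z1 z2 z3. chi (sym_mat (vec3 z1 z2 z3)))"
proof
  have mf: "siegel_modular_form 12 chi" using chi by (simp add: siegel_cusp_form_def)
  have hol: "mv_holomorphic_on (\<lambda>z. chi (sym_mat z)) tube"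
    using mf by (simp add: siegel_modular_form_def)
  have "continuous_on tube (\<lambda>z. chi (sym_mat z))"
    by (intro continuous_at_imp_continuous_on ballI mv_holomorphic_on_continuous[OF hol])
  hence "continuous_on siegel_dom (\<lambda>x. (\<lambda>z. chi (sym_mat z)) (vec3 (fst x) (fst (snd x)) (snd (snd x))))"
    by (rule continuous_on_compose2) (auto intro!: continuous_on_vec3 continuous_intros simp: tube_iff)
  thus "continuous_on siegel_dom (\<lambda>(z1, z2, z3). chi (sym_mat (vec3 z1 z2 z3)))"
    by (simp add: case_prod_unfold)
  show "(\<lambda>w. chi (sym_mat (vec3 (a w) (b w) (c w)))) holomorphic_on S"
    if "open S" "a holomorphic_on S" "b holomorphic_on S" "c holomorphic_on S"
      "\<And>w. w \<in> S \<Longrightarrow> (a w, b w, c w) \<in> siegel_dom" for S a b c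
    using holomorphic_on_curve[OF hol that(1-4)] that(5) by (simp add: vec3_in_tube)
  fix z1 z2 z3 assume d: "(z1, z2, z3) \<in> siegel_dom"
  define Z where "Z = sym_mat (vec3 z1 z2 z3)"
  have Z: "Z \<in> siegel_H2" using d siegel_H2_iff unfolding Z_def by blast
  have Z_eq: "Z = mat2 z1 z2 z2 z3" by (simp add: Z_def sym_mat_def)
  show "chi (sym_mat (vec3 (z1 + of_int l) (z2 + of_int m) (z3 + of_int n))) = chi (sym_mat (vec3 z1 z2 z3))" for l m n
  proof -
    have "chi ((cmat (mat 1) ** Z + cmat (mat2 l m m n)) ** mat 1) = det (cmat 0 ** Z + cmat (mat 1)) powi 12 * chi Z"
      by (rule siegel_transformation[OF mf _ Z]) (auto simp: Sp2Z_def mat2_simps Z_eq)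
    moreover have "(cmat (mat 1) ** Z + cmat (mat2 l m m n)) ** mat 1 = sym_mat (vec3 (z1 + of_int l) (z2 + of_int m) (z3 + of_int n))"
      by (simp add: sym_mat_def mat2_simps Z_eq)
    moreover have "det (cmat 0 ** Z + cmat (mat 1)) = 1"
      by (simp add: det_2 mat2_simps)
    ultimately show ?thesis by (simp add: Z_def)
  qed
  show "chi (sym_mat (vec3 z1 (- z2) z3)) = chi (sym_mat (vec3 z1 z2 z3))"
  proof -
    have "chi ((cmat (mat2 1 0 0 (-1)) ** Z + cmat 0) ** mat2 1 0 0 (-1)) =
        det (cmat 0 ** Z + cmat (mat2 1 0 0 (-1))) powi 12 * chi Z"
      by (rule siegel_transformation[OF mf _ Z]) (auto simp: Sp2Z_def mat2_simps Z_eq)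
    moreover have "(cmat (mat2 1 0 0 (-1)) ** Z + cmat 0) ** mat2 1 0 0 (-1) = sym_mat (vec3 z1 (- z2) z3)"
      by (simp add: sym_mat_def mat2_simps Z_eq)
    \<comment> \<open>The determinant -1 disappears because the weight is even.\<close>
    moreover have "det (cmat 0 ** Z + cmat (mat2 1 0 0 (-1))) = - 1"
      by (simp add: det_2 mat2_simps)
    ultimately show ?thesis by (simp add: Z_def)
  qed
  show "chi (sym_mat (vec3 z1 (z2 + of_int l * z1) (z3 + 2 * of_int l * z2 + (of_int l)\<^sup>2 * z1))) =
      chi (sym_mat (vec3 z1 z2 z3))" for l
  proof -
    \<comment> \<open>The action is Z to A Z A^T: D is the inverse transpose of the shear A, so the
      last matrix is A^T.\<close>
    have "chi ((cmat (mat2 1 0 l 1) ** Z + cmat 0) ** mat2 1 (of_int l) 0 1) =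
        det (cmat 0 ** Z + cmat (mat2 1 (- l) 0 1)) powi 12 * chi Z"
      by (rule siegel_transformation[OF mf _ Z]) (auto simp: Sp2Z_def mat2_simps Z_eq)
    moreover have "(cmat (mat2 1 0 l 1) ** Z + cmat 0) ** mat2 1 (of_int l) 0 1 =
        sym_mat (vec3 z1 (z2 + of_int l * z1) (z3 + 2 * of_int l * z2 + (of_int l)\<^sup>2 * z1))"
      by (simp add: sym_mat_def mat2_simps Z_eq power2_eq_square algebra_simps)
    moreover have "det (cmat 0 ** Z + cmat (mat2 1 (- l) 0 1)) = 1"
      by (simp add: det_2 mat2_simps)
    ultimately show ?thesis by (simp add: Z_def)
  qed
  show "chi (sym_mat (vec3 (z1 - z2\<^sup>2 / z3) (z2 / z3) (- 1 / z3))) = z3 ^ 12 * chi (sym_mat (vec3 z1 z2 z3))"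
  proof -
    have "0 < Im z1 * Im z3" using d by (auto intro: le_less_trans[OF zero_le_power2])
    hence z3: "z3 \<noteq> 0" by auto
    \<comment> \<open>Here C Z + D has rows (1, 0) and (z2, z3), and the last matrix is its
      inverse.\<close>
    have "chi ((cmat (mat2 1 0 0 0) ** Z + cmat (mat2 0 0 0 (-1))) ** mat2 1 0 (- z2 / z3) (1 / z3)) =
        det (cmat (mat2 0 0 0 1) ** Z + cmat (mat2 1 0 0 0)) powi 12 * chi Z"
      by (rule siegel_transformation[OF mf _ Z]) (auto simp: Sp2Z_def mat2_simps Z_eq z3)
    moreover have "(cmat (mat2 1 0 0 0) ** Z + cmat (mat2 0 0 0 (-1))) ** mat2 1 0 (- z2 / z3) (1 / z3) =
        sym_mat (vec3 (z1 - z2\<^sup>2 / z3) (z2 / z3) (- 1 / z3))"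
      by (simp add: sym_mat_def mat2_simps Z_eq power2_eq_square)
    moreover have "det (cmat (mat2 0 0 0 1) ** Z + cmat (mat2 1 0 0 0)) = z3"
      by (simp add: det_2 mat2_simps Z_eq)
    ultimately show ?thesis by (simp add: Z_def)
  qed
next
  fix z1 :: complex assume "Im z1 > 0"
  thus "((\<lambda>t::real. chi (sym_mat (vec3 z1 0 (\<i> * of_real t)))) \<longlongrightarrow> 0) at_top"
    using chi unfolding siegel_cusp_form_def by blast
next
  obtain Z where Z: "Z \<in> siegel_H2" "chi Z \<noteq> 0" using nz by blast
  have "Z $ 2 $ 1 = Z $ 1 $ 2" using Z(1) unfolding siegel_H2_def transpose_def by (auto simp: vec_eq_iff)
  hence "Z = sym_mat (vec3 (Z $ 1 $ 1) (Z $ 1 $ 2) (Z $ 2 $ 2))"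
    by (simp add: sym_mat_def vec_eq_iff forall_2)
  thus "\<exists>z1 z2 z3. (z1, z2, z3) \<in> siegel_dom \<and> chi (sym_mat (vec3 z1 z2 z3)) \<noteq> 0"
    using Z siegel_H2_iff by metis
qed

section \<open>Rational quadratic divisors\<close>

lemma exhaust_5: "(i::5) = 1 \<or> i = 2 \<or> i = 3 \<or> i = 4 \<or> i = 5"
proof (induct i)
  case (of_int z)
  then have "z = 0 \<or> z = 1 \<or> z = 2 \<or> z = 3 \<or> z = 4" by auto
  then show ?case by auto
qed

lemma forall_5: "(\<forall>i::5. P i) \<longleftrightarrow> P 1 \<and> P 2 \<and> P 3 \<and> P 4 \<and> P 5"
  by (metis exhaust_5)

lemma sum_5: "sum f (UNIV::5 set) = f 1 + f 2 + f 3 + f 4 + f 5"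
proof -
  have "(UNIV::5 set) = {1, 2, 3, 4, 5}" using exhaust_5 by auto
  show ?thesis unfolding \<open>UNIV = _\<close> by (simp add: add_ac)
qed

lemma vector_5 [simp]:
  "(vector [a, b, c, d, e] :: 'a::zero^5) $ 1 = a" "(vector [a, b, c, d, e] :: 'a^5) $ 2 = b"
  "(vector [a, b, c, d, e] :: 'a^5) $ 3 = c" "(vector [a, b, c, d, e] :: 'a^5) $ 4 = d"
  "(vector [a, b, c, d, e] :: 'a^5) $ 5 = e"
  unfolding vector_def by simp_all

abbreviation vec5 :: "'a::zero \<Rightarrow> 'a \<Rightarrow> 'a \<Rightarrow> 'a \<Rightarrow> 'a \<Rightarrow> 'a^5" where
  "vec5 a b c d e \<equiv> vector [a, b, c, d, e]"

lemma Qform_eq: "Qform x y = x $ 1 * y $ 5 + x $ 2 * y $ 4 - 2 * x $ 3 * y $ 3 + x $ 4 * y $ 2 + x $ 5 * y $ 1"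
  by (simp add: Qform_def Qmat_def sum_5 matrix_vector_mult_def algebra_simps)

lemma quad_q_eq: "quad_q l = l $ 1 * l $ 5 + l $ 2 * l $ 4 - (l $ 3)\<^sup>2"
  by (simp add: quad_q_def Qform_eq power2_eq_square field_simps)

lemma quad_q_scale: "quad_q (t *\<^sub>R l) = t\<^sup>2 * quad_q l"
  by (simp add: quad_q_eq power2_eq_square algebra_simps)

definition eqn :: "real^5 \<Rightarrow> complex^3 \<Rightarrow> complex" where
  "eqn l z = Qform (cvec l) (tilde z)"

lemma eqn_eq: "eqn l z = of_real (l $ 1) + of_real (l $ 2) * z $ 3 - 2 * of_real (l $ 3) * z $ 2 +
    of_real (l $ 4) * z $ 1 - of_real (l $ 5) * (z $ 1 * z $ 3 - z $ 2 * z $ 2)"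
  by (simp add: eqn_def Qform_eq cvec_def tilde_def algebra_simps)

lemma mem_rat_quad_divisor: "z \<in> rat_quad_divisor l \<longleftrightarrow> z \<in> tube \<and> eqn l z = 0"
  by (simp add: rat_quad_divisor_def eqn_def)

lemma rat_quad_divisor_scale:
  assumes "t \<noteq> 0"
  shows "rat_quad_divisor (t *\<^sub>R l) = rat_quad_divisor l"
proof -
  have "eqn (t *\<^sub>R l) z = of_real t * eqn l z" for z by (simp add: eqn_eq algebra_simps)
  thus ?thesis using assms by (auto simp: mem_rat_quad_divisor)
qed

lemma continuous_on_eqn: "continuous_on UNIV (eqn l)"
  unfolding eqn_eq by (intro continuous_intros)

lemma open_tube: "open tube"
proof -
  have "tube = {z. 0 < Im (z $ 1)} \<inter> {z. (Im (z $ 2))\<^sup>2 < Im (z $ 1) * Im (z $ 3)}"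
    by (auto simp: tube_iff)
  also have "open \<dots>" by (intro open_Int open_Collect_less continuous_intros)
  finally show ?thesis .
qed

text \<open>A second difference around t0 isolates p. Only a ball is assumed because divisors are
  compared locally.\<close>

lemma quadratic_zero_on_ball:
  fixes p q r :: complex
  assumes "\<delta> > 0" "\<And>t. dist t t0 < \<delta> \<Longrightarrow> p * t\<^sup>2 + q * t + r = 0"
  shows "p = 0 \<and> q = 0 \<and> r = 0"
proof -
  define h where "h = complex_of_real (\<delta> / 2)"
  have h: "h \<noteq> 0" "dist (t0 + h) t0 < \<delta>" "dist (t0 - h) t0 < \<delta>"
    using assms(1) by (auto simp: h_def dist_norm norm_divide)
  have e: "p * t0\<^sup>2 + q * t0 + r = 0" "p * (t0 + h)\<^sup>2 + q * (t0 + h) + r = 0" "p * (t0 - h)\<^sup>2 + q * (t0 - h) + r = 0"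
    using assms h by (auto intro!: assms(2))
  have "2 * p * h\<^sup>2 = (p * (t0 + h)\<^sup>2 + q * (t0 + h) + r) + (p * (t0 - h)\<^sup>2 + q * (t0 - h) + r) - 2 * (p * t0\<^sup>2 + q * t0 + r)"
    by (simp add: power2_eq_square algebra_simps)
  also have "\<dots> = 0" unfolding e by simp
  finally have p: "p = 0" using h by simp
  have "q * h = (q * (t0 + h) + r) - (q * t0 + r)" by (simp add: algebra_simps)
  also have "\<dots> = 0" using e p by simp
  finally have "q = 0" using h by simp
  thus ?thesis using p e by simp
qed

lemma isCont_vec3:
  fixes a b c :: "'b::t2_space \<Rightarrow> complex"
  assumes "isCont a p" "isCont b p" "isCont c p"
  shows "isCont (\<lambda>x. vec3 (a x) (b x) (c x)) p"
proof -
  have "\<forall>i. ((\<lambda>x. vec3 (a x) (b x) (c x) $ i) \<longlongrightarrow> vec3 (a p) (b p) (c p) $ i) (at p)"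
    using assms by (simp add: forall_3 isCont_def)
  thus ?thesis unfolding isCont_def by (intro vec_tendstoI) blast
qed

lemma nearby_points:
  assumes \<phi>: "isCont \<phi> (x, y :: complex)" and V: "open V" "\<phi> (x :: complex, y) \<in> V"
  obtains \<delta> where "\<delta> > 0" "\<And>s t. dist s x < \<delta> \<Longrightarrow> dist t y < \<delta> \<Longrightarrow> \<phi> (s, t) \<in> V"
proof -
  have "\<forall>\<^sub>F p in nhds (x, y). \<phi> p \<in> V"
    using topological_tendstoD[OF \<phi>[unfolded isCont_def] V] V(2) by (simp add: eventually_nhds_conv_at)
  then obtain d where d: "d > 0" "\<And>p. dist p (x, y) < d \<Longrightarrow> \<phi> p \<in> V" unfolding eventually_nhds_metric by blast
  show thesis
  proof (rule that[of "d / 2"])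
    fix s t assume "dist s x < d / 2" "dist t y < d / 2"
    hence "dist (s, t) (x, y) < d"
      using sqrt_sum_squares_le_sum[of "dist s x" "dist t y"] by (simp add: dist_Pair_Pair)
    thus "\<phi> (s, t) \<in> V" by (rule d(2))
  qed (use d in auto)
qed

text \<open>Any small piece of a divisor determines the vector up to scale. The equation of
  \<open>l\<close> is solved for one coordinate and inserted into that of \<open>l'\<close>; after
  clearing denominators a polynomial in the other two coordinates vanishes on an open set, and its
  coefficients give the proportionality.\<close>

lemma rat_quad_divisor_locally_contained:
  assumes q: "quad_q l < 0" and V: "open V" "z \<in> V" "z \<in> rat_quad_divisor l"
    and sub: "V \<inter> rat_quad_divisor l \<subseteq> rat_quad_divisor l'"
  obtains r where "l' = r *\<^sub>R l"
proof -
  define a b c d e where abcde: "a = l $ 1" "b = l $ 2" "c = l $ 3" "d = l $ 4" "e = l $ 5"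
  define a' b' c' d' e' where abcde': "a' = l' $ 1" "b' = l' $ 2" "c' = l' $ 3" "d' = l' $ 4" "e' = l' $ 5"
  define z1 z2 z3 where z: "z1 = z $ 1" "z2 = z $ 2" "z3 = z $ 3"
  have zt: "z \<in> tube" and ez: "eqn l z = 0" using V(3) by (auto simp: mem_rat_quad_divisor)
  have im: "Im z1 > 0" using zt by (simp add: tube_iff z)
  have VT: "open (V \<inter> tube)" using V open_tube by blast
  show thesis
  proof (cases "b = 0 \<and> e = 0")
    case False
    have nz: "of_real b - of_real e * s \<noteq> 0" if "Im s > 0" for s :: complex
    proof
      assume "of_real b - of_real e * s = 0"
      hence "Im (of_real b - of_real e * s) = 0" "Re (of_real b - of_real e * s) = 0" by simp_all
      thus False using that False by auto
    qed
    \<comment> \<open>The equation is solved for z3; its denominator has no zero in the upper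
      half-plane.\<close>
    define k where "k = (\<lambda>s t :: complex. (2 * of_real c * t - of_real a - of_real d * s - of_real e * t\<^sup>2) / (of_real b - of_real e * s))"
    have kz: "k z1 z2 = z3"
      using ez nz[OF im] by (simp add: k_def eqn_eq abcde z field_simps power2_eq_square)
    define \<phi> where "\<phi> = (\<lambda>(s, t). vec3 s t (k s t))"
    have "isCont (\<lambda>p. k (fst p) (snd p)) (z1, z2)"
      unfolding k_def using nz[OF im] by (intro continuous_intros) auto
    hence "isCont \<phi> (z1, z2)"
      unfolding \<phi>_def case_prod_unfold by (intro isCont_vec3 continuous_intros)
    moreover have "\<phi> (z1, z2) = z" by (simp add: \<phi>_def kz vec_eq_iff forall_3) (simp add: z)
    hence "\<phi> (z1, z2) \<in> V \<inter> tube" using V zt by simp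
    ultimately obtain \<delta> where \<delta>: "\<delta> > 0" "\<And>s t. dist s z1 < \<delta> \<Longrightarrow> dist t z2 < \<delta> \<Longrightarrow> \<phi> (s, t) \<in> V \<inter> tube"
      using nearby_points[OF _ VT] by blast
    have H: "of_real (b * e' - b' * e) * t\<^sup>2 + (2 * (of_real c * (of_real b' - of_real e' * s) - of_real c' * (of_real b - of_real e * s))) * t
        + ((of_real b - of_real e * s) * (of_real a' + of_real d' * s) - (of_real b' - of_real e' * s) * (of_real a + of_real d * s)) = 0"
      if st: "dist s z1 < \<delta>" "dist t z2 < \<delta>" for s t :: complex
    proof -
      have w: "vec3 s t (k s t) \<in> V \<inter> tube" using \<delta>(2)[OF st] by (simp add: \<phi>_def)
      hence "Im s > 0" by (simp add: tube_iff)
      note n = nz[OF this]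
      have k: "k s t * (of_real b - of_real e * s) = 2 * of_real c * t - of_real a - of_real d * s - of_real e * t\<^sup>2"
        using n by (simp add: k_def)
      have "eqn l (vec3 s t (k s t)) = 0"
        using k by (simp add: eqn_eq abcde power2_eq_square algebra_simps)
      hence "eqn l' (vec3 s t (k s t)) = 0" using w sub by (auto simp: mem_rat_quad_divisor)
      hence "(of_real b - of_real e * s) * (of_real a' - 2 * of_real c' * t + of_real d' * s + of_real e' * t\<^sup>2) +
          (of_real b' - of_real e' * s) * (k s t * (of_real b - of_real e * s)) = 0"
        by (simp add: eqn_eq abcde' power2_eq_square) (algebra)
      thus ?thesis unfolding k by (simp add: power2_eq_square) (algebra)
    qed
    have H': "of_real (b * e' - b' * e) = (0::complex) \<and>
        2 * (of_real c * (of_real b' - of_real e' * s) - of_real c' * (of_real b - of_real e * s)) = 0 \<and>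
        (of_real b - of_real e * s) * (of_real a' + of_real d' * s) - (of_real b' - of_real e' * s) * (of_real a + of_real d * s) = 0"
      if "dist s z1 < \<delta>" for s :: complex
      by (rule quadratic_zero_on_ball[OF \<delta>(1) H]) (use that in auto)
    have 1: "b * e' = b' * e"
      using H'[of z1] \<delta>(1) by (metis dist_self eq_iff_diff_eq_0 of_real_eq_0_iff)
    have "(0::complex) = 0 \<and> of_real (2 * (c' * e - c * e')) = (0::complex) \<and> of_real (2 * (c * b' - c' * b)) = (0::complex)"
      by (rule quadratic_zero_on_ball[OF \<delta>(1), of z1]) (use H' in \<open>auto simp: algebra_simps\<close>)
    hence "2 * (c' * e - c * e') = 0" "2 * (c * b' - c' * b) = 0" by (simp_all only: of_real_eq_0_iff)
    hence 2: "c' * e = c * e'" "c * b' = c' * b" by simp_all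
    have "of_real (e' * d - e * d') = (0::complex) \<and> of_real (b * d' - e * a' - b' * d + e' * a) = (0::complex) \<and>
        of_real (b * a' - b' * a) = (0::complex)"
      by (rule quadratic_zero_on_ball[OF \<delta>(1), of z1]) (use H' in \<open>auto simp: algebra_simps power2_eq_square\<close>)
    hence 3: "e' * d = e * d'" "b * d' - e * a' - b' * d + e' * a = 0" "b * a' = b' * a"
      by (simp_all only: of_real_eq_0_iff right_minus_eq)
    show thesis
    proof (cases "b = 0")
      case True
      with False have e: "e \<noteq> 0" by simp
      have "b' = 0" using 1 True e by simp
      have "l' = (e' / e) *\<^sub>R l"
        using 1 2 3 True e \<open>b' = 0\<close>
        by (simp add: vec_eq_iff forall_5 flip: abcde abcde') (simp add: field_simps)
      thus thesis by (rule that)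
    next
      case b: False
      have "e' = b' / b * e" "c' = b' / b * c" "a' = b' / b * a" using 1 2 3 b by (simp_all add: field_simps)
      moreover from this have "e * a' = e' * a" by simp
      hence "d' = b' / b * d" using 3 b by (simp add: field_simps)
      ultimately have "l' = (b' / b) *\<^sub>R l"
        using b by (simp add: vec_eq_iff forall_5 flip: abcde abcde')
      thus thesis by (rule that)
    qed
  next
    case True
    \<comment> \<open>With b = e = 0 the norm is - c^2, so the equation can be solved for z2
      instead.\<close>
    have c: "c \<noteq> 0" using q True by (auto simp: quad_q_eq abcde)
    define k where "k = (\<lambda>s. (of_real a + of_real d * s) / (2 * of_real c) :: complex)"
    have kz: "k z1 = z2"
      using ez c True by (simp add: k_def eqn_eq abcde z field_simps)
    define \<phi> where "\<phi> = (\<lambda>(s, t). vec3 s (k s) t)"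
    have "isCont (\<lambda>p. k (fst p)) (z1, z3)"
      unfolding k_def using c by (intro continuous_intros) auto
    hence "isCont \<phi> (z1, z3)"
      unfolding \<phi>_def case_prod_unfold by (intro isCont_vec3 continuous_intros)
    moreover have "\<phi> (z1, z3) = z" by (simp add: \<phi>_def kz vec_eq_iff forall_3) (simp add: z)
    hence "\<phi> (z1, z3) \<in> V \<inter> tube" using V zt by simp
    ultimately obtain \<delta> where \<delta>: "\<delta> > 0" "\<And>s t. dist s z1 < \<delta> \<Longrightarrow> dist t z3 < \<delta> \<Longrightarrow> \<phi> (s, t) \<in> V \<inter> tube"
      using nearby_points[OF _ VT] by blast
    have H: "0 * t\<^sup>2 + (of_real b' - of_real e' * s) * t + (of_real a' - 2 * of_real c' * k s + of_real d' * s + of_real e' * (k s)\<^sup>2) = 0"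
      if st: "dist s z1 < \<delta>" "dist t z3 < \<delta>" for s t :: complex
    proof -
      have w: "vec3 s (k s) t \<in> V \<inter> tube" using \<delta>(2)[OF st] by (simp add: \<phi>_def)
      have "eqn l (vec3 s (k s) t) = 0"
        using True c by (simp add: eqn_eq k_def flip: abcde)
      hence "eqn l' (vec3 s (k s) t) = 0" using w sub by (auto simp: mem_rat_quad_divisor)
      thus ?thesis by (simp add: eqn_eq power2_eq_square algebra_simps flip: abcde')
    qed
    have H': "of_real b' - of_real e' * s = 0" "of_real a' - 2 * of_real c' * k s + of_real d' * s + of_real e' * (k s)\<^sup>2 = 0"
      if "dist s z1 < \<delta>" for s :: complex
      using quadratic_zero_on_ball[OF \<delta>(1) H] that by blast+
    have "(0::complex) = 0 \<and> of_real (- e') = (0::complex) \<and> of_real b' = (0::complex)"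
      by (rule quadratic_zero_on_ball[OF \<delta>(1), of z1]) (use H' in \<open>auto simp: algebra_simps\<close>)
    hence be: "b' = 0" "e' = 0" by simp_all
    have "(0::complex) = 0 \<and> of_real (d' - c' * d / c) = (0::complex) \<and> of_real (a' - c' * a / c) = (0::complex)"
    proof (rule quadratic_zero_on_ball[OF \<delta>(1), of z1])
      fix s assume "dist s z1 < \<delta>"
      note h = H'(2)[OF this]
      have "2 * of_real c' * k s = of_real c' * of_real a / of_real c + of_real c' * of_real d / of_real c * s"
        using c by (simp add: k_def add_divide_distrib distrib_left)
      with h show "0 * s\<^sup>2 + of_real (d' - c' * d / c) * s + of_real (a' - c' * a / c) = 0"
        by (simp add: be algebra_simps)
    qed
    hence "d' = c' / c * d" "a' = c' / c * a" by (simp_all only: of_real_eq_0_iff right_minus_eq) simp_all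
    hence "l' = (c' / c) *\<^sub>R l"
      using c be True by (simp add: vec_eq_iff forall_5 flip: abcde abcde')
    thus thesis by (rule that)
  qed
qed

section \<open>Primitive vectors and Heegner multiplicities\<close>

lemma lattice_L_iff: "x \<in> lattice_L \<longleftrightarrow> x $ 1 \<in> \<int> \<and> x $ 2 \<in> \<int> \<and> x $ 3 \<in> \<int> \<and> x $ 4 \<in> \<int> \<and> x $ 5 \<in> \<int>"
  by (simp add: lattice_L_def forall_5)

lemma dual_L_iff: "x \<in> dual_L \<longleftrightarrow> x $ 1 \<in> \<int> \<and> x $ 2 \<in> \<int> \<and> 2 * x $ 3 \<in> \<int> \<and> x $ 4 \<in> \<int> \<and> x $ 5 \<in> \<int>"
proof
  assume "x \<in> dual_L"
  hence *: "Qform x y \<in> \<int>" if "y \<in> lattice_L" for y using that by (auto simp: dual_L_def)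
  show "x $ 1 \<in> \<int> \<and> x $ 2 \<in> \<int> \<and> 2 * x $ 3 \<in> \<int> \<and> x $ 4 \<in> \<int> \<and> x $ 5 \<in> \<int>"
    using *[of "vec5 0 0 0 0 1"] *[of "vec5 0 0 0 1 0"] *[of "vec5 0 0 (-1) 0 0"] *[of "vec5 0 1 0 0 0"] *[of "vec5 1 0 0 0 0"]
    by (simp add: lattice_L_iff Qform_eq)
next
  assume *: "x $ 1 \<in> \<int> \<and> x $ 2 \<in> \<int> \<and> 2 * x $ 3 \<in> \<int> \<and> x $ 4 \<in> \<int> \<and> x $ 5 \<in> \<int>"
  show "x \<in> dual_L" unfolding dual_L_def Qform_eq
    using * by (auto simp: lattice_L_iff intro!: Ints_add Ints_diff Ints_mult)
qed

definition primitive :: "real^5 \<Rightarrow> bool" where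
  "primitive l \<longleftrightarrow> l \<in> dual_L \<and> (\<forall>t. t *\<^sub>R l \<in> dual_L \<longrightarrow> t \<in> \<int>)"

lemma dual_L_int_combination:
  assumes "x \<in> dual_L" "y \<in> dual_L" "m \<in> \<int>"
  shows "x - m *\<^sub>R y \<in> dual_L" "m *\<^sub>R y \<in> dual_L"
proof -
  have "m * (2 * y $ 3) \<in> \<int>" "2 * x $ 3 \<in> \<int>" using assms by (auto simp only: dual_L_iff intro!: Ints_mult)
  hence "2 * x $ 3 - m * (2 * y $ 3) \<in> \<int>" "m * (2 * y $ 3) \<in> \<int>" by (auto intro: Ints_diff)
  hence i: "2 * (x - m *\<^sub>R y) $ 3 \<in> \<int>" "2 * (m *\<^sub>R y) $ 3 \<in> \<int>"
    by (simp_all add: algebra_simps)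
  show "x - m *\<^sub>R y \<in> dual_L" "m *\<^sub>R y \<in> dual_L"
    unfolding dual_L_iff
    by (intro conjI i; use assms in \<open>auto simp: dual_L_iff intro!: Ints_diff Ints_mult\<close>)+
qed

lemma lattice_subset_dual: "x \<in> lattice_L \<Longrightarrow> x \<in> dual_L"
  by (auto simp: lattice_L_iff dual_L_iff intro!: Ints_mult)

text \<open>The real t with t l in the dual lattice lie in (1/N) Z, where N is, up to sign, a
  nonzero entry among l1, l2, 2 l3, l4, l5. The least positive one gives the primitive multiple,
  since a fractional part would produce a smaller one.\<close>

lemma primitive_exists:
  assumes l: "l \<in> dual_L" "l \<noteq> 0"
  obtains t where "t > 0" "primitive (t *\<^sub>R l)"
proof -
  obtain N :: real where N: "N > 0" "N \<in> \<int>" "\<And>t. t *\<^sub>R l \<in> dual_L \<Longrightarrow> t * N \<in> \<int>"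
  proof -
    note goal = that
    have *: thesis if x: "x \<noteq> 0" "x \<in> \<int>" "\<And>t. t *\<^sub>R l \<in> dual_L \<Longrightarrow> t * x \<in> \<int>" for x
    proof (cases "x > 0")
      case True
      thus thesis using goal x by blast
    next
      case False
      show thesis
      proof (rule goal[of "- x"])
        show "t * - x \<in> \<int>" if "t *\<^sub>R l \<in> dual_L" for t using x(3)[OF that] by simp
      qed (use x False in auto)
    qed
    have "l $ 1 \<noteq> 0 \<or> l $ 2 \<noteq> 0 \<or> 2 * l $ 3 \<noteq> 0 \<or> l $ 4 \<noteq> 0 \<or> l $ 5 \<noteq> 0"
      using l(2) by (simp add: vec_eq_iff forall_5)
    moreover have "t * l $ 1 \<in> \<int>" "t * l $ 2 \<in> \<int>" "t * (2 * l $ 3) \<in> \<int>" "t * l $ 4 \<in> \<int>" "t * l $ 5 \<in> \<int>"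
      if "t *\<^sub>R l \<in> dual_L" for t
      using that by (simp_all add: dual_L_iff mult_ac)
    ultimately show thesis
      using *[of "l $ 1"] *[of "l $ 2"] *[of "2 * l $ 3"] *[of "l $ 4"] *[of "l $ 5"] l(1)
      unfolding dual_L_iff[of l] by blast
  qed
  define S where "S n \<longleftrightarrow> n > 0 \<and> (real n / N) *\<^sub>R l \<in> dual_L" for n :: nat
  obtain n1 where "N = real n1"
    using N(1,2) by (metis Ints_cases int_eq_iff_numeral of_int_of_nat_eq of_int_0_less_iff pos_int_cases)
  hence "S n1" using N l by (simp add: S_def)
  define n0 where "n0 = (LEAST n. S n)"
  have n0: "S n0" unfolding n0_def by (rule LeastI[of S, OF \<open>S n1\<close>])
  define t0 where "t0 = real n0 / N"
  have t0: "t0 > 0" "t0 *\<^sub>R l \<in> dual_L" using n0 N by (auto simp: S_def t0_def)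
  have "primitive (t0 *\<^sub>R l)"
    unfolding primitive_def
  proof (intro conjI allI impI t0(2))
    fix t assume t: "t *\<^sub>R t0 *\<^sub>R l \<in> dual_L"
    show "t \<in> \<int>"
    proof (rule ccontr)
      assume "t \<notin> \<int>"
      define s where "s = frac t * t0"
      have "frac t > 0" "frac t < 1" using \<open>t \<notin> \<int>\<close> by (auto simp: frac_gt_0_iff frac_lt_1)
      hence s: "s > 0" "s < t0" using t0 by (auto simp: s_def)
      have "t *\<^sub>R t0 *\<^sub>R l - of_int \<lfloor>t\<rfloor> *\<^sub>R (t0 *\<^sub>R l) = s *\<^sub>R l"
        by (simp add: s_def frac_def algebra_simps)
      hence sl: "s *\<^sub>R l \<in> dual_L" using dual_L_int_combination(1)[OF t t0(2), of "of_int \<lfloor>t\<rfloor>"] by simp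
      hence "s * N \<in> \<int>" by (rule N(3))
      moreover have "s * N > 0" using s N by simp
      ultimately obtain n where n: "s * N = real n" "n > 0"
        by (metis Ints_cases of_int_0_less_iff of_int_of_nat_eq pos_int_cases)
      hence "s = real n / N" using N by (simp add: field_simps)
      hence "S n" using sl n by (simp add: S_def)
      hence "n0 \<le> n" unfolding n0_def by (rule Least_le)
      hence "t0 \<le> s" using N unfolding t0_def \<open>s = real n / N\<close> by (intro divide_right_mono) auto
      thus False using s by simp
    qed
  qed
  thus thesis using that t0 by blast
qed

text \<open>The class of x is the parity of c = 2 x_3, and q(x) is - c^2 / 4 modulo 1; if 4 divides
  c^2 - c'^2, the parities agree.\<close>

lemma coset_determined_by_norm:
  assumes "x \<in> dual_L" "y \<in> dual_L" "quad_q x - quad_q y \<in> \<int>"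
  shows "x - y \<in> lattice_L"
proof -
  obtain c c' :: int where c: "2 * x $ 3 = of_int c" "2 * y $ 3 = of_int c'"
    using assms unfolding dual_L_iff by (auto elim!: Ints_cases)
  have "(x $ 3)\<^sup>2 - (y $ 3)\<^sup>2 = (x $ 1 * x $ 5 + x $ 2 * x $ 4) - (y $ 1 * y $ 5 + y $ 2 * y $ 4) - (quad_q x - quad_q y)"
    by (simp add: quad_q_eq)
  also have "\<dots> \<in> \<int>" using assms by (auto simp: dual_L_iff intro!: Ints_diff Ints_add Ints_mult)
  finally obtain m :: int where m: "(x $ 3)\<^sup>2 - (y $ 3)\<^sup>2 = of_int m" by (auto elim: Ints_cases)
  have xy: "x $ 3 = of_int c / 2" "y $ 3 = of_int c' / 2" using c by simp_all
  have "real_of_int (c\<^sup>2 - c'\<^sup>2) = real_of_int (4 * m)"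
    using m unfolding xy by (simp add: power_divide field_simps)
  hence "c\<^sup>2 - c'\<^sup>2 = 4 * m" by (simp only: of_int_eq_iff)
  hence "even (c\<^sup>2 - c'\<^sup>2)" by simp
  hence "even (c - c')" by simp
  then obtain k where "c - c' = 2 * k" by (elim evenE)
  hence "real_of_int c - real_of_int c' = 2 * real_of_int k" by (metis of_int_diff of_int_mult of_int_numeral)
  hence "x $ 3 - y $ 3 = of_int k" using c by simp
  thus ?thesis using assms by (auto simp: lattice_L_iff dual_L_iff intro!: Ints_diff)
qed

text \<open>Dual vectors with the same divisor are integral multiples of the primitive one, and the
  coset condition follows from the norm. The count involves \<open>l\<close> only through q(l), so
  \<open>l\<close> may be exchanged for a standard vector.\<close>

lemma heegner_primitive:
  assumes l: "primitive l" "quad_q l < 0" "rat_quad_divisor l \<noteq> {}" and idx: "(\<alpha>, n) \<in> heegner_index"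
  shows "heegner \<alpha> n (rat_quad_divisor l) = int (card {j::int. (of_int j)\<^sup>2 * quad_q l = n})"
proof -
  have \<alpha>: "\<alpha> \<in> dual_L" "n - quad_q \<alpha> \<in> \<int>" "n < 0" using idx by (auto simp: heegner_index_def)
  have l0: "l \<in> dual_L" "l \<noteq> 0" using l by (auto simp: primitive_def quad_q_eq)
  have "{x. x - \<alpha> \<in> lattice_L \<and> quad_q x = n \<and> rat_quad_divisor x = rat_quad_divisor l} =
      (\<lambda>j::int. of_int j *\<^sub>R l) ` {j. (of_int j)\<^sup>2 * quad_q l = n}" (is "?A = ?B")
  proof (intro equalityI subsetI)
    fix x assume x: "x \<in> ?A"
    have "x = (x - \<alpha>) - (- 1) *\<^sub>R \<alpha>" by simp
    moreover have "x - \<alpha> \<in> dual_L" using x lattice_subset_dual by blast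
    ultimately have xd: "x \<in> dual_L" using dual_L_int_combination(1)[of "x - \<alpha>" \<alpha> "-1"] \<alpha> by simp
    obtain z where z: "z \<in> rat_quad_divisor l" using l by blast
    obtain r where r: "x = r *\<^sub>R l"
      using rat_quad_divisor_locally_contained[OF l(2) open_UNIV UNIV_I z, of x] x by auto
    hence "r \<in> \<int>" using l xd by (auto simp: primitive_def)
    then obtain j :: int where "r = of_int j" by (elim Ints_cases)
    thus "x \<in> ?B" using x r by (auto simp: quad_q_scale)
  next
    fix x assume "x \<in> ?B"
    then obtain j :: int where j: "x = of_int j *\<^sub>R l" "(of_int j)\<^sup>2 * quad_q l = n" by blast
    have q: "quad_q x = n" using j by (simp add: quad_q_scale)
    have "j \<noteq> 0" using j \<alpha> by auto
    moreover have "x \<in> dual_L" using dual_L_int_combination(2)[OF l0(1,1)] j by simp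
    hence "x - \<alpha> \<in> lattice_L" using \<alpha> q by (intro coset_determined_by_norm) auto
    ultimately show "x \<in> ?A" using q rat_quad_divisor_scale[of "of_int j" l] j by simp
  qed
  moreover have "inj (\<lambda>j::int. of_int j *\<^sub>R l)" using l0 by (auto simp: inj_def)
  ultimately show ?thesis unfolding heegner_def by (simp add: card_image inj_on_subset)
qed

text \<open>For q(l) = - M - c'^2 with c' in {0, 1/2} and M > 0 take (0, 1, c', - M, 0). Its divisor
  z3 - 2 c' z2 - M z1 = 0 contains (tau, 0, M tau), and the entry 1 makes it primitive.\<close>

lemma standard_vector:
  assumes l: "l \<in> dual_L" "quad_q l < 0"
  obtains l1 M where "primitive l1" "quad_q l1 = quad_q l" "M > (0::real)"
    "\<And>\<tau>. \<tau> \<in> uhp \<Longrightarrow> vec3 \<tau> 0 (of_real M * \<tau>) \<in> rat_quad_divisor l1"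
proof -
  obtain c :: int where c: "2 * l $ 3 = of_int c" using l unfolding dual_L_iff by (auto elim!: Ints_cases)
  have "l $ 1 * l $ 5 + l $ 2 * l $ 4 \<in> \<int>" using l by (auto simp: dual_L_iff intro!: Ints_add Ints_mult)
  then obtain m :: int where m: "l $ 1 * l $ 5 + l $ 2 * l $ 4 = of_int m" by (elim Ints_cases)
  have "l $ 3 = of_int c / 2" using c by simp
  hence q: "quad_q l = of_int m - (of_int c / 2)\<^sup>2" by (simp only: quad_q_eq m)
  have tube: "vec3 \<tau> 0 (of_real M * \<tau>) \<in> tube" if "\<tau> \<in> uhp" "M > 0" for \<tau> M
    using that by (simp add: tube_iff uhp_def)
  note goal = that
  have main: thesis if h: "c' = 0 \<or> c' = 1/2" "quad_q l = - of_int M - c'\<^sup>2" "M > 0" for M :: int and c' :: real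
  proof (rule goal[of "vec5 0 1 c' (- of_int M) 0" "of_int M"])
    have "2 * c' = 0 \<or> 2 * c' = 1" using h(1) by auto
    hence "2 * c' \<in> \<int>" by (metis Ints_0 Ints_1)
    thus "primitive (vec5 0 1 c' (- of_int M) 0)"
      unfolding primitive_def dual_L_iff by auto
    show "quad_q (vec5 0 1 c' (- of_int M) 0) = quad_q l" by (simp add: quad_q_eq[of "vec5 _ _ _ _ _"] h(2))
    show "vec3 \<tau> 0 (of_real (of_int M) * \<tau>) \<in> rat_quad_divisor (vec5 0 1 c' (- of_int M) 0)" if "\<tau> \<in> uhp" for \<tau>
      using tube[OF that, of "of_int M"] h(3) by (simp add: mem_rat_quad_divisor eqn_eq)
  qed (use h(3) in simp)
  show thesis
  proof (cases "even c")
    case True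
    then obtain k where k: "c = 2 * k" by (elim evenE)
    have qk: "quad_q l = - of_int (k\<^sup>2 - m) - 0\<^sup>2" using q k by simp
    hence "k\<^sup>2 - m > 0" using l by (metis diff_zero neg_less_0_iff_less of_int_0_less_iff zero_power2)
    thus thesis using main[of 0] qk by blast
  next
    case False
    then obtain k where k: "c = 2 * k + 1" by (elim oddE)
    have qk: "quad_q l = - of_int (k\<^sup>2 + k - m) - (1/2)\<^sup>2" using q k by (simp add: field_simps power2_eq_square)
    hence "real_of_int (k\<^sup>2 + k - m) > -1" using l by (simp add: power2_eq_square)
    hence "k\<^sup>2 + k - m \<ge> 0" by linarith
    then consider "k\<^sup>2 + k - m > 0" | "k\<^sup>2 + k - m = 0" by linarith
    thus thesis
    proof cases
      case 1
      thus thesis using main[of "1/2"] qk by blast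
    next
      case 2
      \<comment> \<open>The norm is -1/4, for which M would be 0. The divisor of (0, 0, 1/2, 0, 0)
        is the diagonal z2 = 0, which contains the curve with M = 1.\<close>
      show thesis
      proof (rule goal[of "vec5 0 0 (1/2) 0 0" 1])
        show "primitive (vec5 0 0 (1/2) 0 0)" unfolding primitive_def dual_L_iff by auto
        show "quad_q (vec5 0 0 (1/2) 0 0) = quad_q l"
          unfolding qk 2 by (simp add: quad_q_eq)
        show "vec3 \<tau> 0 (of_real 1 * \<tau>) \<in> rat_quad_divisor (vec5 0 0 (1/2) 0 0)" if "\<tau> \<in> uhp" for \<tau>
          using tube[OF that, of 1] by (simp add: mem_rat_quad_divisor eqn_eq)
      qed simp
    qed
  qed
qed

section \<open>Divisor components and the zero set\<close>

text \<open>Along a suitable coordinate direction the equation is linear and not constant, so the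
  line meets the divisor only in z.\<close>

lemma eqn_perturb:
  assumes "quad_q l < 0" "z \<in> rat_quad_divisor l"
  obtains v where "\<And>s. s \<noteq> 0 \<Longrightarrow> eqn l (z + s *s v) \<noteq> 0"
proof (cases "l $ 2 = 0 \<and> l $ 5 = 0")
  case True
  hence "l $ 3 \<noteq> 0" using assms(1) by (auto simp: quad_q_eq)
  moreover have "eqn l (z + s *s vec3 0 1 0) = eqn l z - 2 * of_real (l $ 3) * s" for s
    using True by (simp add: eqn_eq algebra_simps)
  ultimately show thesis using assms(2) by (intro that[of "vec3 0 1 0"]) (auto simp: mem_rat_quad_divisor)
next
  case False
  have "of_real (l $ 2) - of_real (l $ 5) * z $ 1 \<noteq> 0"
  proof
    assume "of_real (l $ 2) - of_real (l $ 5) * z $ 1 = 0"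
    hence "Im (of_real (l $ 2) - of_real (l $ 5) * z $ 1) = 0" "Re (of_real (l $ 2) - of_real (l $ 5) * z $ 1) = 0"
      by simp_all
    thus False using False assms(2) by (auto simp: mem_rat_quad_divisor tube_iff)
  qed
  moreover have "eqn l (z + s *s vec3 0 0 1) = eqn l z + s * (of_real (l $ 2) - of_real (l $ 5) * z $ 1)" for s
    by (simp add: eqn_eq algebra_simps)
  ultimately show thesis using assms(2) by (intro that[of "vec3 0 0 1"]) (auto simp: mem_rat_quad_divisor)
qed

text \<open>No other divisor of this kind contains an open piece of the given one, so finitely many
  of them are avoided one by one by shrinking the neighbourhood.\<close>

lemma generic_point:
  assumes l: "quad_q l < 0" and W: "open W" "z \<in> W" "z \<in> rat_quad_divisor l"
    and M: "finite M" "\<And>Y. Y \<in> M \<Longrightarrow> \<exists>l'. quad_q l' < 0 \<and> Y = rat_quad_divisor l' \<and> Y \<noteq> rat_quad_divisor l"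
  shows "\<exists>W'. open W' \<and> W' \<subseteq> W \<and> W' \<inter> rat_quad_divisor l \<noteq> {} \<and> (\<forall>Y\<in>M. W' \<inter> Y = {})"
  using M
proof (induction M rule: finite_induct)
  case empty
  thus ?case using W by blast
next
  case (insert Y M)
  then obtain P where P: "open P" "P \<subseteq> W" "P \<inter> rat_quad_divisor l \<noteq> {}" "\<forall>Y\<in>M. P \<inter> Y = {}" by blast
  obtain l' where l': "quad_q l' < 0" "Y = rat_quad_divisor l'" "Y \<noteq> rat_quad_divisor l" using insert.prems by blast
  obtain x where x: "x \<in> P" "x \<in> rat_quad_divisor l" using P by blast
  have "\<not> P \<inter> rat_quad_divisor l \<subseteq> rat_quad_divisor l'"
  proof
    assume "P \<inter> rat_quad_divisor l \<subseteq> rat_quad_divisor l'"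
    then obtain r where r: "l' = r *\<^sub>R l" using rat_quad_divisor_locally_contained[OF l P(1) x] by blast
    hence "r \<noteq> 0" using l' by (auto simp: quad_q_eq)
    thus False using l' rat_quad_divisor_scale r by blast
  qed
  then obtain w where w: "w \<in> P" "w \<in> rat_quad_divisor l" "w \<notin> rat_quad_divisor l'" by blast
  hence w': "eqn l' w \<noteq> 0" by (simp add: mem_rat_quad_divisor)
  have "open {z. eqn l' z \<noteq> 0}" by (intro open_Collect_neq continuous_on_eqn continuous_on_const)
  thus ?case
    using P w w' l' by (intro exI[of _ "P \<inter> {z. eqn l' z \<noteq> 0}"]) (auto simp: mem_rat_quad_divisor)
qed

text \<open>At x itself several components may meet. If f x were nonzero, there would be a nearby
  point y on this component alone with f y nonzero and f = R t^D near y off the component, R y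
  nonzero. Then D > 0 gives f y = 0, while D < 0 gives f t^n = R and so R y = 0.\<close>

lemma divisor_component_in_zero_set:
  assumes hol: "mv_holomorphic_on f tube" and div: "has_divisor tube f D"
    and comp: "\<And>Y. D Y \<noteq> 0 \<Longrightarrow> \<exists>l. quad_q l < 0 \<and> Y = rat_quad_divisor l"
    and l: "quad_q l < 0" "D (rat_quad_divisor l) \<noteq> 0" and x: "x \<in> rat_quad_divisor l"
  shows "f x = 0"
proof (rule ccontr)
  assume "f x \<noteq> 0"
  have xt: "x \<in> tube" using x by (simp add: mem_rat_quad_divisor)
  have "(f \<longlongrightarrow> f x) (at x)" using mv_holomorphic_on_continuous[OF hol xt] by (simp add: isCont_def)
  hence "\<forall>\<^sub>F z in nhds x. f z \<noteq> 0"
    using \<open>f x \<noteq> 0\<close> tendsto_imp_eventually_ne by (auto simp: eventually_nhds_conv_at)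
  then obtain Q where Q: "open Q" "x \<in> Q" "\<And>z. z \<in> Q \<Longrightarrow> f z \<noteq> 0" unfolding eventually_nhds by blast
  define Y1 where "Y1 = rat_quad_divisor l"
  obtain U t u where U: "open U" "x \<in> U" "U \<subseteq> tube" and
    "let N = {Y. D Y \<noteq> 0 \<and> Y \<inter> U \<noteq> {}} in
           finite N \<and> (\<forall>Y\<in>N. reduced_equation U Y (t Y)) \<and>
           mv_holomorphic_on u U \<and> (\<forall>z\<in>U. u z \<noteq> 0) \<and>
           (\<forall>z\<in>U - \<Union>N. regular_at f z \<longrightarrow> f z = u z * (\<Prod>Y\<in>N. t Y z powi D Y))"
    using div xt unfolding has_divisor_def by blast
  moreover define N where "N = {Y. D Y \<noteq> 0 \<and> Y \<inter> U \<noteq> {}}"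
  ultimately have N: "finite N" "\<And>Y. Y \<in> N \<Longrightarrow> reduced_equation U Y (t Y)"
      "mv_holomorphic_on u U" "\<And>z. z \<in> U \<Longrightarrow> u z \<noteq> 0"
      "\<And>z. z \<in> U - \<Union>N \<Longrightarrow> regular_at f z \<Longrightarrow> f z = u z * (\<Prod>Y\<in>N. t Y z powi D Y)"
    unfolding Let_def by blast+
  have reg: "regular_at f z" if "z \<in> tube" for z
    unfolding regular_at_def using hol open_tube that by blast
  have Y1N: "Y1 \<in> N" using l x U by (auto simp: N_def Y1_def)
  have "\<exists>W'. open W' \<and> W' \<subseteq> U \<inter> Q \<and> W' \<inter> Y1 \<noteq> {} \<and> (\<forall>Y\<in>N - {Y1}. W' \<inter> Y = {})"
    unfolding Y1_def
  proof (rule generic_point[OF l(1) _ _ x])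
    show "\<exists>l'. quad_q l' < 0 \<and> Y = rat_quad_divisor l' \<and> Y \<noteq> rat_quad_divisor l"
      if "Y \<in> N - {rat_quad_divisor l}" for Y
      using that comp[of Y] by (auto simp: N_def)
  qed (use U Q N in auto)
  then obtain P y where P: "open P" "P \<subseteq> U" "P \<subseteq> Q" "y \<in> P" "y \<in> Y1" "\<And>Y. Y \<in> N \<Longrightarrow> Y \<noteq> Y1 \<Longrightarrow> P \<inter> Y = {}"
    by blast
  have yt: "y \<in> tube" using P U by blast
  obtain v where v: "\<And>s. s \<noteq> 0 \<Longrightarrow> eqn l (y + s *s v) \<noteq> 0"
    using eqn_perturb[OF l(1)] P(5) unfolding Y1_def by blast
  \<comment> \<open>The local product formula holds off the components only, so y is approached
    along a line that leaves \<open>Y1\<close> at once.\<close>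
  define z where "z = (\<lambda>s::complex. y + s *s v)"
  have z: "(z \<longlongrightarrow> y) (at 0)"
  proof (rule vec_tendstoI)
    fix i
    have "((\<lambda>s. y $ i + s * v $ i) \<longlongrightarrow> y $ i + 0 * v $ i) (at 0)" by (intro tendsto_intros)
    thus "((\<lambda>s. z s $ i) \<longlongrightarrow> y $ i) (at 0)" by (simp add: z_def)
  qed
  have lim: "((\<lambda>s. g (z s)) \<longlongrightarrow> g y) (at 0)" if "isCont g y" for g :: "complex^3 \<Rightarrow> complex"
    by (rule isCont_tendsto_compose[OF that z])
  define R where "R = (\<lambda>w. u w * (\<Prod>Y\<in>N - {Y1}. t Y w powi D Y))"
  have yU: "y \<in> U" using P by blast
  have t_zero: "t Y w = 0 \<longleftrightarrow> w \<in> Y" if "Y \<in> N" "w \<in> U" for Y w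
  proof -
    have "Y \<inter> U = {z \<in> U. t Y z = 0}" using N(2)[OF that(1)] by (simp only: reduced_equation_def)
    hence "w \<in> Y \<inter> U \<longleftrightarrow> w \<in> {z \<in> U. t Y z = 0}" by (rule arg_cong)
    thus ?thesis using that(2) by simp
  qed
  have tc: "isCont (t Y) y" if "Y \<in> N" for Y
  proof (rule mv_holomorphic_on_continuous[OF _ yU])
    show "mv_holomorphic_on (t Y) U" using N(2)[OF that] by (simp only: reduced_equation_def)
  qed
  have tn: "t Y y \<noteq> 0" if "Y \<in> N - {Y1}" for Y
  proof -
    have "P \<inter> Y = {}" using that by (intro P(6)) auto
    thus ?thesis using that yU P(4) t_zero by blast
  qed
  have ty: "t Y1 y = 0" using t_zero[OF Y1N yU] P(5) by simp
  have limR: "((\<lambda>s. R (z s)) \<longlongrightarrow> R y) (at 0)"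
    unfolding R_def
    by (intro tendsto_mult tendsto_prod tendsto_power_int lim tc tn mv_holomorphic_on_continuous[OF N(3)]) (use P in auto)
  have R0: "R y \<noteq> 0" using N(1,4) P tn by (auto simp: R_def)
  have "\<forall>\<^sub>F s in at 0. z s \<in> P" using topological_tendstoD[OF z P(1,4)] .
  moreover have "\<forall>\<^sub>F s in at (0::complex). s \<noteq> 0" by (simp add: eventually_at_filter)
  ultimately have ev: "\<forall>\<^sub>F s in at 0. f (z s) = R (z s) * t Y1 (z s) powi D Y1 \<and> t Y1 (z s) \<noteq> 0"
  proof eventually_elim
    case (elim s)
    have "z s \<notin> Y1" using v[OF elim(2)] by (simp add: Y1_def mem_rat_quad_divisor z_def)
    hence "z s \<in> U - \<Union>N" using elim P(2,6) by auto
    moreover have "regular_at f (z s)" using reg elim P U by blast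
    ultimately have "f (z s) = u (z s) * (\<Prod>Y\<in>N. t Y (z s) powi D Y)" by (rule N(5))
    also have "(\<Prod>Y\<in>N. t Y (z s) powi D Y) = t Y1 (z s) powi D Y1 * (\<Prod>Y\<in>N - {Y1}. t Y (z s) powi D Y)"
      by (rule prod.remove[OF N(1) Y1N])
    finally have "f (z s) = R (z s) * t Y1 (z s) powi D Y1" by (simp add: R_def)
    moreover have "t Y1 (z s) \<noteq> 0"
      using t_zero[OF Y1N] \<open>z s \<notin> Y1\<close> \<open>z s \<in> U - \<Union>N\<close> by blast
    ultimately show ?case by blast
  qed
  have limf: "((\<lambda>s. f (z s)) \<longlongrightarrow> f y) (at 0)" by (intro lim mv_holomorphic_on_continuous[OF hol yt])
  define n where "n = nat \<bar>D Y1\<bar>"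
  have n: "n > 0" using l by (auto simp: n_def Y1_def)
  have limt: "((\<lambda>s. t Y1 (z s) ^ n) \<longlongrightarrow> 0) (at 0)"
    using tendsto_power[OF lim[OF tc[OF Y1N]], of n] n by (simp add: ty zero_power)
  show False
  proof (cases "D Y1 > 0")
    case True
    hence D1: "D Y1 = int n" by (simp add: n_def)
    from ev have "\<forall>\<^sub>F s in at 0. R (z s) * t Y1 (z s) ^ n = f (z s)"
      by eventually_elim (simp add: D1)
    from Lim_transform_eventually[OF tendsto_mult[OF limR limt] this] have "f y = 0"
      using tendsto_unique[OF _ limf] by simp
    thus False using Q P by blast
  next
    case False
    hence D1: "D Y1 = - int n" by (simp add: n_def)
    from ev have "\<forall>\<^sub>F s in at 0. f (z s) * t Y1 (z s) ^ n = R (z s)"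
      by eventually_elim (simp add: D1 power_int_minus)
    from Lim_transform_eventually[OF tendsto_mult[OF limf limt] this] have "R y = 0"
      using tendsto_unique[OF _ limR] by simp
    thus False using R0 by blast
  qed
qed

theorem theorem8p3:
  fixes chi12 :: "complex^2^2 \<Rightarrow> complex"
  assumes "siegel_cusp_form 12 chi12"
    and "\<exists>Z\<in>siegel_H2. chi12 Z \<noteq> 0"
  shows "\<not> borcherds_lift (\<lambda>z. chi12 (sym_mat z))"
proof
  interpret siegel_form_12 "\<lambda>z1 z2 z3. chi12 (sym_mat (vec3 z1 z2 z3))"
    by (rule siegel_cusp_form_12_symmetries[OF assms])
  assume "borcherds_lift (\<lambda>z. chi12 (sym_mat z))"
  then obtain I and c :: "(real^5) \<times> real \<Rightarrow> int" where I: "finite I" "I \<subseteq> heegner_index"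
    and div: "has_divisor tube (\<lambda>z. chi12 (sym_mat z)) (\<lambda>Y. \<Sum>(\<alpha>, n)\<in>I. c (\<alpha>, n) * heegner \<alpha> n Y)"
    unfolding borcherds_lift_def by blast
  define D where "D = (\<lambda>Y. \<Sum>(\<alpha>, n)\<in>I. c (\<alpha>, n) * heegner \<alpha> n Y)"
  have hol: "mv_holomorphic_on (\<lambda>z. chi12 (sym_mat z)) tube"
    using assms by (simp add: siegel_cusp_form_def siegel_modular_form_def)
  have comp': "\<exists>l. l \<in> dual_L \<and> quad_q l < 0 \<and> Y = rat_quad_divisor l" if nz: "D Y \<noteq> 0" for Y
  proof -
    obtain p where p: "p \<in> I" "(case p of (\<alpha>, n) \<Rightarrow> c (\<alpha>, n) * heegner \<alpha> n Y) \<noteq> 0"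
      using nz unfolding D_def by (rule sum.not_neutral_contains_not_neutral)
    obtain \<alpha> n where "p = (\<alpha>, n)" by (cases p)
    with p have \<alpha>: "(\<alpha>, n) \<in> I" "heegner \<alpha> n Y \<noteq> 0" by auto
    have "{l. l - \<alpha> \<in> lattice_L \<and> quad_q l = n \<and> rat_quad_divisor l = Y} \<noteq> {}"
    proof
      assume "{l. l - \<alpha> \<in> lattice_L \<and> quad_q l = n \<and> rat_quad_divisor l = Y} = {}"
      hence "heegner \<alpha> n Y = 0" by (simp only: heegner_def card.empty of_nat_0)
      thus False using \<alpha> by simp
    qed
    then obtain l where l: "l - \<alpha> \<in> lattice_L" "quad_q l = n" "rat_quad_divisor l = Y" by blast
    have "(\<alpha>, n) \<in> heegner_index" using \<alpha> I by blast
    hence "\<alpha> \<in> dual_L" "n < 0" by (auto simp: heegner_index_def)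
    moreover have "l \<in> dual_L"
      using dual_L_int_combination(1)[OF lattice_subset_dual[OF l(1)] \<open>\<alpha> \<in> dual_L\<close>, of "-1"] by simp
    ultimately show ?thesis using l by blast
  qed
  \<comment> \<open>The empty set may carry a coefficient without harm: it meets no \<open>U\<close>
    and so does not enter the local product formula.\<close>
  have empty: "Y = {}" if Y: "D Y \<noteq> 0" for Y
  proof (rule ccontr)
    assume "Y \<noteq> {}"
    obtain l where l: "l \<in> dual_L" "quad_q l < 0" "Y = rat_quad_divisor l" using comp'[OF Y] by blast
    have "l \<noteq> 0" using l by (auto simp: quad_q_eq)
    then obtain r where r: "r > 0" "primitive (r *\<^sub>R l)" using primitive_exists l(1) by blast
    define l0 where "l0 = r *\<^sub>R l"
    have l0: "primitive l0" "quad_q l0 < 0" "Y = rat_quad_divisor l0"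
      using r l rat_quad_divisor_scale[of r l] by (auto simp: l0_def quad_q_scale mult_pos_neg)
    obtain l1 M where l1: "primitive l1" "quad_q l1 = quad_q l0" "M > (0::real)"
        "\<And>\<tau>. \<tau> \<in> uhp \<Longrightarrow> vec3 \<tau> 0 (of_real M * \<tau>) \<in> rat_quad_divisor l1"
      by (rule standard_vector[of l0]) (use l0 in \<open>auto simp: primitive_def\<close>)
    have "\<i> \<in> uhp" by (simp add: uhp_def)
    hence ne: "rat_quad_divisor l1 \<noteq> {}" using l1(4) by blast
    have "D (rat_quad_divisor l1) = D Y"
      unfolding D_def l0(3)
    proof (intro sum.cong refl, clarify)
      fix \<alpha> n assume "(\<alpha>, n) \<in> I"
      hence idx: "(\<alpha>, n) \<in> heegner_index" using I by blast
      show "c (\<alpha>, n) * heegner \<alpha> n (rat_quad_divisor l1) = c (\<alpha>, n) * heegner \<alpha> n (rat_quad_divisor l0)"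
        using heegner_primitive[OF l1(1) _ ne idx] heegner_primitive[OF l0(1,2) _ idx] l0 l1(2) \<open>Y \<noteq> {}\<close> by simp
    qed
    hence D1: "D (rat_quad_divisor l1) \<noteq> 0" using Y by simp
    have "chi12 (sym_mat (vec3 \<tau> 0 (of_real M * \<tau>))) = 0" if "\<tau> \<in> uhp" for \<tau>
    proof (rule divisor_component_in_zero_set[OF hol div[folded D_def] _ _ D1 l1(4)[OF that]])
      show "\<exists>l. quad_q l < 0 \<and> Z = rat_quad_divisor l" if "D Z \<noteq> 0" for Z using comp'[OF that] by blast
      show "quad_q l1 < 0" using l0 l1 by simp
    qed
    thus False using nonzero_on_line[OF l1(3)] by blast
  qed
  obtain z1 z2 z3 where z: "(z1, z2, z3) \<in> siegel_dom" "chi12 (sym_mat (vec3 z1 z2 z3)) = 0"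
    using has_zero by blast
  define x where "x = vec3 z1 z2 z3"
  have xt: "x \<in> tube" using z by (simp add: x_def vec3_in_tube)
  obtain U t u where U: "x \<in> U" and
    "let N = {Y. D Y \<noteq> 0 \<and> Y \<inter> U \<noteq> {}} in
           finite N \<and> (\<forall>Y\<in>N. reduced_equation U Y (t Y)) \<and>
           mv_holomorphic_on u U \<and> (\<forall>z\<in>U. u z \<noteq> 0) \<and>
           (\<forall>z\<in>U - \<Union>N. regular_at (\<lambda>z. chi12 (sym_mat z)) z \<longrightarrow>
              chi12 (sym_mat z) = u z * (\<Prod>Y\<in>N. t Y z powi D Y))"
    using div xt unfolding has_divisor_def D_def[symmetric] by blast
  moreover have "{Y. D Y \<noteq> 0 \<and> Y \<inter> U \<noteq> {}} = {}" using empty by blast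
  moreover have "regular_at (\<lambda>z. chi12 (sym_mat z)) x"
    unfolding regular_at_def using hol open_tube xt by blast
  \<comment> \<open>The product over no components is 1, so the form equals the unit
    \<open>u\<close> at its own zero x.\<close>
  ultimately have "chi12 (sym_mat x) = u x" "u x \<noteq> 0" by (simp_all add: Let_def)
  thus False using z by (simp add: x_def)
qed

end
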